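(* Let $\gamma>2$. For every $\varepsilon>0$ let $u_0=u_0^\varepsilon,\ u_1=u_1^\varepsilon\in\mathcal A_\varepsilon$ be such that the family $(I_0^\varepsilon)_\varepsilon$ satisfies assumption (H) and $u_1$ is a minimizer of $\mathcal F_\varepsilon^{\tau,\gamma}(\cdot,u_0)$. Suppose furthermore that $I_0$ is a discrete octagon. Then there exists $\bar\varepsilon>0$ such that for every $\varepsilon\le\bar\varepsilon$ the set $I_1$ is a discrete octagon contained in $I_0$, and $\partial^+I_1=Z_1$.
   Context: Fix $k\in(1/3,1)$, $\zeta>0$; for $\varepsilon>0$ let $\tau=\zeta\varepsilon$. $\mathbb N=\{1,2,\dots\}$; $e_1,e_2$ is the standard basis of $\mathbb R^2$. $\mathcal A_\varepsilon$ is the set of functions $u:\varepsilon\mathbb Z^2\to\{-1,0,1\}$ with $\#\{p:u(p)=0\}<\infty$. For $u\in\mathcal A_\varepsilon$, $$\mathcal E_\varepsilon(u)=\sum\varepsilon\big(1-u(p)u(q)-k(1-(u(p)u(q))^2)\big),$$ the sum being over unordered pairs $\{p,q\}\subset\varepsilon\mathbb Z^2$ with $|p-q|=\varepsilon$. Put $I_u=\{u=1\}$, $Z_u=\{u=0\}$, $I_j=I_j^\varepsilon=I_{u_j}$, $Z_j=Z_{u_j}$. For $I\subset\varepsilon\mathbb Z^2$, $d_1^\varepsilon(p,\partial I)=\inf\{\|p-q\|_1:q\in I\}$ if $p\notin I$, and $=\inf\{\|p-q\|_1:q\in\varepsilon\mathbb Z^2\setminus I\}$ if $p\in I$. $\partial^+I=\{p\in\varepsilon\mathbb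 Z^2\setminus I:d_1^\varepsilon(p,\partial I)=\varepsilon\}$. For $u,w\in\mathcal A_\varepsilon$, $$\mathcal F_\varepsilon^{\tau,\gamma}(u,w)=\mathcal E_\varepsilon(u)+\frac1\tau\Big(\sum_{p\in I_u\triangle I_w}\varepsilon^2d_1^\varepsilon(p,\partial I_w)+\varepsilon^\gamma|\#Z_u-\#Z_w|\Big);$$ minimizers are taken over $\mathcal A_\varepsilon$. An octagon is a convex octagon in $\mathbb R^2$ whose sides are parallel to $e_1,e_2,e_1+e_2$ or $e_1-e_2$ (sides of zero length allowed). A discrete octagon is a set $I\subset\varepsilon\mathbb Z^2$ of the form $I=A\cap\varepsilon\mathbb Z^2$ with $A$ an octagon. A set $I\subset\varepsilon\mathbb Z^2$ is strongly connected if any two of its points are joined inside $I$ by a finite path whose consecutive points have $\ell^1$-distance $\varepsilon$. A staircase set is a strongly connected set which is horizontally and vertically convex (if $p,\,p+n\varepsilon e_i\in I$, $n\in\mathbb N$, $i\in\{1,2\}$, then all lattice points of the segment between them lie in $I$). Its external slices are $\mathscr P_1$ (lowest horizontal slice), $\mathscr P_2$ (leftmost vertical slice), $\mathscr P_3$ (highest horizontal slice), $\mathscr P_4$ (rightmost vertical slice). Assumption (H): there exist constants $\bar R,\bar c>0$ such that for every $\varepsilon>0$ the set $I_0^\varepsilon$ is a staircase set with $\min_{i=1,\dots,4}\#\mathscr P_i^\varepsilon\ge\bar c/\varepsilon$, and all the $I_0^\varepsilon$ are contained in a ball of radius $\bar R$. *)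

theory Defs
  imports "HOL-Analysis.Analysis"
begin

type_synonym point = "real \<times> real"

definition lattice_pts :: "real \<Rightarrow> point set" where
  "lattice_pts \<epsilon> = {(\<epsilon> * of_int i, \<epsilon> * of_int j) | i j :: int. True}"

definition l1norm :: "point \<Rightarrow> real" where
  "l1norm x = \<bar>fst x\<bar> + \<bar>snd x\<bar>"

definition basis_dirs :: "point set" where
  "basis_dirs = {(1, 0), (0, 1)}"

text \<open>A spin field is a function on the lattice; as usual for extensional function
  spaces it takes the value \<^term>\<open>undefined\<close> off the lattice.\<close>

definition ones :: "real \<Rightarrow> (point \<Rightarrow> real) \<Rightarrow> point set" where
  "ones \<epsilon> u = {p \<in> lattice_pts \<epsilon>. u p = 1}"

definition zeros :: "real \<Rightarrow> (point \<Rightarrow> real) \<Rightarrow> point set" where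
  "zeros \<epsilon> u = {p \<in> lattice_pts \<epsilon>. u p = 0}"

definition admissible :: "real \<Rightarrow> (point \<Rightarrow> real) set" where
  "admissible \<epsilon> = {u \<in> lattice_pts \<epsilon> \<rightarrow>\<^sub>E {-1, 0, 1}. finite (zeros \<epsilon> u)}"

definition bonds :: "real \<Rightarrow> point set set" where
  "bonds \<epsilon> = {{p, q} | p q. p \<in> lattice_pts \<epsilon> \<and> q \<in> lattice_pts \<epsilon> \<and> dist p q = \<epsilon>}"

text \<open>For a bond \<open>B = {p, q}\<close> with \<open>p \<noteq> q\<close>, \<^term>\<open>prod u B\<close> is \<open>u p * u q\<close>. All summands
  are nonnegative when \<open>k < 1\<close>, so the possibly infinite sum is taken in \<^typ>\<open>ennreal\<close>.\<close>

definition energy :: "real \<Rightarrow> real \<Rightarrow> (point \<Rightarrow> real) \<Rightarrow> ennreal" where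
  "energy k \<epsilon> u =
     (\<Sum>\<^sub>\<infinity>B\<in>bonds \<epsilon>. ennreal (\<epsilon> * (1 - prod u B - k * (1 - (prod u B)\<^sup>2))))"

text \<open>The infimum is taken in \<^typ>\<open>ennreal\<close>, so that it is infinite over the empty set.\<close>

definition dist_bdry :: "real \<Rightarrow> point \<Rightarrow> point set \<Rightarrow> ennreal" where
  "dist_bdry \<epsilon> p I =
     (if p \<in> I then (INF q \<in> lattice_pts \<epsilon> - I. ennreal (l1norm (p - q)))
      else (INF q \<in> I. ennreal (l1norm (p - q))))"

definition outer_bdry :: "real \<Rightarrow> point set \<Rightarrow> point set" where
  "outer_bdry \<epsilon> I = {p \<in> lattice_pts \<epsilon> - I. dist_bdry \<epsilon> p I = ennreal \<epsilon>}"

definition functional ::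
  "real \<Rightarrow> real \<Rightarrow> real \<Rightarrow> real \<Rightarrow> (point \<Rightarrow> real) \<Rightarrow> (point \<Rightarrow> real) \<Rightarrow> ennreal" where
  "functional k \<tau> \<gamma> \<epsilon> u w =
     energy k \<epsilon> u + ennreal (1 / \<tau>) *
       ((\<Sum>\<^sub>\<infinity>p\<in>sym_diff (ones \<epsilon> u) (ones \<epsilon> w). ennreal (\<epsilon>\<^sup>2) * dist_bdry \<epsilon> p (ones \<epsilon> w))
        + ennreal (\<epsilon> powr \<gamma> * \<bar>real (card (zeros \<epsilon> u)) - real (card (zeros \<epsilon> w))\<bar>))"

definition minimizer ::
  "real \<Rightarrow> real \<Rightarrow> real \<Rightarrow> real \<Rightarrow> (point \<Rightarrow> real) \<Rightarrow> (point \<Rightarrow> real) \<Rightarrow> bool" where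
  "minimizer k \<tau> \<gamma> \<epsilon> w u \<longleftrightarrow>
     u \<in> admissible \<epsilon> \<and>
     (\<forall>v\<in>admissible \<epsilon>. functional k \<tau> \<gamma> \<epsilon> u w \<le> functional k \<tau> \<gamma> \<epsilon> v w)"

text \<open>A convex polygon all of whose nondegenerate sides have one of the four directions;
  it then has at most two sides per direction, and the missing ones among the eight
  are the sides of zero length. Segments in these directions and single points are included.\<close>

definition octagon :: "point set \<Rightarrow> bool" where
  "octagon A \<longleftrightarrow>
     polytope A \<and> A \<noteq> {} \<and>
     (\<forall>S. S edge_of A \<longrightarrow>
        (\<exists>d\<in>{(1, 0), (0, 1), (1, 1), (1, -1)}. \<forall>x\<in>S. \<forall>y\<in>S. \<exists>t::real. y - x = t *\<^sub>R d))"

definition discrete_octagon :: "real \<Rightarrow> point set \<Rightarrow> bool" where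
  "discrete_octagon \<epsilon> I \<longleftrightarrow> (\<exists>A. octagon A \<and> I = A \<inter> lattice_pts \<epsilon>)"

definition strongly_connected :: "real \<Rightarrow> point set \<Rightarrow> bool" where
  "strongly_connected \<epsilon> I \<longleftrightarrow>
     (\<forall>p\<in>I. \<forall>q\<in>I. (p, q) \<in> {(x, y). x \<in> I \<and> y \<in> I \<and> l1norm (x - y) = \<epsilon>}\<^sup>*)"

definition hv_convex :: "real \<Rightarrow> point set \<Rightarrow> bool" where
  "hv_convex \<epsilon> I \<longleftrightarrow>
     (\<forall>p. \<forall>n\<ge>1. \<forall>e\<in>basis_dirs. p \<in> I \<and> p + (real n * \<epsilon>) *\<^sub>R e \<in> I \<longrightarrow>
        closed_segment p (p + (real n * \<epsilon>) *\<^sub>R e) \<inter> lattice_pts \<epsilon> \<subseteq> I)"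

definition staircase :: "real \<Rightarrow> point set \<Rightarrow> bool" where
  "staircase \<epsilon> I \<longleftrightarrow> I \<subseteq> lattice_pts \<epsilon> \<and> strongly_connected \<epsilon> I \<and> hv_convex \<epsilon> I"

text \<open>The external slices in the order lowest, leftmost, highest, rightmost.\<close>

definition external_slices :: "point set \<Rightarrow> point set list" where
  "external_slices I =
     [{p \<in> I. \<forall>q\<in>I. snd p \<le> snd q},
      {p \<in> I. \<forall>q\<in>I. fst p \<le> fst q},
      {p \<in> I. \<forall>q\<in>I. snd q \<le> snd p},
      {p \<in> I. \<forall>q\<in>I. fst q \<le> fst p}]"

definition assumption_H :: "(real \<Rightarrow> point set) \<Rightarrow> bool" where
  "assumption_H I \<longleftrightarrow>
     (\<exists>R>0. \<exists>c>0. \<exists>x.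
        \<forall>\<epsilon>>0. staircase \<epsilon> (I \<epsilon>) \<and>
          (\<forall>P\<in>set (external_slices (I \<epsilon>)). c / \<epsilon> \<le> real (card P)) \<and>
          I \<epsilon> \<subseteq> ball x R)"

end

theory Submission
  imports Defs "HOL-Real_Asymp.Real_Asymp"
begin

text \<open>The bond energy is submodular on configurations with values in \<open>{-1, 0,
  1}\<close>, while the number of zeros and the dissipation are modular. A minimizer
  \<open>u\<close> can therefore be compared with octagonal configurations through its pointwise
  maximum and minimum with them: adding a partial layer to a side of an octagon costs more energy
  than adding the whole layer, so octagons contained in \<open>u\<close> can be enlarged, and
  octagons containing \<open>u\<close> reduced, one layer at a time. Reducing from outside gives
  \<open>I_1 \<subseteq> I_0\<close>. Conversely the dissipation forces \<open>u\<close> to contain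
  some deep square; completing a layer costs a bounded energy but gains dissipation proportional to
  the length and depth of the layer, so the square grows into an octagon \<open>b\<close> at
  distance of order \<open>\<epsilon> powr (-1/2)\<close> lattice steps from the boundary of
  \<open>I_0\<close>. If \<open>b\<close> is maximal and \<open>h\<close> is the smallest octagon
  around \<open>I_1\<close>, then exchanging an outer layer of \<open>h\<close> for the next layer
  of \<open>b\<close> preserves energy and number of zeros and lowers the dissipation, so \<open>h =
  b\<close>.\<close>

text \<open>With \<open>\<beta> = 1 - k\<close>, the bound \<open>k > 1/3\<close> makes
  \<open>2 - 3 * \<beta>\<close> positive: up to the charge \<open>s\<close>, this is the price of a
  new 1 on a flat side that touches a -1 instead of a protecting 0. For \<open>\<beta>\<close> above
  1/2, however, a few unprotected 1s cost less than a complete flat layer. Partial flat layers are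
  thus controlled by energy only from some number \<open>\<Lambda>\<close> of cells on; sparser ones
  are handled through the dissipation. On diagonal sides a single cell already costs at least as
  much as the whole layer. The penalty on the number of zeros may act in either direction. Since
  \<open>\<gamma> > 2\<close>, its weight in lattice units tends to 0, and it enters as a small
  energy \<open>s\<close> per zero. The scale \<open>\<epsilon> powr (-1/2)\<close> is the depth
  \<open>m\<close> at which the gain \<open>\<epsilon> / \<zeta> * m\<^sup>2\<close> of a layer of
  length and depth \<open>m\<close> balances its bounded energy. Growth of the core stops there. The
  exchange of layers goes further because a complete layer costs the same wherever it is attached:
  \<open>2 * \<beta>\<close> on a flat side, \<open>2 * \<beta> + s\<close> on a diagonal
  one.\<close>

type_synonym cell = "int \<times> int"

text \<open>For spins in {-1, 0, 1} and \<open>\<beta> = 1 - k\<close> this is the summand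
  \<open>1 - a * b - k * (1 - (a * b)\<^sup>2)\<close> of the energy.\<close>

definition bond_cost :: "real \<Rightarrow> int \<Rightarrow> int \<Rightarrow> real" where
  "bond_cost \<beta> a b = (if a = 0 \<or> b = 0 then \<beta> else if a = b then 0 else 2)"

definition grid :: "int \<Rightarrow> cell set" where
  "grid N = {-N..N} \<times> {-N..N}"

text \<open>The strict inequalities keep every bond of positive cost inside the sum over
  \<open>grid N\<close>, although a site is charged only with its right and its upper bond.\<close>

definition conf :: "int \<Rightarrow> (cell \<Rightarrow> int) \<Rightarrow> bool" where
  "conf N u \<longleftrightarrow> (\<forall>p. u p \<in> {-1, 0, 1}) \<and>
     (\<forall>x y. u (x, y) \<noteq> -1 \<longrightarrow> \<bar>x\<bar> < N \<and> \<bar>y\<bar> < N)"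

definition site_en :: "real \<Rightarrow> real \<Rightarrow> (cell \<Rightarrow> int) \<Rightarrow> cell \<Rightarrow> real" where
  "site_en \<beta> s u p = bond_cost \<beta> (u p) (u (p + (1, 0))) + bond_cost \<beta> (u p) (u (p + (0, 1)))
     + s * of_bool (u p = 0)"

definition en :: "real \<Rightarrow> real \<Rightarrow> int \<Rightarrow> (cell \<Rightarrow> int) \<Rightarrow> real" where
  "en \<beta> s N u = (\<Sum>p\<in>grid N. site_en \<beta> s u p)"

definition join :: "(cell \<Rightarrow> int) \<Rightarrow> (cell \<Rightarrow> int) \<Rightarrow> cell \<Rightarrow> int" where
  "join u v p = max (u p) (v p)"

definition meet :: "(cell \<Rightarrow> int) \<Rightarrow> (cell \<Rightarrow> int) \<Rightarrow> cell \<Rightarrow> int" where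
  "meet u v p = min (u p) (v p)"

section \<open>Submodularity of the lattice energy\<close>

lemma finite_grid [simp]: "finite (grid N)"
  by (simp add: grid_def)

lemma bond_cost_commute: "bond_cost \<beta> a b = bond_cost \<beta> b a"
  by (auto simp: bond_cost_def)

lemma bond_cost_simps:
  "bond_cost \<beta> 0 b = \<beta>" "bond_cost \<beta> a 0 = \<beta>" "bond_cost \<beta> 1 1 = 0"
  "bond_cost \<beta> (-1) (-1) = 0" "bond_cost \<beta> 1 (-1) = 2" "bond_cost \<beta> (-1) 1 = 2"
  by (simp_all add: bond_cost_def)

lemma bond_cost_nonneg: "0 \<le> \<beta> \<Longrightarrow> 0 \<le> bond_cost \<beta> a b"
  by (auto simp: bond_cost_def)

text \<open>The only critical case pairs \<open>0, 0\<close> with \<open>1, -1\<close>: the total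
  \<open>\<beta> + 2\<close> becomes \<open>2 * \<beta>\<close>, which is no larger exactly when
  \<open>\<beta> \<le> 2\<close>.\<close>

lemma bond_cost_submodular:
  assumes "0 \<le> \<beta>" "\<beta> \<le> 2"
    and "a \<in> {-1, 0, 1}" "b \<in> {-1, 0, 1}" "c \<in> {-1, 0, 1}" "d \<in> {-1, 0, 1}"
  shows "bond_cost \<beta> (max a c) (max b d) + bond_cost \<beta> (min a c) (min b d)
           \<le> bond_cost \<beta> a b + bond_cost \<beta> c d"
proof -
  have "a = -1 \<or> a = 0 \<or> a = 1" "b = -1 \<or> b = 0 \<or> b = 1"
    "c = -1 \<or> c = 0 \<or> c = 1" "d = -1 \<or> d = 0 \<or> d = 1"
    using assms by auto
  then show ?thesis
    by (elim disjE; hypsubst; simp add: bond_cost_simps assms(1,2))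
qed

text \<open>At a single site maximum and minimum merely permute the two values, so the number of
  zeros is modular and \<open>s\<close> may have either sign; the bond terms are submodular one by
  one.\<close>

lemma en_submodular:
  assumes "0 \<le> \<beta>" "\<beta> \<le> 2" "conf N u" "conf N v"
  shows "en \<beta> s N (join u v) + en \<beta> s N (meet u v) \<le> en \<beta> s N u + en \<beta> s N v"
proof -
  have "site_en \<beta> s (join u v) p + site_en \<beta> s (meet u v) p \<le> site_en \<beta> s u p + site_en \<beta> s v p" for p
  proof -
    have val: "u q \<in> {-1, 0, 1}" "v q \<in> {-1, 0, 1}" for q
      using assms unfolding conf_def by blast+
    have "(of_bool (join u v p = 0) + of_bool (meet u v p = 0) :: real)
        = of_bool (u p = 0) + of_bool (v p = 0)"
      by (auto simp: join_def meet_def)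
    then have "s * of_bool (join u v p = 0) + s * of_bool (meet u v p = 0)
        = s * of_bool (u p = 0) + s * of_bool (v p = 0)"
      by (metis distrib_left)
    moreover note
      bond_cost_submodular[OF assms(1,2) val(1)[of p] val(1)[of "p + (1,0)"] val(2)[of p] val(2)[of "p + (1,0)"]]
      bond_cost_submodular[OF assms(1,2) val(1)[of p] val(1)[of "p + (0,1)"] val(2)[of p] val(2)[of "p + (0,1)"]]
    ultimately show ?thesis
      unfolding site_en_def by (simp add: join_def meet_def)
  qed
  then show ?thesis
    unfolding en_def sum.distrib[symmetric] by (intro sum_mono)
qed

lemma conf_join: "conf N u \<Longrightarrow> conf N v \<Longrightarrow> conf N (join u v)"
  by (auto simp: conf_def join_def max_def split: if_splits)

lemma conf_meet: "conf N u \<Longrightarrow> conf N v \<Longrightarrow> conf N (meet u v)"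
  by (auto simp: conf_def meet_def min_def split: if_splits)

lemma sum_of_bool_card:
  "finite G \<Longrightarrow> P \<subseteq> G \<Longrightarrow> (\<Sum>p\<in>G. c * of_bool (p \<in> P)) = c * real (card P)"
  by (simp add: sum_distrib_left[symmetric] Int_absorb1)

subsection \<open>Adding cells along a flat or a diagonal side\<close>

text \<open>Counts the horizontal bonds inside a row of cells, each named by its left end; the
  maximum of \<open>A\<close> is not such an end.\<close>

lemma card_succ_image: "finite A \<Longrightarrow> A \<noteq> {} \<Longrightarrow> card {x \<in> A. x + 1 \<in> A} + 1 \<le> card (A :: int set)"
proof -
  assume A: "finite A" "A \<noteq> {}"
  have "{x \<in> A. x + 1 \<in> A} \<subseteq> A - {Max A}"
    using Max_ge[OF A(1)] by force
  then have "card {x \<in> A. x + 1 \<in> A} \<le> card (A - {Max A})"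
    using A by (intro card_mono) auto
  moreover have "card (A - {Max A}) = card A - 1" "0 < card A"
    using A by (auto simp: card_gt_0_iff)
  ultimately show ?thesis by linarith
qed

text \<open>Counts the horizontal bonds that touch a row of cells; the additional one enters the
  minimum of \<open>A\<close> from the left.\<close>

lemma card_succ_union: "finite A \<Longrightarrow> A \<noteq> {} \<Longrightarrow> card A + 1 \<le> card ({x. x \<in> A \<or> x + 1 \<in> A} :: int set)"
proof -
  assume A: "finite A" "A \<noteq> {}"
  have fin: "finite {x. x \<in> A \<or> x + 1 \<in> A}"
  proof -
    have "{x. x \<in> A \<or> x + 1 \<in> A} \<subseteq> A \<union> (\<lambda>x. x - 1) ` A" by force
    then show ?thesis using A by (meson finite_UnI finite_imageI finite_subset)
  qed
  have "Min A - 1 \<notin> A" using Min_le[OF A(1), of "Min A - 1"] by auto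
  moreover have "insert (Min A - 1) A \<subseteq> {x. x \<in> A \<or> x + 1 \<in> A}"
    using A by auto
  moreover have "card (insert (Min A - 1) A) = card A + 1"
    using calculation(1) A(1) by simp
  ultimately show ?thesis
    using card_mono[OF fin, of "insert (Min A - 1) A"] by linarith
qed

text \<open>An exact balance over single bonds. Row \<open>t\<close> is the last row of 1s and row
  \<open>t + 1\<close> its zeros; \<open>A\<close> and \<open>Z\<close> are the cells raised in the
  rows \<open>t + 1\<close> and \<open>t + 2\<close>. Bonds inside or below \<open>A\<close> drop
  from \<open>\<beta>\<close> to 0, bonds along or above \<open>Z\<close> rise from 0 to
  \<open>\<beta>\<close>, and a cell of \<open>A\<close> without a zero above raises its upper bond
  from \<open>\<beta>\<close> to 2. Under a cell of \<open>Z\<close> the bond costs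
  \<open>\<beta>\<close> before and after.\<close>

lemma en_flat_side:
  fixes t lo hi :: int and A Z :: "int set"
  assumes "lo < hi"
    and one: "\<And>x. lo < x \<Longrightarrow> x < hi \<Longrightarrow> v (x, t) = 1"
    and zero: "\<And>x. lo \<le> x \<Longrightarrow> x \<le> hi \<Longrightarrow> v (x, t + 1) = 0"
    and minus: "\<And>x. v (x, t + 2) = -1" "\<And>x. v (x, t + 3) = -1"
    and A: "A \<subseteq> {lo<..<hi}" and Z: "Z \<subseteq> {lo<..<hi}"
    and N: "-N \<le> t" "t + 2 \<le> N" "-N \<le> lo" "hi \<le> N"
    and w: "\<And>x y. w (x, y) = (if y = t + 1 \<and> x \<in> A then 1 else if y = t + 2 \<and> x \<in> Z then 0 else v (x, y))"
  shows "en \<beta> s N w = en \<beta> s N v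
     - \<beta> * card {x \<in> A. x + 1 \<in> A} + \<beta> * card {x. x \<in> Z \<or> x + 1 \<in> Z}
     + (\<beta> + s) * card Z - (\<beta> + s) * card A + (2 - \<beta>) * card (A - Z)"
proof -
  \<comment> \<open>Bonds are indexed by their left or lower ends: \<open>?h1\<close>,
    \<open>?h2\<close> are horizontal, \<open>?v0\<close>, \<open>?v1\<close>, \<open>?v2\<close>
    vertical. The new zeros are booked together with \<open>?v2\<close>, the zeros that disappear
    with \<open>?a\<close>.\<close>
  let ?h1 = "(\<lambda>x. (x, t + 1)) ` {x \<in> A. x + 1 \<in> A}"
  let ?h2 = "(\<lambda>x. (x, t + 2)) ` {x. x \<in> Z \<or> x + 1 \<in> Z}"
  let ?v0 = "(\<lambda>x. (x, t)) ` A"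
  let ?v1 = "(\<lambda>x. (x, t + 1)) ` (A - Z)"
  let ?v2 = "(\<lambda>x. (x, t + 2)) ` Z"
  let ?a = "(\<lambda>x. (x, t + 1)) ` A"
  have others: "(x, y) \<in> ?h1 \<longleftrightarrow> y = t + 1 \<and> x \<in> A \<and> x + 1 \<in> A"
      "(x, y) \<in> ?h2 \<longleftrightarrow> y = t + 2 \<and> (x \<in> Z \<or> x + 1 \<in> Z)"
      "(x, y) \<in> ?v0 \<longleftrightarrow> y = t \<and> x \<in> A" "(x, y) \<in> ?v1 \<longleftrightarrow> y = t + 1 \<and> x \<in> A \<and> x \<notin> Z"
      "(x, y) \<in> ?v2 \<longleftrightarrow> y = t + 2 \<and> x \<in> Z" "(x, y) \<in> ?a \<longleftrightarrow> y = t + 1 \<and> x \<in> A" for x y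
    by auto
  have pw: "site_en \<beta> s w p = site_en \<beta> s v p + (- \<beta>) * of_bool (p \<in> ?h1) + \<beta> * of_bool (p \<in> ?h2)
      + (- \<beta>) * of_bool (p \<in> ?v0) + (2 - \<beta>) * of_bool (p \<in> ?v1) + (\<beta> + s) * of_bool (p \<in> ?v2)
      + (- s) * of_bool (p \<in> ?a)" for p
  proof -
    obtain x y where p: "p = (x, y)" by force
    have mem: "x \<in> A \<Longrightarrow> lo < x \<and> x < hi" "x + 1 \<in> A \<Longrightarrow> lo < x + 1 \<and> x + 1 < hi"
        "x \<in> Z \<Longrightarrow> lo < x \<and> x < hi" "x + 1 \<in> Z \<Longrightarrow> lo < x + 1 \<and> x + 1 < hi"
      using A Z by auto
    consider "y = t" | "y = t + 1" | "y = t + 2" | "y \<noteq> t \<and> y \<noteq> t + 1 \<and> y \<noteq> t + 2" by auto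
    then show ?thesis
    proof cases
      case 1
      have o: "(y = t + 1) = False" "(y = t + 2) = False" "(y = t) = True" using 1 by auto
      have z: "x \<in> A \<Longrightarrow> v (x, y) = 1" "x \<in> A \<Longrightarrow> v (x, y + 1) = 0"
        using mem(1) one[of x] zero[of x] 1 by auto
      have wv: "w (x, y) = v (x, y)" "w (x + 1, y) = v (x + 1, y)"
          "w (x, y + 1) = (if x \<in> A then 1 else v (x, y + 1))"
        unfolding w using 1 by auto
      show ?thesis
        unfolding p
        by (cases "x \<in> A") (simp_all add: site_en_def others wv bond_cost_simps z o)
    next
      case 2
      have o: "(y = t + 1) = True" "(y = t + 2) = False" "(y = t) = False" using 2 by auto
      have z: "x \<in> A \<Longrightarrow> v (x, y) = 0" "x \<in> A \<Longrightarrow> v (x + 1, y) = 0"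
          "x + 1 \<in> A \<Longrightarrow> v (x, y) = 0" "x + 1 \<in> A \<Longrightarrow> v (x + 1, y) = 0" "x \<in> Z \<Longrightarrow> v (x, y) = 0"
        using mem zero[of x] zero[of "x + 1"] 2 by force+
      have wv: "w (x, y) = (if x \<in> A then 1 else v (x, y))" "v (x, y + 1) = -1"
          "w (x + 1, y) = (if x + 1 \<in> A then 1 else v (x + 1, y))"
          "w (x, y + 1) = (if x \<in> Z then 0 else -1)"
        unfolding w using 2 minus(1)[of x] by (auto simp: algebra_simps)
      show ?thesis
        unfolding p
        by (cases "x \<in> A"; cases "x + 1 \<in> A"; cases "x \<in> Z")
          (simp_all add: site_en_def others wv bond_cost_simps z o)
    next
      case 3
      have o: "(y = t + 1) = False" "(y = t + 2) = True" "(y = t) = False" using 3 by auto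
      have wv: "w (x, y) = (if x \<in> Z then 0 else -1)" "w (x + 1, y) = (if x + 1 \<in> Z then 0 else -1)"
          "w (x, y + 1) = -1" "v (x, y) = -1" "v (x + 1, y) = -1" "v (x, y + 1) = -1"
        unfolding w using 3 minus[of x] minus[of "x + 1"] by (auto simp: algebra_simps)
      show ?thesis
        unfolding p
        by (cases "x \<in> Z"; cases "x + 1 \<in> Z")
          (simp_all add: site_en_def others wv bond_cost_simps o)
    next
      case 4
      have o: "(y = t + 1) = False" "(y = t + 2) = False" "(y = t) = False" using 4 by auto
      have wv: "w (x, y) = v (x, y)" "w (x + 1, y) = v (x + 1, y)" "w (x, y + 1) = v (x, y + 1) \<or> y + 1 = t + 1 \<or> y + 1 = t + 2"
        unfolding w using 4 by auto
      then have wv: "w (x, y) = v (x, y)" "w (x + 1, y) = v (x + 1, y)" "w (x, y + 1) = v (x, y + 1)"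
        using 4 by auto
      show ?thesis
        unfolding p by (simp add: site_en_def others wv o)
    qed
  qed
  have bd: "x \<in> A \<Longrightarrow> lo < x \<and> x < hi" "x \<in> Z \<Longrightarrow> lo < x \<and> x < hi" for x
    using A Z by auto
  have sub: "?h1 \<subseteq> grid N" "?h2 \<subseteq> grid N" "?v0 \<subseteq> grid N" "?v1 \<subseteq> grid N" "?v2 \<subseteq> grid N" "?a \<subseteq> grid N"
    using N by (auto simp: grid_def dest!: bd)
  have inj: "inj_on (\<lambda>x. (x, c)) S" for c :: int and S :: "int set"
    by (simp add: inj_on_def)
  have "en \<beta> s N w = en \<beta> s N v + (- \<beta>) * card ?h1 + \<beta> * card ?h2 + (- \<beta>) * card ?v0
       + (2 - \<beta>) * card ?v1 + (\<beta> + s) * card ?v2 + (- s) * card ?a"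
    unfolding en_def pw sum.distrib by (simp only: sum_of_bool_card[OF finite_grid] sub)
  then show ?thesis
    by (simp add: card_image[OF inj] algebra_simps)
qed

text \<open>No bond runs along a diagonal: each of its cells has two bonds inward and two outward.
  The cell of \<open>A\<close> with index \<open>x\<close> meets the next diagonal at the indices
  \<open>x\<close> and \<open>x + 1\<close>, whence the two counts of exposed bonds.\<close>

lemma en_diagonal_side:
  fixes c lo hi :: int and A Z :: "int set"
  assumes one: "\<And>x. lo \<le> x \<Longrightarrow> x \<le> hi \<Longrightarrow> v (x - 1, c + 1 - x) = 1 \<and> v (x, c - x) = 1"
    and zero: "\<And>x. lo - 1 \<le> x \<Longrightarrow> x \<le> hi + 1 \<Longrightarrow> v (x, c + 1 - x) = 0"
    and minus: "\<And>x. v (x, c + 2 - x) = -1" "\<And>x. v (x, c + 3 - x) = -1"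
    and A: "A \<subseteq> {lo..hi}" and Z: "Z \<subseteq> {lo..hi + 1}"
    and N: "-N < lo" "hi < N" "-N < c - hi" "c + 2 - lo < N"
    and w: "\<And>x y. w (x, y) = (if y = c + 1 - x \<and> x \<in> A then 1 else if y = c + 2 - x \<and> x \<in> Z then 0 else v (x, y))"
  shows "en \<beta> s N w = en \<beta> s N v
     + (2 * \<beta> + s) * card Z - (2 * \<beta> + s) * card A
     + (2 - \<beta>) * (card {x \<in> A. x \<notin> Z} + card {x \<in> A. x + 1 \<notin> Z})"
proof -
  let ?l = "(\<lambda>x. (x - 1, c + 1 - x)) ` A"
  let ?d = "(\<lambda>x. (x, c - x)) ` A"
  let ?q1 = "(\<lambda>x. (x, c + 1 - x)) ` {x \<in> A. x + 1 \<notin> Z}"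
  let ?q2 = "(\<lambda>x. (x, c + 1 - x)) ` {x \<in> A. x \<notin> Z}"
  let ?q = "(\<lambda>x. (x, c + 1 - x)) ` A"
  let ?n = "(\<lambda>x. (x, c + 2 - x)) ` Z"
  have l: "(x, y) \<in> ?l \<longleftrightarrow> y = c - x \<and> x + 1 \<in> A" for x y
    by (auto simp: image_iff intro!: bexI[of _ "x + 1"])
  have others: "(x, y) \<in> ?d \<longleftrightarrow> y = c - x \<and> x \<in> A"
      "(x, y) \<in> ?q1 \<longleftrightarrow> y = c + 1 - x \<and> x \<in> A \<and> x + 1 \<notin> Z"
      "(x, y) \<in> ?q2 \<longleftrightarrow> y = c + 1 - x \<and> x \<in> A \<and> x \<notin> Z"
      "(x, y) \<in> ?n \<longleftrightarrow> y = c + 2 - x \<and> x \<in> Z"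
      "(x, y) \<in> ?q \<longleftrightarrow> y = c + 1 - x \<and> x \<in> A" for x y
    by auto
  have pw: "site_en \<beta> s w p = site_en \<beta> s v p + (- \<beta>) * of_bool (p \<in> ?l) + (- \<beta>) * of_bool (p \<in> ?d)
      + (2 - \<beta>) * of_bool (p \<in> ?q1) + (2 - \<beta>) * of_bool (p \<in> ?q2) + (2 * \<beta> + s) * of_bool (p \<in> ?n)
      + (- s) * of_bool (p \<in> ?q)" for p
  proof -
    obtain x y where p: "p = (x, y)" by force
    have mem: "x \<in> A \<Longrightarrow> lo \<le> x \<and> x \<le> hi" "x + 1 \<in> A \<Longrightarrow> lo \<le> x + 1 \<and> x + 1 \<le> hi"
        "x \<in> Z \<Longrightarrow> lo \<le> x \<and> x \<le> hi + 1" "x + 1 \<in> Z \<Longrightarrow> lo \<le> x + 1 \<and> x + 1 \<le> hi + 1"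
      using A Z by auto
    consider "y = c - x" | "y = c + 1 - x" | "y = c + 2 - x" | "y \<noteq> c - x \<and> y \<noteq> c + 1 - x \<and> y \<noteq> c + 2 - x"
      by auto
    then show ?thesis
    proof cases
      case 1
      have o: "(y = c - x) = True" "(y = c + 1 - x) = False" "(y = c + 2 - x) = False" using 1 by auto
      have z: "x \<in> A \<Longrightarrow> v (x, y) = 1" "x \<in> A \<Longrightarrow> v (x, y + 1) = 0"
          "x + 1 \<in> A \<Longrightarrow> v (x, y) = 1" "x + 1 \<in> A \<Longrightarrow> v (x + 1, y) = 0"
        using mem(1,2) one[of x] one[of "x + 1"] zero[of x] zero[of "x + 1"] 1 by (auto simp: algebra_simps)
      have wv: "w (x, y) = v (x, y)" "w (x + 1, y) = (if x + 1 \<in> A then 1 else v (x + 1, y))"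
          "w (x, y + 1) = (if x \<in> A then 1 else v (x, y + 1))"
        unfolding w using 1 by auto
      show ?thesis
        unfolding p
        by (cases "x \<in> A"; cases "x + 1 \<in> A") (simp_all add: site_en_def l others wv bond_cost_simps z o)
    next
      case 2
      have o: "(y = c - x) = False" "(y = c + 1 - x) = True" "(y = c + 2 - x) = False" using 2 by auto
      have z: "x \<in> A \<Longrightarrow> v (x, y) = 0" "x \<in> Z \<Longrightarrow> v (x, y) = 0" "x + 1 \<in> Z \<Longrightarrow> v (x, y) = 0"
        using mem(1,3,4) zero[of x] 2 by auto
      have e: "c + 2 - x = y + 1" "c + 2 - (x + 1) = y" using 2 by auto
      note m = minus(1)[of x, unfolded e] minus(1)[of "x + 1", unfolded e]
      have wv: "w (x, y) = (if x \<in> A then 1 else v (x, y))"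
          "w (x + 1, y) = (if x + 1 \<in> Z then 0 else -1)"
          "w (x, y + 1) = (if x \<in> Z then 0 else -1)"
        unfolding w using 2 m by auto
      show ?thesis
        unfolding p
        by (cases "x \<in> A"; cases "x \<in> Z"; cases "x + 1 \<in> Z")
          (simp_all add: site_en_def l others wv m bond_cost_simps z o)
    next
      case 3
      have o: "(y = c - x) = False" "(y = c + 1 - x) = False" "(y = c + 2 - x) = True" using 3 by auto
      have e: "c + 2 - x = y" "c + 3 - x = y + 1" "c + 3 - (x + 1) = y" using 3 by auto
      note m = minus(1)[of x, unfolded e] minus(2)[of x, unfolded e] minus(2)[of "x + 1", unfolded e]
      have wv: "w (x, y) = (if x \<in> Z then 0 else -1)" "w (x + 1, y) = -1" "w (x, y + 1) = -1"
        unfolding w using 3 m by auto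
      show ?thesis
        unfolding p by (cases "x \<in> Z") (simp_all add: site_en_def l others wv m bond_cost_simps o)
    next
      case 4
      have o: "(y = c - x) = False" "(y = c + 1 - x) = False" "(y = c + 2 - x) = False" using 4 by auto
      have wv: "w (x, y) = v (x, y)" "w (x + 1, y) = v (x + 1, y)" "w (x, y + 1) = v (x, y + 1)"
        unfolding w using 4 by auto
      show ?thesis
        unfolding p by (simp add: site_en_def l others wv o)
    qed
  qed
  have bd: "x \<in> A \<Longrightarrow> lo \<le> x \<and> x \<le> hi" "x \<in> Z \<Longrightarrow> lo \<le> x \<and> x \<le> hi + 1" for x
    using A Z by auto
  have sub: "?l \<subseteq> grid N" "?d \<subseteq> grid N" "?q1 \<subseteq> grid N" "?q2 \<subseteq> grid N" "?n \<subseteq> grid N" "?q \<subseteq> grid N"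
    using N by (auto simp: grid_def dest!: bd)
  have inj: "inj_on (\<lambda>x. (x - 1, d - x)) S" "inj_on (\<lambda>x. (x, d - x)) S" for d :: int and S :: "int set"
    by (simp_all add: inj_on_def)
  have "en \<beta> s N w = en \<beta> s N v + (- \<beta>) * card ?l + (- \<beta>) * card ?d + (2 - \<beta>) * card ?q1
       + (2 - \<beta>) * card ?q2 + (2 * \<beta> + s) * card ?n + (- s) * card ?q"
    unfolding en_def pw sum.distrib by (simp only: sum_of_bool_card[OF finite_grid] sub)
  then show ?thesis
    by (simp add: card_image[OF inj(1)] card_image[OF inj(2)] algebra_simps)
qed

section \<open>Octagons with integer support heights\<close>

declare One_nat_def [simp del]

text \<open>The directions run counterclockwise from the first basis vector, so that even indices belong to
  the axis-parallel sides and odd ones to the diagonal sides of the octagon with support heights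
  \<open>b\<close>; \<open>side b i\<close> is the length of its side \<open>i\<close>, counted in lattice steps along that side.\<close>

definition phi :: "nat \<Rightarrow> cell \<Rightarrow> int" where
  "phi i p = [fst p, fst p + snd p, snd p, snd p - fst p,
     - fst p, - fst p - snd p, - snd p, fst p - snd p] ! i"

definition oct :: "(nat \<Rightarrow> int) \<Rightarrow> cell set" where
  "oct b = {p. \<forall>i<8. phi i p \<le> b i}"

definition side :: "(nat \<Rightarrow> int) \<Rightarrow> nat \<Rightarrow> int" where
  "side b i = b ((i + 7) mod 8) + b ((i + 1) mod 8) - (if even i then 2 else 1) * b i"

text \<open>Nonnegative side lengths mean that all eight constraints are attained, so that
  \<open>b\<close> is the support function of \<open>oct b\<close> and not just an upper bound for
  it.\<close>

definition tight :: "(nat \<Rightarrow> int) \<Rightarrow> bool" where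
  "tight b \<longleftrightarrow> (\<forall>i<8. 0 \<le> side b i)"

text \<open>Raising all heights by one produces the ring of zeros. This makes \<open>cfg\<close>
  monotone in \<open>b\<close>, so that configurations of nested octagons are ordered
  pointwise.\<close>

definition cfg :: "(nat \<Rightarrow> int) \<Rightarrow> cell \<Rightarrow> int" where
  "cfg b p = (if p \<in> oct b then 1 else if p \<in> oct (\<lambda>i. b i + 1) then 0 else -1)"

definition incr :: "(nat \<Rightarrow> int) \<Rightarrow> nat \<Rightarrow> nat \<Rightarrow> int" where
  "incr b i = b(i := b i + 1)"

definition layer :: "(nat \<Rightarrow> int) \<Rightarrow> nat \<Rightarrow> cell set" where
  "layer b i = oct (incr b i) - oct b"

lemma all_less_8: "(\<forall>i<8. P i) \<longleftrightarrow> P 0 \<and> P 1 \<and> P 2 \<and> P 3 \<and> P 4 \<and> P 5 \<and> P 6 \<and> P (7::nat)"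
proof -
  have "{i. i < 8} = {0, 1, 2, 3, 4, 5, 6, 7::nat}" by auto
  then show ?thesis by (metis (mono_tags, lifting) insert_iff mem_Collect_eq singletonD)
qed

lemma oct_iff: "(x, y) \<in> oct b \<longleftrightarrow> x \<le> b 0 \<and> x + y \<le> b 1 \<and> y \<le> b 2 \<and> y - x \<le> b 3
    \<and> - x \<le> b 4 \<and> - x - y \<le> b 5 \<and> - y \<le> b 6 \<and> x - y \<le> b 7"
  by (simp add: oct_def all_less_8 phi_def)

lemma side_simps:
  "side b 0 = b 7 + b 1 - 2 * b 0" "side b 1 = b 0 + b 2 - b 1" "side b 2 = b 1 + b 3 - 2 * b 2"
  "side b 3 = b 2 + b 4 - b 3" "side b 4 = b 3 + b 5 - 2 * b 4" "side b 5 = b 4 + b 6 - b 5"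
  "side b 6 = b 5 + b 7 - 2 * b 6" "side b 7 = b 6 + b 0 - b 7"
  by (simp_all add: side_def)

lemma tight_iff: "tight b \<longleftrightarrow> 2 * b 0 \<le> b 7 + b 1 \<and> b 1 \<le> b 0 + b 2 \<and> 2 * b 2 \<le> b 1 + b 3
    \<and> b 3 \<le> b 2 + b 4 \<and> 2 * b 4 \<le> b 3 + b 5 \<and> b 5 \<le> b 4 + b 6 \<and> 2 * b 6 \<le> b 5 + b 7 \<and> b 7 \<le> b 6 + b 0"
  by (simp add: tight_def all_less_8 side_simps)

lemma oct_mono: "(\<And>i. i < 8 \<Longrightarrow> b i \<le> c i) \<Longrightarrow> oct b \<subseteq> oct c"
  unfolding oct_def by (auto intro: order_trans)

lemma oct_cong: "(\<And>i. i < 8 \<Longrightarrow> b i = c i) \<Longrightarrow> oct b = oct c"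
  unfolding oct_def by auto

lemma cfg_cong: "(\<And>i. i < 8 \<Longrightarrow> b i = c i) \<Longrightarrow> cfg b = cfg c"
  using oct_cong[of b c] oct_cong[of "\<lambda>i. b i + 1" "\<lambda>i. c i + 1"] by (auto simp: cfg_def fun_eq_iff)

lemma cfg_mono: "(\<And>i. i < 8 \<Longrightarrow> b i \<le> c i) \<Longrightarrow> cfg b p \<le> cfg c p"
  using oct_mono[of b c] oct_mono[of "\<lambda>i. b i + 1" "\<lambda>i. c i + 1"] by (auto simp: cfg_def)

text \<open>A new flat row and its new row of zeros have equal length, whereas in
  \<open>oct_incr_ne\<close> the diagonal of zeros is longer by one cell. This is why only diagonal
  layers change the number of zeros.\<close>

lemma oct_incr_top:
  assumes "tight b" "tight (incr b 2)"
  shows "(x, y) \<in> oct (incr b 2) \<longleftrightarrow> (x, y) \<in> oct b \<or> y = b 2 + 1 \<and> b 2 - b 3 < x \<and> x < b 1 - b 2"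
    and "(x, y) \<in> oct (\<lambda>i. incr b 2 i + 1) \<longleftrightarrow>
      (x, y) \<in> oct (\<lambda>i. b i + 1) \<or> y = b 2 + 2 \<and> b 2 - b 3 < x \<and> x < b 1 - b 2"
  using assms by (auto simp: tight_iff oct_iff incr_def)

lemma oct_incr_ne:
  assumes "tight b" "tight (incr b 1)"
  shows "(x, y) \<in> oct (incr b 1) \<longleftrightarrow> (x, y) \<in> oct b \<or> y = b 1 + 1 - x \<and> b 1 + 1 - b 2 \<le> x \<and> x \<le> b 0"
    and "(x, y) \<in> oct (\<lambda>i. incr b 1 i + 1) \<longleftrightarrow>
      (x, y) \<in> oct (\<lambda>i. b i + 1) \<or> y = b 1 + 2 - x \<and> b 1 + 1 - b 2 \<le> x \<and> x \<le> b 0 + 1"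
  using assms by (auto simp: tight_iff oct_iff incr_def)

section \<open>Energy of complete and partial layers\<close>

lemma layer_top:
  assumes "tight b" "tight (incr b 2)"
  shows "layer b 2 = (\<lambda>x. (x, b 2 + 1)) ` {b 2 - b 3<..<b 1 - b 2}"
proof -
  have "(x, y) \<in> oct b \<Longrightarrow> y \<le> b 2" for x y by (simp add: oct_iff)
  then show ?thesis
    unfolding layer_def by (auto simp: oct_incr_top(1)[OF assms] image_iff) fastforce
qed

lemma layer_ne:
  assumes "tight b" "tight (incr b 1)"
  shows "layer b 1 = (\<lambda>x. (x, b 1 + 1 - x)) ` {b 1 + 1 - b 2..b 0}"
proof -
  have "(x, y) \<in> oct b \<Longrightarrow> x + y \<le> b 1" for x y by (simp add: oct_iff)
  then show ?thesis
    unfolding layer_def by (auto simp: oct_incr_ne(1)[OF assms] image_iff) fastforce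
qed

text \<open>The excess energy is \<open>\<beta> * (r + q) + (2 * \<beta> + s) * e + (2 - 3 * \<beta>
  - s) * d\<close>, where \<open>r\<close> and \<open>q\<close> are the numbers of runs of new 1s
  and new zeros, \<open>e\<close> counts zeros above no 1, and \<open>d\<close> counts 1s below no
  zero. If both kinds are present, \<open>r + q\<close> is at least 2; if there are no new zeros,
  every 1 is uncovered, and \<open>\<Lambda>\<close> of them make up for the missing
  \<open>\<beta>\<close>.\<close>

lemma layer_step_top:
  fixes b :: "nat \<Rightarrow> int"
  assumes t: "tight b" "tight (incr b 2)" and cf: "conf N (cfg (incr b 2))"
    and w: "\<And>p. cfg b p \<le> w p" "\<And>p. w p \<le> cfg (incr b 2) p"
    and \<beta>: "0 < \<beta>" "\<bar>s\<bar> \<le> \<beta> / 2" "\<bar>s\<bar> \<le> (2 - 3 * \<beta>) / 2" "\<beta> < real \<Lambda> * ((2 - 3 * \<beta>) / 2)"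
    and A: "A = {p \<in> layer b 2. w p = 1}"
  shows "en \<beta> s N (cfg (incr b 2)) = en \<beta> s N (cfg b) + 2 * \<beta>"
    and "w \<noteq> cfg b \<Longrightarrow> en \<beta> s N (cfg b) < en \<beta> s N w"
    and "A \<noteq> {} \<Longrightarrow> en \<beta> s N (cfg b) + \<beta> \<le> en \<beta> s N w"
    and "\<Lambda> \<le> card A \<Longrightarrow> en \<beta> s N (cfg b) + 2 * \<beta> \<le> en \<beta> s N w"
    and "A = layer b 2 \<Longrightarrow> \<Lambda> \<le> card A \<Longrightarrow> w \<noteq> cfg (incr b 2) \<Longrightarrow> en \<beta> s N (cfg b) + 2 * \<beta> < en \<beta> s N w"
proof -
  define lo hi c where lo: "lo = b 2 - b 3" and hi: "hi = b 1 - b 2" and c: "c = b 2"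
  note T = t[unfolded tight_iff incr_def, simplified]
  have lohi: "lo + 2 \<le> hi" using T by (auto simp: lo hi)
  have one: "cfg b (x, c) = 1" if "lo < x" "x < hi" for x
    using that T by (auto simp: cfg_def oct_iff lo hi c)
  have zero: "cfg b (x, c + 1) = 0" if "lo \<le> x" "x \<le> hi" for x
    using that T by (auto simp: cfg_def oct_iff lo hi c)
  have minus: "cfg b (x, c + 2) = -1" "cfg b (x, c + 3) = -1" for x
    by (auto simp: cfg_def oct_iff c)
  have inc: "cfg (incr b 2) (x, y) = (if y = c + 1 \<and> x \<in> {lo<..<hi} then 1
      else if y = c + 2 \<and> x \<in> {lo<..<hi} then 0 else cfg b (x, y))" for x y
  proof -
    have m: "(x, y) \<in> oct (incr b 2) \<longleftrightarrow> (x, y) \<in> oct b \<or> y = c + 1 \<and> x \<in> {lo<..<hi}"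
      "(x, y) \<in> oct (\<lambda>i. incr b 2 i + 1) \<longleftrightarrow> (x, y) \<in> oct (\<lambda>i. b i + 1) \<or> y = c + 2 \<and> x \<in> {lo<..<hi}"
      unfolding oct_incr_top[OF t] lo hi c by auto
    have "y \<le> c + 1" if "(x, y) \<in> oct b \<or> (x, y) \<in> oct (\<lambda>i. b i + 1)"
      using that by (auto simp: oct_iff c)
    then show ?thesis
      unfolding cfg_def m by auto
  qed
  have Nb: "-N \<le> c" "c + 2 \<le> N" "-N \<le> lo" "hi \<le> N"
  proof -
    have "cfg (incr b 2) (lo + 1, c + 2) \<noteq> -1" "cfg (incr b 2) (hi - 1, c + 2) \<noteq> -1" 
      "cfg (incr b 2) (hi - 1, c + 1) \<noteq> -1" "cfg (incr b 2) (hi - 1, c) \<noteq> -1"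
      using lohi one[of "hi - 1"] by (auto simp: inc)
    then have "\<bar>lo + 1\<bar> < N \<and> \<bar>c + 2\<bar> < N" "\<bar>hi - 1\<bar> < N \<and> \<bar>c\<bar> < N"
      using cf unfolding conf_def by blast+
    then show "-N \<le> c" "c + 2 \<le> N" "-N \<le> lo" "hi \<le> N" by auto
  qed
  define X Z where X: "X = {x \<in> {lo<..<hi}. w (x, c + 1) = 1}" and Z: "Z = {x \<in> {lo<..<hi}. w (x, c + 2) = 0}"
  have fin: "finite X" "finite Z" "X \<subseteq> {lo<..<hi}" "Z \<subseteq> {lo<..<hi}"
    unfolding X Z by (auto intro: finite_subset[of _ "{lo<..<hi}"])
  \<comment> \<open>The two bounds leave one binary choice per cell: a zero of row
    \<open>c + 1\<close> may become 1, a -1 of row \<open>c + 2\<close> may become 0.\<close>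
  have form: "w (x, y) = (if y = c + 1 \<and> x \<in> X then 1 else if y = c + 2 \<and> x \<in> Z then 0 else cfg b (x, y))" for x y
    using w(1)[of "(x, y)"] w(2)[of "(x, y)"] zero[of x] minus(1)[of x] unfolding inc
    by (auto simp: X Z split: if_splits)
  note E = en_flat_side[of lo hi "cfg b" c _ _ N _ \<beta> s]
  have Ew: "en \<beta> s N w = en \<beta> s N (cfg b)
     - \<beta> * card {x \<in> X. x + 1 \<in> X} + \<beta> * card {x. x \<in> Z \<or> x + 1 \<in> Z}
     + (\<beta> + s) * card Z - (\<beta> + s) * card X + (2 - \<beta>) * card (X - Z)"
    by (rule E) (use lohi one zero minus fin Nb form in auto)
  have A_eq: "A = (\<lambda>x. (x, c + 1)) ` X"
    unfolding A layer_top[OF t] X lo hi c by auto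
  have cardA: "card A = card X"
    unfolding A_eq by (rule card_image) (simp add: inj_on_def)
  have layer_eq: "A = layer b 2 \<longleftrightarrow> X = {lo<..<hi}"
    unfolding A_eq layer_top[OF t] lo hi c
    by (rule inj_image_eq_iff) (simp add: inj_on_def)
  define d where "d = real (card (X - Z))"
  define e where "e = real (card (Z - X))"
  have de: "real (card Z) - real (card X) = e - d"
  proof -
    have "card X = card (X \<inter> Z) + card (X - Z)" "card Z = card (X \<inter> Z) + card (Z - X)"
      using card_Int_Diff[OF fin(1), of Z] card_Int_Diff[OF fin(2), of X] by (simp_all add: Int_commute)
    then show ?thesis by (simp add: d_def e_def)
  qed
  \<comment> \<open>The other half of \<open>2 - 3 * \<beta>\<close> absorbs the charge, so
    \<open>\<omega>\<close> bounds the price of an uncovered 1 for both signs of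
    \<open>s\<close>.\<close>
  define \<omega> where "\<omega> = (2 - 3 * \<beta>) / 2"
  have "0 < \<omega>"
  proof (rule ccontr)
    assume "\<not> 0 < \<omega>"
    then have "real \<Lambda> * \<omega> \<le> 0" by (simp add: mult_nonneg_nonpos)
    then show False using \<beta> by (simp add: \<omega>_def)
  qed
  then have w0: "0 \<le> \<omega>" "0 < \<omega>" by simp_all
  have coef: "\<omega> \<le> 2 - 3 * \<beta> - s"
    using \<beta>(1,3) w0 by (auto simp: \<omega>_def abs_if field_simps split: if_splits)
  have de0: "0 \<le> d" "0 \<le> e" by (simp_all add: d_def e_def)
  define r where "r = real (card X) - real (card {x \<in> X. x + 1 \<in> X})"
  define q where "q = real (card {x. x \<in> Z \<or> x + 1 \<in> Z}) - real (card Z)"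
  have r: "0 \<le> r" and r1: "X \<noteq> {} \<Longrightarrow> 1 \<le> r"
    using card_succ_image[OF fin(1)] by (cases "X = {}"; simp add: r_def; linarith)+
  have q: "0 \<le> q" and q1: "Z \<noteq> {} \<Longrightarrow> 1 \<le> q"
    using card_succ_union[OF fin(2)] by (cases "Z = {}"; simp add: q_def; linarith)+
  have Ed: "en \<beta> s N w - en \<beta> s N (cfg b) = \<beta> * (r + q) + (2 * \<beta> + s) * e + (2 - 3 * \<beta> - s) * d"
  proof -
    have "en \<beta> s N w - en \<beta> s N (cfg b) = \<beta> * (r + q) + (2 * \<beta> + s) * (real (card Z) - real (card X)) + (2 - \<beta>) * d"
      unfolding Ew by (simp add: r_def q_def d_def algebra_simps)
    then show ?thesis unfolding de by (simp add: algebra_simps)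
  qed
  have lb: "en \<beta> s N w - en \<beta> s N (cfg b) \<ge> \<beta> * (r + q) + \<beta> * e + \<omega> * d"
  proof -
    have "\<beta> * e \<le> (2 * \<beta> + s) * e" "\<omega> * d \<le> (2 - 3 * \<beta> - s) * d"
      using de0 \<beta> coef by (auto intro!: mult_right_mono)
    then show ?thesis unfolding Ed by linarith
  qed
  have dL: "\<beta> < \<omega> * d" if "\<Lambda> \<le> card X" "Z = {}"
  proof -
    have "\<beta> < real \<Lambda> * \<omega>" using \<beta>(4) by (simp add: \<omega>_def)
    also have "\<dots> \<le> d * \<omega>" using that w0 by (auto simp: d_def intro!: mult_right_mono)
    finally show ?thesis by (simp add: mult.commute)
  qed
  have mono: "\<beta> * m \<le> \<beta> * n" if "m \<le> n" for m n :: real using that \<beta> by simp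
  have nn: "0 \<le> \<beta> * e" "0 \<le> \<omega> * d" "0 \<le> \<beta> * (r + q)"
    using de0 w0 \<beta> r q by auto
  show "en \<beta> s N (cfg (incr b 2)) = en \<beta> s N (cfg b) + 2 * \<beta>"
  proof -
    have "{x \<in> {lo<..<hi}. x + 1 \<in> {lo<..<hi}} = {lo<..<hi - 1}"
      "{x. x \<in> {lo<..<hi} \<or> x + 1 \<in> {lo<..<hi}} = {lo - 1<..<hi}" using lohi by auto
    moreover have "en \<beta> s N (cfg (incr b 2)) = en \<beta> s N (cfg b)
     - \<beta> * card {x \<in> {lo<..<hi}. x + 1 \<in> {lo<..<hi}} + \<beta> * card {x. x \<in> {lo<..<hi} \<or> x + 1 \<in> {lo<..<hi}}
     + (\<beta> + s) * card {lo<..<hi} - (\<beta> + s) * card {lo<..<hi} + (2 - \<beta>) * card ({lo<..<hi} - {lo<..<hi})"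
      by (rule E) (use lohi one zero minus Nb inc in auto)
    moreover have "real (nat (hi - lo)) = real (nat (hi - 1 - (lo + 1))) + 2" using lohi by simp
    ultimately show ?thesis using lohi by (simp add: algebra_simps)
  qed
  show "en \<beta> s N (cfg b) < en \<beta> s N w" if "w \<noteq> cfg b"
  proof -
    have "X \<noteq> {} \<or> Z \<noteq> {}" using that form by (auto simp: fun_eq_iff)
    then have "1 \<le> r + q" using r q r1 q1 by (elim disjE) (simp_all add: add_increasing add_increasing2)
    then have "\<beta> * 1 \<le> \<beta> * (r + q)" by (rule mono)
    then show ?thesis using lb nn \<beta> by linarith
  qed
  show "en \<beta> s N (cfg b) + \<beta> \<le> en \<beta> s N w" if "A \<noteq> {}"
  proof -
    have "X \<noteq> {}" using that A_eq by simp
    then have "1 \<le> r + q" using r1 q by linarith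
    then have "\<beta> * 1 \<le> \<beta> * (r + q)" by (rule mono)
    then show ?thesis using lb nn \<beta> by linarith
  qed
  have L0: "0 < \<Lambda>" using \<beta> by (intro gr0I) auto
  show "en \<beta> s N (cfg b) + 2 * \<beta> \<le> en \<beta> s N w" if L: "\<Lambda> \<le> card A"
  proof (cases "Z = {}")
    case True
    have "X \<noteq> {}" using L L0 cardA by auto
    then have "\<beta> * 1 \<le> \<beta> * (r + q)" using r1 q by (intro mono) simp
    moreover have "\<beta> < \<omega> * d" using dL True L cardA by simp
    ultimately show ?thesis using lb nn by linarith
  next
    case False
    have "X \<noteq> {}" using L L0 cardA by auto
    then have "\<beta> * 2 \<le> \<beta> * (r + q)" using r1 q1 False by (intro mono) simp
    then show ?thesis using lb nn by linarith
  qed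
  show "en \<beta> s N (cfg b) + 2 * \<beta> < en \<beta> s N w"
    if L: "A = layer b 2" "\<Lambda> \<le> card A" "w \<noteq> cfg (incr b 2)"
  proof (cases "Z = {}")
    case True
    have "X \<noteq> {}" using L L0 cardA by auto
    then have "\<beta> * 1 \<le> \<beta> * (r + q)" using r1 q by (intro mono) simp
    moreover have "\<beta> < \<omega> * d" using dL True L cardA by simp
    ultimately show ?thesis using lb nn by linarith
  next
    case False
    have XX: "X = {lo<..<hi}" using L layer_eq by simp
    then have "Z \<noteq> X" using L(3) inc form by (auto simp: fun_eq_iff)
    then have "X - Z \<noteq> {}" using fin(4) XX by auto
    then have "0 < d" using fin by (auto simp: d_def card_gt_0_iff)
    then have "0 < \<omega> * d" using w0 by simp
    moreover have "X \<noteq> {}" using L L0 cardA by auto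
    then have "\<beta> * 2 \<le> \<beta> * (r + q)" using r1 q1 False by (intro mono) simp
    ultimately show ?thesis using lb nn by linarith
  qed
qed

text \<open>The cells of a diagonal have at least one outer neighbour more than their own number.
  Each of these is either made a zero or leaves an exposed bond, so the first cell already commits
  to the price \<open>2 * \<beta> + s\<close> of the full layer.\<close>

lemma layer_step_ne:
  fixes b :: "nat \<Rightarrow> int"
  assumes t: "tight b" "tight (incr b 1)" and cf: "conf N (cfg (incr b 1))"
    and w: "\<And>p. cfg b p \<le> w p" "\<And>p. w p \<le> cfg (incr b 1) p"
    and \<beta>: "0 < \<beta>" "\<bar>s\<bar> \<le> \<beta> / 2" "\<bar>s\<bar> \<le> (2 - 3 * \<beta>) / 2" "\<beta> < real \<Lambda> * ((2 - 3 * \<beta>) / 2)"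
    and A: "A = {p \<in> layer b 1. w p = 1}"
  shows "en \<beta> s N (cfg (incr b 1)) = en \<beta> s N (cfg b) + 2 * \<beta> + s"
    and "w \<noteq> cfg b \<Longrightarrow> en \<beta> s N (cfg b) < en \<beta> s N w"
    and "A \<noteq> {} \<Longrightarrow> en \<beta> s N (cfg b) + \<beta> \<le> en \<beta> s N w"
    and "A \<noteq> {} \<Longrightarrow> en \<beta> s N (cfg b) + 2 * \<beta> + s \<le> en \<beta> s N w"
    and "A = layer b 1 \<Longrightarrow> w \<noteq> cfg (incr b 1) \<Longrightarrow> en \<beta> s N (cfg b) + 2 * \<beta> + s < en \<beta> s N w"
proof -
  define lo hi c where lo: "lo = b 1 + 1 - b 2" and hi: "hi = b 0" and c: "c = b 1"
  note T = t[unfolded tight_iff incr_def, simplified]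
  have lohi: "lo \<le> hi" using T by (auto simp: lo hi)
  have one: "cfg b (x - 1, c + 1 - x) = 1" "cfg b (x, c - x) = 1" if "lo \<le> x" "x \<le> hi" for x
    using that T by (auto simp: cfg_def oct_iff lo hi c)
  have zero: "cfg b (x, c + 1 - x) = 0" if "lo - 1 \<le> x" "x \<le> hi + 1" for x
    using that T by (auto simp: cfg_def oct_iff lo hi c)
  have minus: "cfg b (x, c + 2 - x) = -1" "cfg b (x, c + 3 - x) = -1" for x
    by (auto simp: cfg_def oct_iff c)
  have inc: "cfg (incr b 1) (x, y) = (if y = c + 1 - x \<and> x \<in> {lo..hi} then 1
      else if y = c + 2 - x \<and> x \<in> {lo..hi + 1} then 0 else cfg b (x, y))" for x y
  proof -
    have m: "(x, y) \<in> oct (incr b 1) \<longleftrightarrow> (x, y) \<in> oct b \<or> y = c + 1 - x \<and> x \<in> {lo..hi}"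
      "(x, y) \<in> oct (\<lambda>i. incr b 1 i + 1) \<longleftrightarrow> (x, y) \<in> oct (\<lambda>i. b i + 1) \<or> y = c + 2 - x \<and> x \<in> {lo..hi + 1}"
      unfolding oct_incr_ne[OF t] lo hi c by auto
    have "x + y \<le> c + 1" if "(x, y) \<in> oct b \<or> (x, y) \<in> oct (\<lambda>i. b i + 1)"
      using that by (auto simp: oct_iff c)
    then show ?thesis
      unfolding cfg_def m by auto
  qed
  have Nb: "-N < lo" "hi < N" "-N < c - hi" "c + 2 - lo < N"
  proof -
    have "cfg (incr b 1) (lo, c + 2 - lo) \<noteq> -1" "cfg (incr b 1) (hi, c - hi) \<noteq> -1"
      using lohi one(2)[of hi] by (auto simp: inc)
    then have "\<bar>lo\<bar> < N \<and> \<bar>c + 2 - lo\<bar> < N" "\<bar>hi\<bar> < N \<and> \<bar>c - hi\<bar> < N"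
      using cf unfolding conf_def by blast+
    then show "-N < lo" "hi < N" "-N < c - hi" "c + 2 - lo < N" by auto
  qed
  define X Z where X: "X = {x \<in> {lo..hi}. w (x, c + 1 - x) = 1}" and Z: "Z = {x \<in> {lo..hi + 1}. w (x, c + 2 - x) = 0}"
  have fin: "finite X" "finite Z" "X \<subseteq> {lo..hi}" "Z \<subseteq> {lo..hi + 1}"
    unfolding X Z by (auto intro: finite_subset[of _ "{lo..hi + 1}"])
  have form: "w (x, y) = (if y = c + 1 - x \<and> x \<in> X then 1 else if y = c + 2 - x \<and> x \<in> Z then 0 else cfg b (x, y))" for x y
    using w(1)[of "(x, y)"] w(2)[of "(x, y)"] zero[of x] minus(1)[of x] unfolding inc
    by (auto simp: X Z split: if_splits)
  note E = en_diagonal_side[of lo hi "cfg b" c _ _ N _ \<beta> s]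
  have Ew: "en \<beta> s N w = en \<beta> s N (cfg b) + (2 * \<beta> + s) * card Z - (2 * \<beta> + s) * card X
     + (2 - \<beta>) * (card {x \<in> X. x \<notin> Z} + card {x \<in> X. x + 1 \<notin> Z})"
    by (rule E) (use lohi one zero minus fin Nb form in auto)
  have A_eq: "A = (\<lambda>x. (x, c + 1 - x)) ` X"
    unfolding A layer_ne[OF t] X lo hi c by auto
  have layer_eq: "A = layer b 1 \<longleftrightarrow> X = {lo..hi}"
    unfolding A_eq layer_ne[OF t] lo hi c
    by (rule inj_image_eq_iff) (simp add: inj_on_def)
  \<comment> \<open>Indices of the cells on the next diagonal that touch \<open>X\<close>, that is,
    of the places where a zero would protect a new 1.\<close>
  define Y where "Y = {x. x - 1 \<in> X \<or> x \<in> X}"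
  have Y_im: "Y = (\<lambda>x. x + 1) ` {x. x \<in> X \<or> x + 1 \<in> X}"
    unfolding Y_def by (auto simp: image_iff intro!: exI[of _ "_ - 1"])
  have finY: "finite Y"
  proof -
    have "Y \<subseteq> X \<union> (\<lambda>x. x + 1) ` X" by (force simp: Y_def)
    then show ?thesis using fin by (meson finite_UnI finite_imageI finite_subset)
  qed
  have cardY: "X \<noteq> {} \<Longrightarrow> card X + 1 \<le> card Y"
    unfolding Y_im using card_succ_union[OF fin(1)] by (subst card_image) auto
  define d where "d = real (card (Y - Z))"
  define e where "e = real (card (Z - Y))"
  define \<rho> where "\<rho> = real (card Y) - real (card X)"
  have de: "real (card Z) = real (card Y) + e - d"
  proof -
    have "card Y = card (Y \<inter> Z) + card (Y - Z)" "card Z = card (Y \<inter> Z) + card (Z - Y)"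
      using card_Int_Diff[OF finY, of Z] card_Int_Diff[OF fin(2), of Y] by (simp_all add: Int_commute)
    then show ?thesis by (simp add: d_def e_def)
  qed
  \<comment> \<open>An unprotected index of \<open>Y\<close> is the upper or the right neighbour of
    a cell of \<open>X\<close> and therefore accounts for at least one exposed bond.\<close>
  have d_le: "d \<le> real (card {x \<in> X. x \<notin> Z} + card {x \<in> X. x + 1 \<notin> Z})"
  proof -
    have "Y - Z \<subseteq> {x \<in> X. x \<notin> Z} \<union> (\<lambda>x. x + 1) ` {x \<in> X. x + 1 \<notin> Z}"
    proof
      fix x assume x: "x \<in> Y - Z"
      show "x \<in> {x \<in> X. x \<notin> Z} \<union> (\<lambda>x. x + 1) ` {x \<in> X. x + 1 \<notin> Z}"
      proof (cases "x \<in> X")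
        case False
        then have "x - 1 \<in> {x \<in> X. x + 1 \<notin> Z}" using x by (simp add: Y_def)
        then have "(x - 1) + 1 \<in> (\<lambda>x. x + 1) ` {x \<in> X. x + 1 \<notin> Z}" by (rule imageI)
        then show ?thesis by simp
      qed (use x in simp)
    qed
    then have "card (Y - Z) \<le> card ({x \<in> X. x \<notin> Z} \<union> (\<lambda>x. x + 1) ` {x \<in> X. x + 1 \<notin> Z})"
      using fin by (intro card_mono) auto
    also have "\<dots> \<le> card {x \<in> X. x \<notin> Z} + card ((\<lambda>x. x + 1) ` {x \<in> X. x + 1 \<notin> Z})"
      by (rule card_Un_le)
    also have "\<dots> \<le> card {x \<in> X. x \<notin> Z} + card {x \<in> X. x + 1 \<notin> Z}"
      using fin by (intro add_left_mono card_image_le) auto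
    finally show ?thesis by (simp add: d_def)
  qed
  define \<omega> where "\<omega> = (2 - 3 * \<beta>) / 2"
  have "0 < \<omega>"
  proof (rule ccontr)
    assume "\<not> 0 < \<omega>"
    then have "real \<Lambda> * \<omega> \<le> 0" by (simp add: mult_nonneg_nonpos)
    then show False using \<beta> by (simp add: \<omega>_def)
  qed
  then have w0: "0 \<le> \<omega>" "0 < \<omega>" by simp_all
  have coef: "\<omega> \<le> 2 - 3 * \<beta> - s"
    using \<beta>(1,3) w0 by (auto simp: \<omega>_def abs_if field_simps split: if_splits)
  have de0: "0 \<le> d" "0 \<le> e" by (simp_all add: d_def e_def)
  have \<rho>: "0 \<le> \<rho>" "X \<noteq> {} \<Longrightarrow> 1 \<le> \<rho>"
    using cardY by (cases "X = {}"; simp add: \<rho>_def; linarith)+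
  have lb: "en \<beta> s N w - en \<beta> s N (cfg b) \<ge> (2 * \<beta> + s) * \<rho> + \<beta> * e + \<omega> * d"
  proof -
    have "en \<beta> s N w - en \<beta> s N (cfg b) = (2 * \<beta> + s) * (real (card Z) - real (card X))
        + (2 - \<beta>) * real (card {x \<in> X. x \<notin> Z} + card {x \<in> X. x + 1 \<notin> Z})"
      unfolding Ew by (simp add: algebra_simps)
    moreover have "(2 - \<beta>) * d \<le> (2 - \<beta>) * real (card {x \<in> X. x \<notin> Z} + card {x \<in> X. x + 1 \<notin> Z})"
      using d_le w0 \<beta> by (intro mult_left_mono) (auto simp: \<omega>_def)
    moreover have "(2 * \<beta> + s) * (real (card Z) - real (card X)) = (2 * \<beta> + s) * \<rho> + (2 * \<beta> + s) * e - (2 * \<beta> + s) * d"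
      unfolding de by (simp add: \<rho>_def algebra_simps)
    moreover have "\<beta> * e \<le> (2 * \<beta> + s) * e" "\<omega> * d \<le> (2 - 3 * \<beta> - s) * d"
      using de0 \<beta> coef by (auto intro!: mult_right_mono)
    ultimately show ?thesis by (simp add: algebra_simps)
  qed
  have nn: "0 \<le> \<beta> * e" "0 \<le> \<omega> * d" "0 \<le> (2 * \<beta> + s) * \<rho>"
    using de0 w0 \<beta> \<rho> by auto
  have X1: "2 * \<beta> + s \<le> (2 * \<beta> + s) * \<rho>" if "X \<noteq> {}"
    using mult_left_mono[of 1 \<rho> "2 * \<beta> + s"] \<rho>(2)[OF that] \<beta> by auto
  show "en \<beta> s N (cfg (incr b 1)) = en \<beta> s N (cfg b) + 2 * \<beta> + s"
  proof -
    have e: "{x \<in> {lo..hi}. x \<notin> {lo..hi + 1}} = {}" "{x \<in> {lo..hi}. x + 1 \<notin> {lo..hi + 1}} = {}"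
      by auto
    have "en \<beta> s N (cfg (incr b 1)) = en \<beta> s N (cfg b)
     + (2 * \<beta> + s) * card {lo..hi + 1} - (2 * \<beta> + s) * card {lo..hi}
     + (2 - \<beta>) * (card {x \<in> {lo..hi}. x \<notin> {lo..hi + 1}} + card {x \<in> {lo..hi}. x + 1 \<notin> {lo..hi + 1}})"
      by (rule E) (use lohi one zero minus Nb inc in auto)
    moreover have "real (card {lo..hi + 1}) = real (card {lo..hi}) + 1" using lohi by simp
    ultimately show ?thesis unfolding e by (simp add: algebra_simps)
  qed
  show "en \<beta> s N (cfg b) < en \<beta> s N w" if "w \<noteq> cfg b"
  proof (cases "X = {}")
    case True
    then have "Z \<noteq> {}" using that form by (auto simp: fun_eq_iff)
    then have "0 < e" using True fin by (auto simp: e_def Y_def card_gt_0_iff)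
    then have "0 < \<beta> * e" using \<beta> by simp
    then show ?thesis using lb nn by linarith
  next
    case False
    then show ?thesis using X1 lb nn \<beta> by linarith
  qed
  show "en \<beta> s N (cfg b) + \<beta> \<le> en \<beta> s N w" if "A \<noteq> {}"
    proof -
    have "X \<noteq> {}" using that A_eq by simp
    then show ?thesis using X1 lb nn \<beta> by linarith
  qed
  show "en \<beta> s N (cfg b) + 2 * \<beta> + s \<le> en \<beta> s N w" if "A \<noteq> {}"
    proof -
    have "X \<noteq> {}" using that A_eq by simp
    then show ?thesis using X1 lb nn \<beta> by linarith
  qed
  show "en \<beta> s N (cfg b) + 2 * \<beta> + s < en \<beta> s N w" if L: "A = layer b 1" "w \<noteq> cfg (incr b 1)"
  proof -
    have XX: "X = {lo..hi}" using L layer_eq by simp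
    have Y: "Y = {lo..hi + 1}" using lohi unfolding Y_def XX by auto
    have "Z \<noteq> Y" using L(2) inc form unfolding Y XX by (auto simp: fun_eq_iff)
    then have "Y - Z \<noteq> {}" using fin(4) Y by auto
    then have "0 < d" using finY by (auto simp: d_def card_gt_0_iff)
    then have "0 < \<omega> * d" using w0 by simp
    moreover have "X \<noteq> {}" using XX lohi by auto
    ultimately show ?thesis using lb nn X1 by linarith
  qed
qed

subsection \<open>Quarter turns\<close>

definition rot :: "cell \<Rightarrow> cell" where
  "rot p = (- snd p, fst p)"

definition rotv :: "(nat \<Rightarrow> int) \<Rightarrow> nat \<Rightarrow> int" where
  "rotv b i = b ((i + 2) mod 8)"

lemma rot_Pair [simp]: "rot (x, y) = (-y, x)"
  by (simp add: rot_def)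

lemma bij_rot: "bij rot"
  by (rule o_bij[of "\<lambda>p. (snd p, - fst p)"]) (auto simp: rot_def fun_eq_iff)

lemma rot_grid: "bij_betw rot (grid N) (grid N)"
  by (rule bij_betw_byWitness[of _ "\<lambda>p. (snd p, - fst p)"]) (auto simp: rot_def grid_def)

lemma rot_mem_oct: "rot p \<in> oct b \<longleftrightarrow> p \<in> oct (rotv b)"
  by (cases p) (auto simp: oct_iff rotv_def simp flip: numeral_2_eq_2)

lemma cfg_rot: "cfg b (rot p) = cfg (rotv b) p"
proof -
  have "(\<lambda>i. rotv b i + 1) = rotv (\<lambda>i. b i + 1)" by (simp add: rotv_def fun_eq_iff)
  then show ?thesis by (simp add: cfg_def rot_mem_oct)
qed

lemma tight_rotv: "tight (rotv b) \<longleftrightarrow> tight b"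
  by (auto simp: tight_iff rotv_def simp flip: numeral_2_eq_2)

lemma incr_rotv: "i < 8 \<Longrightarrow> j < 8 \<Longrightarrow> incr (rotv b) i j = rotv (incr b ((i + 2) mod 8)) j"
  unfolding incr_def rotv_def by (auto simp: mod_if split: if_splits)

lemma side_rotv: "i < 8 \<Longrightarrow> side (rotv b) i = side b ((i + 2) mod 8)"
proof -
  assume "i < 8"
  then have "i \<in> {0, 1, 2, 3, 4, 5, 6, 7}" by auto
  then show ?thesis by (auto simp: side_def rotv_def simp flip: numeral_2_eq_2)
qed

lemma layer_rotv: "i < 8 \<Longrightarrow> layer (rotv b) i = {p. rot p \<in> layer b ((i + 2) mod 8)}"
proof -
  assume "i < 8"
  then have "oct (incr (rotv b) i) = oct (rotv (incr b ((i + 2) mod 8)))"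
    by (intro oct_cong incr_rotv)
  then show ?thesis by (auto simp: layer_def rot_mem_oct)
qed

lemma conf_rot: "conf N u \<Longrightarrow> conf N (u \<circ> rot)"
proof -
  assume u: "conf N u"
  have "(u \<circ> rot) p \<in> {-1, 0, 1}" for p
    using u unfolding conf_def o_apply by blast
  moreover have "\<bar>x\<bar> < N \<and> \<bar>y\<bar> < N" if "(u \<circ> rot) (x, y) \<noteq> -1" for x y
  proof -
    have "\<bar>- y\<bar> < N \<and> \<bar>x\<bar> < N" using u that unfolding conf_def o_apply rot_Pair by blast
    then show ?thesis by simp
  qed
  ultimately show ?thesis unfolding conf_def by blast
qed

text \<open>The turn maps upward bonds to leftward ones, so the horizontal sum has to be shifted by
  one column. The columns lost and gained contribute nothing because \<open>u\<close> equals -1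
  there.\<close>

lemma en_rot:
  assumes "conf N u"
  shows "en \<beta> s N (u \<circ> rot) = en \<beta> s N u"
proof -
  have supp: "u p = -1" if "\<bar>fst p\<bar> \<ge> N \<or> \<bar>snd p\<bar> \<ge> N" for p
  proof (cases p)
    case (Pair x y)
    then have "u (x, y) \<noteq> -1 \<longrightarrow> \<bar>x\<bar> < N \<and> \<bar>y\<bar> < N"
      using assms unfolding conf_def by blast
    then show ?thesis using that Pair by auto
  qed
  define g where "g p = bond_cost \<beta> (u p) (u (p + (1, 0)))" for p :: cell
  define f where "f p = bond_cost \<beta> (u p) (u (p + (-1, 0))) + bond_cost \<beta> (u p) (u (p + (0, 1))) + s * of_bool (u p = 0)" for p :: cell
  have site: "site_en \<beta> s (u \<circ> rot) p = f (rot p)" for p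
    by (cases p) (simp add: site_en_def f_def)
  have "en \<beta> s N (u \<circ> rot) = (\<Sum>p\<in>grid N. f p)"
    unfolding en_def site by (rule sum.reindex_bij_betw[OF rot_grid])
  also have "\<dots> = (\<Sum>p\<in>grid N. g (p + (-1, 0))) + (\<Sum>p\<in>grid N. bond_cost \<beta> (u p) (u (p + (0, 1))) + s * of_bool (u p = 0))"
  proof -
    have "bond_cost \<beta> (u p) (u (p + (-1, 0))) = g (p + (-1, 0))" for p
      by (cases p) (simp add: g_def bond_cost_commute)
    then show ?thesis by (simp add: f_def sum.distrib)
  qed
  also have "(\<Sum>p\<in>grid N. g (p + (-1, 0))) = (\<Sum>q\<in>(\<lambda>p. p + (-1, 0)) ` grid N. g q)"
    by (subst sum.reindex) (auto simp: inj_on_def)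
  also have "\<dots> = (\<Sum>q\<in>grid N. g q)"
  proof (rule sum.mono_neutral_cong)
    fix q assume q: "q \<in> (\<lambda>p. p + (-1, 0)) ` grid N - grid N"
    then have "fst q = -N - 1" by (auto simp: grid_def)
    then have "\<bar>fst q\<bar> \<ge> N" "\<bar>fst (q + (1, 0))\<bar> \<ge> N" by auto
    then show "g q = 0" unfolding g_def using supp[of q] supp[of "q + (1, 0)"] by (simp add: bond_cost_simps)
  next
    fix q assume q: "q \<in> grid N - (\<lambda>p. p + (-1, 0)) ` grid N"
    have "fst q = N"
    proof (rule ccontr)
      assume "fst q \<noteq> N"
      then have "q + (1, 0) \<in> grid N" using q by (cases q) (auto simp: grid_def)
      moreover have "q = (q + (1, 0)) + (-1, 0)" by (cases q) simp
      ultimately show False using q by blast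
    qed
    then have "\<bar>fst q\<bar> \<ge> N" "\<bar>fst (q + (1, 0))\<bar> \<ge> N" by (auto simp: fst_add)
    then show "g q = 0" unfolding g_def using supp[of q] supp[of "q + (1, 0)"] by (simp add: bond_cost_simps)
  qed auto
  also have "(\<Sum>q\<in>grid N. g q) + (\<Sum>p\<in>grid N. bond_cost \<beta> (u p) (u (p + (0, 1))) + s * of_bool (u p = 0)) = en \<beta> s N u"
    unfolding en_def site_en_def g_def by (simp add: sum.distrib)
  finally show ?thesis .
qed

text \<open>One statement of the same shape for flat and diagonal layers, so that a quarter turn
  transports all conclusions by rewriting.\<close>

definition layer_gap ::
  "real \<Rightarrow> real \<Rightarrow> int \<Rightarrow> nat \<Rightarrow> (nat \<Rightarrow> int) \<Rightarrow> nat \<Rightarrow> (cell \<Rightarrow> int) \<Rightarrow> cell set \<Rightarrow> bool" where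
  "layer_gap \<beta> s N \<Lambda> b i w A \<longleftrightarrow>
     en \<beta> s N (cfg (incr b i)) = en \<beta> s N (cfg b) + 2 * \<beta> + (if odd i then s else 0) \<and>
     (w \<noteq> cfg b \<longrightarrow> en \<beta> s N (cfg b) < en \<beta> s N w) \<and>
     (A \<noteq> {} \<longrightarrow> en \<beta> s N (cfg b) + \<beta> \<le> en \<beta> s N w) \<and>
     (A \<noteq> {} \<longrightarrow> odd i \<or> \<Lambda> \<le> card A \<longrightarrow> en \<beta> s N (cfg (incr b i)) \<le> en \<beta> s N w) \<and>
     (A = layer b i \<longrightarrow> odd i \<or> \<Lambda> \<le> card A \<longrightarrow> w \<noteq> cfg (incr b i) \<longrightarrow>
        en \<beta> s N (cfg (incr b i)) < en \<beta> s N w)"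

text \<open>The even and the odd indices are one orbit each under the quarter turn, so the top side
  and the upper right side determine all cases.\<close>

lemma layer_step:
  fixes b :: "nat \<Rightarrow> int"
  assumes "i < 8" "tight b" "tight (incr b i)" "conf N (cfg (incr b i))"
    and "\<And>p. cfg b p \<le> w p" "\<And>p. w p \<le> cfg (incr b i) p"
    and \<beta>: "0 < \<beta>" "\<bar>s\<bar> \<le> \<beta> / 2" "\<bar>s\<bar> \<le> (2 - 3 * \<beta>) / 2" "\<beta> < real \<Lambda> * ((2 - 3 * \<beta>) / 2)"
  shows "layer_gap \<beta> s N \<Lambda> b i w {p \<in> layer b i. w p = 1}"
proof -
  define P where "P b i \<longleftrightarrow> (\<forall>w. tight b \<longrightarrow> tight (incr b i) \<longrightarrow> conf N (cfg (incr b i)) \<longrightarrow> (\<forall>p. cfg b p \<le> w p) \<longrightarrow>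
     (\<forall>p. w p \<le> cfg (incr b i) p) \<longrightarrow> layer_gap \<beta> s N \<Lambda> b i w {p \<in> layer b i. w p = 1})"
    for b :: "nat \<Rightarrow> int" and i
  have P2: "P b 2" for b
    unfolding P_def
  proof (intro allI impI)
    fix w assume h: "tight b" "tight (incr b 2)" "conf N (cfg (incr b 2))" "\<forall>p. cfg b p \<le> w p" "\<forall>p. w p \<le> cfg (incr b 2) p"
    note st = layer_step_top[OF h(1-3) h(4)[rule_format] h(5)[rule_format] \<beta> refl]
    have ev: "odd (2::nat) = False" by simp
    show "layer_gap \<beta> s N \<Lambda> b 2 w {p \<in> layer b 2. w p = 1}"
      unfolding layer_gap_def ev if_False simp_thms st(1) add_0_right
      by (intro conjI impI refl st(2) st(3) st(4) st(5))
  qed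
  have P1: "P b 1" for b
    unfolding P_def
  proof (intro allI impI)
    fix w assume h: "tight b" "tight (incr b 1)" "conf N (cfg (incr b 1))" "\<forall>p. cfg b p \<le> w p" "\<forall>p. w p \<le> cfg (incr b 1) p"
    note st = layer_step_ne[OF h(1-3) h(4)[rule_format] h(5)[rule_format] \<beta> refl]
    have ev: "odd (1::nat) = True" by simp
    show "layer_gap \<beta> s N \<Lambda> b 1 w {p \<in> layer b 1. w p = 1}"
      unfolding layer_gap_def ev if_True simp_thms st(1)
      by (intro conjI impI refl st(2) st(3) st(4) st(5))
  qed
  have turn: "P b ((i + 2) mod 8)" if "i < 8" "P (rotv b) i" for b i
    unfolding P_def
  proof (intro allI impI)
    let ?i = "(i + 2) mod 8"
    fix w assume h: "tight b" "tight (incr b ?i)" "conf N (cfg (incr b ?i))" "\<forall>p. cfg b p \<le> w p" "\<forall>p. w p \<le> cfg (incr b ?i) p"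
    have c: "cfg (rotv b) = cfg b \<circ> rot" by (simp add: fun_eq_iff cfg_rot)
    have c': "cfg (incr (rotv b) i) = cfg (incr b ?i) \<circ> rot"
      using cfg_cong[of "incr (rotv b) i" "rotv (incr b ?i)"] incr_rotv[OF that(1)]
      by (simp add: fun_eq_iff cfg_rot)
    have t: "tight (incr (rotv b) i) \<longleftrightarrow> tight (incr b ?i)"
    proof -
      have "tight (incr (rotv b) i) \<longleftrightarrow> tight (rotv (incr b ?i))"
        by (simp add: tight_iff incr_rotv[OF that(1)])
      then show ?thesis by (simp add: tight_rotv)
    qed
    have wr: "(w \<circ> rot = v \<circ> rot) \<longleftrightarrow> w = v" for v
      using bij_is_surj[OF bij_rot] surj_fun_eq[of rot UNIV w v] by (auto simp: fun_eq_iff)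
    have A: "{p \<in> layer (rotv b) i. (w \<circ> rot) p = 1} = rot -` {p \<in> layer b ?i. w p = 1}"
      by (auto simp: layer_rotv[OF that(1)])
    have A': "layer (rotv b) i = rot -` layer b ?i"
      by (auto simp: layer_rotv[OF that(1)])
    have cd: "card (rot -` S) = card S" for S
      using bij_rot by (intro card_vimage_inj) (auto simp: bij_is_inj bij_is_surj)
    have im: "rot ` (rot -` S) = S" for S
      using bij_is_surj[OF bij_rot] by (rule surj_image_vimage_eq)
    have emp: "rot -` S = {} \<longleftrightarrow> S = {}" for S
      using im[of S] image_empty[of rot] vimage_empty[of rot] by metis
    have eq: "rot -` S = rot -` S' \<longleftrightarrow> S = S'" for S S'
      using im[of S] im[of S'] by metis
    have ev: "odd ?i \<longleftrightarrow> odd i" by presburger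
    have cw: "conf N w" "conf N (cfg b)"
    proof -
      have "w p \<noteq> -1 \<Longrightarrow> cfg (incr b ?i) p \<noteq> -1" "cfg b p \<noteq> -1 \<Longrightarrow> cfg (incr b ?i) p \<noteq> -1"
        "w p \<in> {-1, 0, 1}" "cfg b p \<in> {-1, 0, 1}" for p
        using h(4,5)[rule_format, of p] by (auto simp: cfg_def split: if_splits)
      then show "conf N w" "conf N (cfg b)" using h(3) unfolding conf_def by blast+
    qed
    note er = en_rot[OF cw(1), of \<beta> s] en_rot[OF cw(2), of \<beta> s] en_rot[OF h(3), of \<beta> s]
    have cf: "conf N (cfg (incr (rotv b) i))" unfolding c' by (rule conf_rot[OF h(3)])
    have le: "\<forall>p. cfg (rotv b) p \<le> (w \<circ> rot) p" "\<forall>p. (w \<circ> rot) p \<le> cfg (incr (rotv b) i) p"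
      unfolding c c' using h(4,5) by simp_all
    have tr: "tight (rotv b)" "tight (incr (rotv b) i)" using h(1,2) t tight_rotv by blast+
    have "layer_gap \<beta> s N \<Lambda> (rotv b) i (w \<circ> rot) {p \<in> layer (rotv b) i. (w \<circ> rot) p = 1}"
      using that(2)[unfolded P_def, rule_format, OF tr cf le[rule_format]] .
    then show "layer_gap \<beta> s N \<Lambda> b ?i w {p \<in> layer b ?i. w p = 1}"
      unfolding layer_gap_def A unfolding A' c c' er wr cd emp eq ev .
  qed
  have P3: "P b 3" for b using turn[of 1 b] P1 by simp
  have P4: "P b 4" for b using turn[of 2 b] P2 by simp
  have P5: "P b 5" for b using turn[of 3 b] P3 by simp
  have P6: "P b 6" for b using turn[of 4 b] P4 by simp
  have P7: "P b 7" for b using turn[of 5 b] P5 by simp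
  have P0: "P b 0" for b using turn[of 6 b] P6 by simp
  have "i \<in> {0, 1, 2, 3, 4, 5, 6, 7}" using assms(1) by auto
  then have "P b i"
    by (elim insertE) (simp_all only: P0 P1 P2 P3 P4 P5 P6 P7 empty_iff)
  then show ?thesis using assms(2-6) unfolding P_def by blast
qed

subsection \<open>Depth inside an octagon\<close>

text \<open>The \<open>+ 1\<close> turns the minimal slack into the l1 distance, in lattice steps,
  from a cell of \<open>oct b\<close> to the outside: cells next to the boundary have depth
  1.\<close>

definition dep :: "(nat \<Rightarrow> int) \<Rightarrow> cell \<Rightarrow> int" where
  "dep b p = Min ((\<lambda>i. b i - phi i p) ` {..<8}) + 1"

lemma le_dep_iff: "k \<le> dep b p \<longleftrightarrow> (\<forall>i<8. k \<le> b i - phi i p + 1)"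
proof -
  have "k \<le> dep b p \<longleftrightarrow> k - 1 \<le> Min ((\<lambda>i. b i - phi i p) ` {..<8})"
    by (auto simp: dep_def)
  also have "\<dots> \<longleftrightarrow> (\<forall>x\<in>(\<lambda>i. b i - phi i p) ` {..<8}. k - 1 \<le> x)"
    by (rule Min_ge_iff) (auto simp: lessThan_empty_iff)
  also have "\<dots> \<longleftrightarrow> (\<forall>i<8. k \<le> b i - phi i p + 1)" by (force simp: Ball_def)
  finally show ?thesis .
qed

lemma dep_le: "i < 8 \<Longrightarrow> dep b p \<le> b i - phi i p + 1"
  using le_dep_iff[of "dep b p" b p] by blast

lemma mem_oct_iff_dep: "p \<in> oct b \<longleftrightarrow> 1 \<le> dep b p"
  by (auto simp: le_dep_iff oct_def)

lemma phi_rot: "i < 8 \<Longrightarrow> phi ((i + 2) mod 8) (rot p) = phi i p"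
proof -
  assume "i < 8"
  then have "i \<in> {0, 1, 2, 3, 4, 5, 6, 7}" by auto
  then show ?thesis by (auto simp: phi_def rot_def simp flip: numeral_2_eq_2)
qed

lemma all_less_8_shift: "(\<forall>i<8. P ((i + 2) mod 8)) \<longleftrightarrow> (\<forall>i<8. P (i :: nat))"
  by (auto simp: all_less_8 simp flip: numeral_2_eq_2)

lemma dep_rotv: "dep (rotv b) p = dep b (rot p)"
proof -
  have "k \<le> dep (rotv b) p \<longleftrightarrow> k \<le> dep b (rot p)" for k
  proof -
    have "k \<le> dep (rotv b) p \<longleftrightarrow> (\<forall>i<8. k \<le> b ((i + 2) mod 8) - phi ((i + 2) mod 8) (rot p) + 1)"
      unfolding le_dep_iff rotv_def using phi_rot by simp
    then show ?thesis
      unfolding le_dep_iff using all_less_8_shift[of "\<lambda>i. k \<le> b i - phi i (rot p) + 1"] by simp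
  qed
  from this[of "dep b (rot p)"] this[of "dep (rotv b) p"] show ?thesis by auto
qed

text \<open>Reduces a claim about all sides of all octagons to the top side, or to the upper right
  side.\<close>

lemma rot_induct:
  fixes P :: "(nat \<Rightarrow> int) \<Rightarrow> nat \<Rightarrow> bool"
  assumes "i < 8" and turn: "\<And>b i. i < 8 \<Longrightarrow> P (rotv b) i \<Longrightarrow> P b ((i + 2) mod 8)"
  shows "(\<And>b. P b 2) \<Longrightarrow> even i \<Longrightarrow> P b i" and "(\<And>b. P b 1) \<Longrightarrow> odd i \<Longrightarrow> P b i"
proof -
  have i: "i \<in> {0, 1, 2, 3, 4, 5, 6, 7}" using assms(1) by auto
  show "P b i" if "\<And>b. P b 2" "even i"
  proof -
    have "P b 4" for b using turn[of 2 b] that by simp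
    moreover from this have "P b 6" for b using turn[of 4 b] by simp
    moreover from this have "P b 0" for b using turn[of 6 b] by simp
    ultimately show ?thesis using i that by auto
  qed
  show "P b i" if "\<And>b. P b 1" "odd i"
  proof -
    have "P b 3" for b using turn[of 1 b] that by simp
    moreover from this have "P b 5" for b using turn[of 3 b] by simp
    moreover from this have "P b 7" for b using turn[of 5 b] by simp
    ultimately show ?thesis using i that by auto
  qed
qed

lemma tight_incr_rotv: "i < 8 \<Longrightarrow> tight (incr (rotv b) i) \<longleftrightarrow> tight (incr b ((i + 2) mod 8))"
proof -
  assume "i < 8"
  then have "tight (incr (rotv b) i) \<longleftrightarrow> tight (rotv (incr b ((i + 2) mod 8)))"
    by (simp add: tight_iff incr_rotv)
  then show ?thesis by (simp add: tight_rotv)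
qed

lemma layer_rotv_vimage: "i < 8 \<Longrightarrow> layer (rotv b) i = rot -` layer b ((i + 2) mod 8)"
  by (auto simp: layer_rotv)

lemma card_vimage_rot: "card (rot -` S) = card S"
  using bij_rot by (intro card_vimage_inj) (auto simp: bij_is_inj bij_is_surj)

lemma sum_vimage_rot: "(\<Sum>p\<in>rot -` S. f (rot p)) = sum f S"
  by (rule sum.reindex_bij_betw)
    (use bij_rot in \<open>auto simp: bij_betw_def inj_on_def bij_is_surj surj_image_vimage_eq dest: bij_is_inj injD\<close>)

text \<open>A side of \<open>n\<close> steps carries \<open>n + 1\<close> cells. The next row
  outward loses both end cells at a flat side, but only one cell at a diagonal side.\<close>

lemma card_layer:
  assumes "i < 8" "tight b" "tight (incr b i)"
  shows "card (layer b i) = nat (side b i - (if even i then 1 else 0))"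
proof -
  define P where "P b i \<longleftrightarrow> (tight b \<longrightarrow> tight (incr b i) \<longrightarrow>
     card (layer b i) = nat (side b i - (if even i then 1 else 0)))" for b i
  have turn: "P b ((i + 2) mod 8)" if "i < 8" "P (rotv b) i" for b i
  proof -
    have "even ((i + 2) mod 8) \<longleftrightarrow> even i" by presburger
    then show ?thesis
      using that unfolding P_def
      by (simp add: tight_rotv tight_incr_rotv layer_rotv_vimage card_vimage_rot side_rotv)
  qed
  have "P b 2" for b
    unfolding P_def
  proof (intro impI)
    assume t: "tight b" "tight (incr b 2)"
    have "card (layer b 2) = card {b 2 - b 3<..<b 1 - b 2}"
      unfolding layer_top[OF t] by (rule card_image) (simp add: inj_on_def)
    moreover have "b 1 - b 2 - (b 2 - b 3 + 1) = side b 2 - (if even (2::nat) then 1 else 0)"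
      by (simp add: side_simps)
    ultimately show "card (layer b 2) = nat (side b 2 - (if even (2::nat) then 1 else 0))"
      by (simp only: card_greaterThanLessThan_int)
  qed
  moreover have "P b 1" for b
    unfolding P_def
  proof (intro impI)
    assume t: "tight b" "tight (incr b 1)"
    have "card (layer b 1) = card {b 1 + 1 - b 2..b 0}"
      unfolding layer_ne[OF t] by (rule card_image) (simp add: inj_on_def)
    moreover have "b 0 - (b 1 + 1 - b 2) + 1 = side b 1 - (if even (1::nat) then 1 else 0)"
      by (simp add: side_simps)
    ultimately show "card (layer b 1) = nat (side b 1 - (if even (1::nat) then 1 else 0))"
      by (simp only: card_atLeastAtMost_int)
  qed
  ultimately have "P b i"
    using rot_induct[of i P, OF assms(1) turn] by blast
  then show ?thesis using assms unfolding P_def by blast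
qed

lemma finite_oct: "finite (oct b)"
proof -
  have "oct b \<subseteq> {- b 4..b 0} \<times> {- b 6..b 2}" by (auto simp: oct_iff)
  then show ?thesis by (rule finite_subset) auto
qed

lemma finite_layer: "finite (layer b i)"
  unfolding layer_def using finite_oct by simp

text \<open>Only the cells close to the two ends of a flat layer are shallower than its distance
  to the boundary line it is parallel to.\<close>

lemma card_shallow_flat:
  assumes "i < 8" "even i" "tight b" "tight (incr b i)"
    and le: "\<And>j. j < 8 \<Longrightarrow> b j \<le> b0 j" and W: "\<And>j. j < 8 \<Longrightarrow> even j \<Longrightarrow> b0 i - b i \<le> side b j"
    and "b i < b0 i"
  shows "int (card {p \<in> layer b i. dep b0 p < b0 i - b i}) \<le> 2 * (b0 i - b i)"
proof -
  define P where "P b i \<longleftrightarrow> (\<forall>b0. tight b \<longrightarrow> tight (incr b i) \<longrightarrow> (\<forall>j<8. b j \<le> b0 j) \<longrightarrow>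
     (\<forall>j<8. even j \<longrightarrow> b0 i - b i \<le> side b j) \<longrightarrow> b i < b0 i \<longrightarrow>
     int (card {p \<in> layer b i. dep b0 p < b0 i - b i}) \<le> 2 * (b0 i - b i))" for b i
  have turn: "P b ((i + 2) mod 8)" if "i < 8" "P (rotv b) i" for b i
    unfolding P_def
  proof (intro allI impI)
    let ?i = "(i + 2) mod 8"
    fix b0 assume h: "tight b" "tight (incr b ?i)" "\<forall>j<8. b j \<le> b0 j"
      "\<forall>j<8. even j \<longrightarrow> b0 ?i - b ?i \<le> side b j" "b ?i < b0 ?i"
    have "\<forall>j<8. rotv b j \<le> rotv b0 j" using h(3) by (simp add: rotv_def)
    moreover have "\<forall>j<8. even j \<longrightarrow> rotv b0 i - rotv b i \<le> side (rotv b) j"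
    proof (intro allI impI)
      fix j :: nat assume j: "j < 8" "even j"
      then have "even ((j + 2) mod 8)" "(j + 2) mod 8 < 8" by presburger+
      then show "rotv b0 i - rotv b i \<le> side (rotv b) j"
        using h(4) unfolding side_rotv[OF j(1)] by (simp add: rotv_def)
    qed
    moreover have "{p \<in> layer (rotv b) i. dep (rotv b0) p < rotv b0 i - rotv b i}
        = rot -` {p \<in> layer b ?i. dep b0 p < b0 ?i - b ?i}"
      by (auto simp: layer_rotv[OF that(1)] dep_rotv rotv_def)
    moreover have "tight (rotv b)" "tight (incr (rotv b) i)" "rotv b i < rotv b0 i"
      using h(1,2,5) tight_rotv tight_incr_rotv[OF that(1)] by (auto simp: rotv_def)
    ultimately have "int (card (rot -` {p \<in> layer b ?i. dep b0 p < b0 ?i - b ?i})) \<le> 2 * (rotv b0 i - rotv b i)"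
      using that(2)[unfolded P_def, rule_format, of "rotv b0"] by simp
    then show "int (card {p \<in> layer b ?i. dep b0 p < b0 ?i - b ?i}) \<le> 2 * (b0 ?i - b ?i)"
      unfolding card_vimage_rot by (simp add: rotv_def)
  qed
  have "P b 2" for b
    unfolding P_def
  proof (intro allI impI)
    fix b0 assume h: "tight b" "tight (incr b 2)" "\<forall>j<8. b j \<le> b0 j"
      "\<forall>j<8. even j \<longrightarrow> b0 2 - b 2 \<le> side b j" "b 2 < b0 2"
    define \<tau> where "\<tau> = b0 2 - b 2"
    have s: "\<tau> \<le> side b 0" using h(4)[rule_format, of 0] by (simp add: \<tau>_def)
    note h3 = h(3)[unfolded all_less_8] and T = h(1)[unfolded tight_iff]
    have "{p \<in> layer b 2. dep b0 p < \<tau>} \<subseteq> (\<lambda>x. (x, b 2 + 1)) ` ({b 2 - b 3<..<b 2 - b 3 + \<tau>} \<union> {b 1 - b 2 - \<tau><..<b 1 - b 2})"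
    proof
      fix p assume p: "p \<in> {p \<in> layer b 2. dep b0 p < \<tau>}"
      then obtain x where x: "p = (x, b 2 + 1)" "b 2 - b 3 < x" "x < b 1 - b 2"
        using layer_top[OF h(1,2)] by auto
      have "x < b 2 - b 3 + \<tau> \<or> b 1 - b 2 - \<tau> < x"
      proof (rule ccontr)
        assume c: "\<not> ?thesis"
        \<comment> \<open>The line through the side itself is at distance at least
          \<open>\<tau>\<close> by the height of the row, the two adjacent diagonal lines by
          \<open>c\<close>, the remaining ones by the lengths of the sides.\<close>
        have "\<tau> \<le> dep b0 p"
          unfolding le_dep_iff all_less_8 using c x h3 T s
          by (simp add: phi_def side_simps \<tau>_def) 
        then show False using p by simp
      qed
      then show "p \<in> (\<lambda>x. (x, b 2 + 1)) ` ({b 2 - b 3<..<b 2 - b 3 + \<tau>} \<union> {b 1 - b 2 - \<tau><..<b 1 - b 2})"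
        using x by auto
    qed
    then have "card {p \<in> layer b 2. dep b0 p < \<tau>}
      \<le> card ((\<lambda>x. (x, b 2 + 1)) ` ({b 2 - b 3<..<b 2 - b 3 + \<tau>} \<union> {b 1 - b 2 - \<tau><..<b 1 - b 2}))"
      by (rule card_mono[rotated]) simp
    also have "\<dots> \<le> card ({b 2 - b 3<..<b 2 - b 3 + \<tau>} \<union> {b 1 - b 2 - \<tau><..<b 1 - b 2})"
      by (rule card_image_le) simp
    also have "\<dots> \<le> card {b 2 - b 3<..<b 2 - b 3 + \<tau>} + card {b 1 - b 2 - \<tau><..<b 1 - b 2}"
      by (rule card_Un_le)
    also have "\<dots> \<le> 2 * nat \<tau>" by simp
    finally have "int (card {p \<in> layer b 2. dep b0 p < \<tau>}) \<le> int (2 * nat \<tau>)"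
      by (simp only: of_nat_le_iff)
    also have "\<dots> = 2 * \<tau>" using h(5) by (simp add: \<tau>_def)
    finally show "int (card {p \<in> layer b 2. dep b0 p < b0 2 - b 2}) \<le> 2 * (b0 2 - b 2)"
      by (simp only: \<tau>_def)
  qed
  then have "P b i"
    using rot_induct(1)[of i P, OF assms(1) turn] assms(2) by blast
  then show ?thesis using assms unfolding P_def by blast
qed

text \<open>A diagonal layer is cut out by its own height and the two adjacent flat heights, so
  octagons that agree in these share it.\<close>

lemma layer_diagonal_eq:
  assumes "i < 8" "odd i" "tight b" "tight (incr b i)" "tight g" "tight (incr g i)"
    and "\<And>j. j < 8 \<Longrightarrow> even j \<Longrightarrow> g j = b j" and "g i = b i"
  shows "layer g i = layer b i"
proof -
  define P where "P b i \<longleftrightarrow> (\<forall>g. tight b \<longrightarrow> tight (incr b i) \<longrightarrow> tight g \<longrightarrow> tight (incr g i) \<longrightarrow>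
     (\<forall>j<8. even j \<longrightarrow> g j = b j) \<longrightarrow> g i = b i \<longrightarrow> layer g i = layer b i)" for b i
  have turn: "P b ((i + 2) mod 8)" if "i < 8" "P (rotv b) i" for b i
    unfolding P_def
  proof (intro allI impI)
    let ?i = "(i + 2) mod 8"
    fix g assume h: "tight b" "tight (incr b ?i)" "tight g" "tight (incr g ?i)" "\<forall>j<8. even j \<longrightarrow> g j = b j"
      "g ?i = b ?i"
    have "\<forall>j<8. even j \<longrightarrow> rotv g j = rotv b j"
    proof (intro allI impI)
      fix j :: nat assume "j < 8" "even j"
      then have "even ((j + 2) mod 8)" "(j + 2) mod 8 < 8" by presburger+
      then show "rotv g j = rotv b j" using h(5) by (simp add: rotv_def)
    qed
    then have "layer (rotv g) i = layer (rotv b) i"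
      using that(2)[unfolded P_def, rule_format, of "rotv g"] h tight_rotv tight_incr_rotv[OF that(1)]
      by (simp add: rotv_def)
    then show "layer g ?i = layer b ?i"
      unfolding layer_rotv_vimage[OF that(1)]
      using surj_image_vimage_eq[OF bij_is_surj[OF bij_rot]] by metis
  qed
  have "P b 1" for b
    unfolding P_def by (simp add: layer_ne)
  then have "P b i"
    using rot_induct(2)[of i P, OF assms(1) turn] assms(2) by blast
  then show ?thesis using assms unfolding P_def by blast
qed

text \<open>A diagonal layer further out embeds, by a translation that increases the depth, as a
  proper subset into a layer further in.\<close>

lemma sum_dep_diagonal_layers:
  assumes "i < 8" "odd i" "tight b" "tight (incr b i)" "tight g" "tight (incr g i)"
    and "\<And>j. j < 8 \<Longrightarrow> even j \<Longrightarrow> g j = b j" and "b i < g i" "g i < b0 i"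
    and "\<And>j. j < 8 \<Longrightarrow> b j \<le> b0 j" and "\<And>j. j < 8 \<Longrightarrow> even j \<Longrightarrow> 2 * (b0 i - b i) \<le> side b j"
  shows "(\<Sum>p\<in>layer g i. dep b0 p) < (\<Sum>p\<in>layer b i. dep b0 p)"
proof -
  define P where "P b i \<longleftrightarrow> (\<forall>g b0. tight b \<longrightarrow> tight (incr b i) \<longrightarrow> tight g \<longrightarrow> tight (incr g i) \<longrightarrow>
     (\<forall>j<8. even j \<longrightarrow> g j = b j) \<longrightarrow> b i < g i \<longrightarrow> g i < b0 i \<longrightarrow> (\<forall>j<8. b j \<le> b0 j) \<longrightarrow>
     (\<forall>j<8. even j \<longrightarrow> 2 * (b0 i - b i) \<le> side b j) \<longrightarrow>
     (\<Sum>p\<in>layer g i. dep b0 p) < (\<Sum>p\<in>layer b i. dep b0 p))" for b i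
  have turn: "P b ((i + 2) mod 8)" if "i < 8" "P (rotv b) i" for b i
    unfolding P_def
  proof (intro allI impI)
    let ?i = "(i + 2) mod 8"
    fix g b0 assume h: "tight b" "tight (incr b ?i)" "tight g" "tight (incr g ?i)" "\<forall>j<8. even j \<longrightarrow> g j = b j"
      "b ?i < g ?i" "g ?i < b0 ?i" "\<forall>j<8. b j \<le> b0 j" "\<forall>j<8. even j \<longrightarrow> 2 * (b0 ?i - b ?i) \<le> side b j"
    have e: "\<forall>j<8. even j \<longrightarrow> rotv g j = rotv b j"
      "\<forall>j<8. even j \<longrightarrow> 2 * (rotv b0 i - rotv b i) \<le> side (rotv b) j"
    proof (safe)
      fix j :: nat assume j: "j < 8" "even j"
      then have j2: "even ((j + 2) mod 8)" "(j + 2) mod 8 < 8" by presburger+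
      then show "rotv g j = rotv b j" using h(5) by (simp add: rotv_def)
      show "2 * (rotv b0 i - rotv b i) \<le> side (rotv b) j"
        using h(9) j2 unfolding side_rotv[OF j(1)] by (simp add: rotv_def)
    qed
    have r: "rotv b i < rotv g i" "rotv g i < rotv b0 i" "\<forall>j<8. rotv b j \<le> rotv b0 j"
      using h(6-8) by (simp_all add: rotv_def)
    have t: "tight (rotv b)" "tight (incr (rotv b) i)" "tight (rotv g)" "tight (incr (rotv g) i)"
      using h(1-4) tight_rotv tight_incr_rotv[OF that(1)] by blast+
    have "(\<Sum>p\<in>layer (rotv g) i. dep (rotv b0) p) < (\<Sum>p\<in>layer (rotv b) i. dep (rotv b0) p)"
      using that(2)[unfolded P_def] t e r by blast
    then show "(\<Sum>p\<in>layer g ?i. dep b0 p) < (\<Sum>p\<in>layer b ?i. dep b0 p)"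
      unfolding dep_rotv layer_rotv_vimage[OF that(1)] sum_vimage_rot .
  qed
  have "P b 1" for b
    unfolding P_def
  proof (intro allI impI)
    fix g b0 assume h: "tight b" "tight (incr b 1)" "tight g" "tight (incr g 1)" "\<forall>j<8. even j \<longrightarrow> g j = b j"
      "b 1 < g 1" "g 1 < b0 1" "\<forall>j<8. b j \<le> b0 j" "\<forall>j<8. even j \<longrightarrow> 2 * (b0 1 - b 1) \<le> side b j"
    define k where "k = g 1 - b 1"
    have k: "0 < k" "k < b0 1 - b 1" using h by (auto simp: k_def)
    have ge: "g 0 = b 0" "g 2 = b 2" using h(5) by auto
    have s: "2 * (b0 1 - b 1) \<le> side b 2" using h(9)[rule_format, of 2] by simp
    note T = h(1)[unfolded tight_iff] and B = h(8)[unfolded all_less_8] and T' = h(2)[unfolded tight_iff incr_def, simplified]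
    \<comment> \<open>A shift to the left by the difference of the heights moves the outer diagonal
      onto the inner one.\<close>
    let ?f = "\<lambda>p. p + (-k, 0) :: cell"
    have lg: "layer g 1 = (\<lambda>x. (x, g 1 + 1 - x)) ` {g 1 + 1 - b 2..b 0}"
      and lb: "layer b 1 = (\<lambda>x. (x, b 1 + 1 - x)) ` {b 1 + 1 - b 2..b 0}"
      using layer_ne[OF h(1,2)] layer_ne[OF h(3,4)] ge by simp_all
    have sub: "?f ` layer g 1 \<subseteq> layer b 1"
      unfolding lg lb using k by (auto simp: image_iff k_def)
    \<comment> \<open>Only the slacks of the three left-hand sides shrink. They stay above the slack
      of side 1, which bounds the depth from above, because the sides are long.\<close>
    have depf: "dep b0 p \<le> dep b0 (?f p)" if "p \<in> layer g 1" for p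
    proof -
      obtain x where x: "p = (x, g 1 + 1 - x)" "g 1 + 1 - b 2 \<le> x" "x \<le> b 0" using \<open>p \<in> layer g 1\<close> unfolding lg by auto
      have "dep b0 p \<le> b0 i - phi i p + 1" if "i < 8" for i using that by (rule dep_le)
      then have D: "\<forall>i<8. dep b0 p \<le> b0 i - phi i p + 1" by blast
      show ?thesis
        unfolding le_dep_iff[of "dep b0 p" b0 "?f p"] all_less_8
        using D[unfolded all_less_8] x T B s k by (simp add: phi_def k_def side_simps)
    qed
    \<comment> \<open>The right end of the inner layer is missed by the shift; its positive depth
      makes the inequality strict.\<close>
    define z where "z = (b 0, b 1 + 1 - b 0)"
    have z: "z \<in> layer b 1" unfolding lb z_def using T' by auto
    have z': "z \<notin> ?f ` layer g 1" unfolding lg z_def using k by auto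
    have zd: "1 \<le> dep b0 z"
    proof -
      have "z \<in> oct (incr b 1)" using z by (auto simp: layer_def)
      moreover have "incr b 1 j \<le> b0 j" if "j < 8" for j
        using h(8) h(6,7) that by (auto simp: incr_def)
      ultimately have "z \<in> oct b0" using oct_mono[of "incr b 1" b0] by blast
      then show ?thesis by (simp add: mem_oct_iff_dep)
    qed
    have pos: "0 \<le> dep b0 p" if "p \<in> layer b 1" for p
    proof -
      have "p \<in> oct (incr b 1)" using that by (auto simp: layer_def)
      moreover have "incr b 1 j \<le> b0 j" if "j < 8" for j
        using h(8) h(6,7) that by (auto simp: incr_def)
      ultimately have "p \<in> oct b0" using oct_mono[of "incr b 1" b0] by blast
      then show ?thesis by (simp add: mem_oct_iff_dep)
    qed
    have "(\<Sum>p\<in>layer g 1. dep b0 p) \<le> (\<Sum>p\<in>layer g 1. dep b0 (?f p))"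
      by (rule sum_mono) (rule depf)
    also have "\<dots> = (\<Sum>p\<in>?f ` layer g 1. dep b0 p)"
      by (subst sum.reindex) (auto simp: inj_on_def)
    also have "\<dots> < (\<Sum>p\<in>?f ` layer g 1. dep b0 p) + dep b0 z" using zd by simp
    also have "\<dots> = (\<Sum>p\<in>insert z (?f ` layer g 1). dep b0 p)"
      using z' finite_layer by simp
    also have "\<dots> \<le> (\<Sum>p\<in>layer b 1. dep b0 p)"
      using sub z pos by (intro sum_mono2 finite_layer) auto
    finally show "(\<Sum>p\<in>layer g 1. dep b0 p) < (\<Sum>p\<in>layer b 1. dep b0 p)" .
  qed
  then have "P b i"
    using rot_induct(2)[of i P, OF assms(1) turn] assms(2) by blast
  then show ?thesis using assms unfolding P_def by blast
qed

subsection \<open>Minimizers of the discrete functional\<close>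

definition nz :: "int \<Rightarrow> (cell \<Rightarrow> int) \<Rightarrow> real" where
  "nz N u = (\<Sum>p\<in>grid N. of_bool (u p = 0))"

definition dis :: "int \<Rightarrow> cell set \<Rightarrow> (cell \<Rightarrow> real) \<Rightarrow> (cell \<Rightarrow> int) \<Rightarrow> real" where
  "dis N I d u = (\<Sum>p\<in>grid N. of_bool ((u p = 1) \<noteq> (p \<in> I)) * d p)"

lemma en_zeros: "en \<beta> s N u = en \<beta> 0 N u + s * nz N u"
  unfolding en_def site_en_def nz_def by (simp add: sum.distrib sum_distrib_left)

lemma en_nonneg: "0 \<le> \<beta> \<Longrightarrow> \<bar>s\<bar> \<le> \<beta> \<Longrightarrow> 0 \<le> en \<beta> s N u"
  unfolding en_def site_en_def
  by (intro sum_nonneg) (auto simp: bond_cost_def)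

lemma cfg_values: "cfg b p \<in> {-1, 0, 1}"
  by (simp add: cfg_def)

lemma cfg_eq_1_iff: "cfg b p = 1 \<longleftrightarrow> p \<in> oct b"
  by (simp add: cfg_def)

lemma conf_mono: "conf N v \<Longrightarrow> (\<And>p. u p \<in> {-1, 0, 1}) \<Longrightarrow> (\<And>p. u p \<le> v p) \<Longrightarrow> conf N u"
proof -
  assume v: "conf N v" and u: "\<And>p. u p \<in> {-1, 0, 1}" "\<And>p. u p \<le> v p"
  have "u p \<noteq> -1 \<Longrightarrow> v p \<noteq> -1" for p using u[of p] by auto
  then show ?thesis using v u(1) unfolding conf_def by blast
qed

lemma conf_cfg_mono: "conf N (cfg c) \<Longrightarrow> (\<And>i. i < 8 \<Longrightarrow> b i \<le> c i) \<Longrightarrow> conf N (cfg b)"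
  using conf_mono[of N "cfg c" "cfg b"] cfg_values cfg_mono by blast

lemma conf_ones_grid: "conf N u \<Longrightarrow> u p = 1 \<Longrightarrow> p \<in> grid N"
proof -
  assume u: "conf N u" "u p = 1"
  then have "u (fst p, snd p) \<noteq> -1" by simp
  then have "\<bar>fst p\<bar> < N \<and> \<bar>snd p\<bar> < N" using u(1) unfolding conf_def by blast
  then show ?thesis by (cases p) (auto simp: grid_def)
qed

lemma incr_simps [simp]: "incr b i i = b i + 1" "j \<noteq> i \<Longrightarrow> incr b i j = b j"
  by (simp_all add: incr_def)

lemma le_incr: "b j \<le> incr b i j"
  by (simp add: incr_def)

text \<open>In lattice units the parameters are \<open>\<beta> = 1 - k\<close>, \<open>\<eta> = \<epsilon> / \<zeta>\<close> and \<open>\<delta> = \<epsilon> powr (\<gamma> - 2) / \<zeta>\<close>;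
  \<open>\<Lambda>\<close> is the number of cells beyond which completing a flat layer pays off.\<close>

locale minimizing =
  fixes \<beta> \<eta> \<delta> nz0 :: real and N :: int and \<Lambda> :: nat and b0 :: "nat \<Rightarrow> int"
    and d :: "cell \<Rightarrow> real" and u :: "cell \<Rightarrow> int"
  assumes \<beta>: "0 < \<beta>" "\<delta> \<le> \<beta> / 2" "\<delta> \<le> (2 - 3 * \<beta>) / 2" "\<beta> < real \<Lambda> * ((2 - 3 * \<beta>) / 2)"
    and \<delta>: "0 \<le> \<delta>" and \<eta>: "0 < \<eta>"
    and d_in: "\<And>p. p \<in> oct b0 \<Longrightarrow> d p = dep b0 p" and d_out: "\<And>p. p \<notin> oct b0 \<Longrightarrow> 0 \<le> d p"
    and conf_u: "conf N u"
    and minimal: "\<And>v. conf N v \<Longrightarrow>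
      en \<beta> 0 N u + \<eta> * dis N (oct b0) d u + \<delta> * \<bar>nz N u - nz0\<bar>
      \<le> en \<beta> 0 N v + \<eta> * dis N (oct b0) d v + \<delta> * \<bar>nz N v - nz0\<bar>"
begin

abbreviation "D v \<equiv> dis N (oct b0) d v"

text \<open>Each comparison with a competitor linearizes the penalization of the number of zeros, which
  then acts as an additional cost \<open>s\<close> of either sign per zero.\<close>

definition charge :: "real \<Rightarrow> bool" where
  "charge s \<longleftrightarrow> s = \<delta> \<or> s = - \<delta>"

lemma charge_bounds: "charge s \<Longrightarrow> \<bar>s\<bar> \<le> \<beta> / 2" "charge s \<Longrightarrow> \<bar>s\<bar> \<le> (2 - 3 * \<beta>) / 2"
  using \<beta> \<delta> by (auto simp: charge_def)

lemma \<beta>_le: "0 \<le> \<beta>" "\<beta> \<le> 2"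
  using \<beta> \<delta> by auto

text \<open>By the triangle inequality the penalties of \<open>v\<close> and \<open>u\<close> differ
  by at most \<open>\<delta>\<close> times the difference of their numbers of zeros, which is linear
  once its sign is known. The charge therefore depends on the competitor.\<close>

lemma minimal_charge:
  assumes "conf N v"
  obtains s where "charge s" "en \<beta> s N u + \<eta> * D u \<le> en \<beta> s N v + \<eta> * D v"
proof -
  define s where "s = (if nz N u \<le> nz N v then \<delta> else - \<delta>)"
  have "\<delta> * \<bar>nz N v - nz0\<bar> \<le> \<delta> * (\<bar>nz N u - nz0\<bar> + \<bar>nz N v - nz N u\<bar>)"
    using \<delta> by (intro mult_left_mono) auto
  moreover have "\<delta> * \<bar>nz N v - nz N u\<bar> = s * nz N v - s * nz N u"
    by (auto simp: s_def algebra_simps)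
  ultimately have "en \<beta> s N u + \<eta> * D u \<le> en \<beta> s N v + \<eta> * D v"
    using minimal[OF assms] unfolding en_zeros[of \<beta> s] by (simp add: algebra_simps)
  moreover have "charge s" by (simp add: s_def charge_def)
  ultimately show thesis using that by blast
qed

text \<open>Removing a 1 outside \<open>oct b0\<close> can only lower the dissipation, so the loss
  is counted on the part of \<open>R\<close> inside \<open>oct b0\<close>.\<close>

lemma dis_diff:
  assumes v: "conf N v"
    and E: "E = {p. v p = 1 \<and> u p \<noteq> 1}" and R: "R = {p. u p = 1 \<and> v p \<noteq> 1}" and sub: "E \<subseteq> oct b0"
  shows "D v - D u \<le> real_of_int (\<Sum>p\<in>R \<inter> oct b0. dep b0 p) - real_of_int (\<Sum>p\<in>E. dep b0 p)"
proof -
  have EG: "E \<subseteq> grid N" and RG: "R \<subseteq> grid N"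
    using conf_ones_grid[OF v] conf_ones_grid[OF conf_u] by (auto simp: E R)
  have "D v - D u = (\<Sum>p\<in>grid N. (of_bool ((v p = 1) \<noteq> (p \<in> oct b0)) - of_bool ((u p = 1) \<noteq> (p \<in> oct b0))) * d p)"
    unfolding dis_def sum_subtractf[symmetric] by (simp add: left_diff_distrib)
  also have "\<dots> \<le> (\<Sum>p\<in>grid N. (if p \<in> R \<inter> oct b0 then real_of_int (dep b0 p) else 0) - (if p \<in> E then real_of_int (dep b0 p) else 0))"
  proof (rule sum_mono)
    fix p
    show "(of_bool ((v p = 1) \<noteq> (p \<in> oct b0)) - of_bool ((u p = 1) \<noteq> (p \<in> oct b0))) * d p
      \<le> (if p \<in> R \<inter> oct b0 then real_of_int (dep b0 p) else 0) - (if p \<in> E then real_of_int (dep b0 p) else 0)"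
      using sub d_in[of p] d_out[of p] by (cases "p \<in> oct b0"; cases "v p = 1"; cases "u p = 1") (auto simp: E R)
  qed
  also have "\<dots> = (\<Sum>p\<in>grid N \<inter> (R \<inter> oct b0). real_of_int (dep b0 p)) - (\<Sum>p\<in>grid N \<inter> E. real_of_int (dep b0 p))"
    by (simp add: sum_subtractf sum.inter_restrict)
  finally have "D v - D u \<le> (\<Sum>p\<in>grid N \<inter> (R \<inter> oct b0). real_of_int (dep b0 p)) - (\<Sum>p\<in>grid N \<inter> E. real_of_int (dep b0 p))" .
  moreover have "grid N \<inter> (R \<inter> oct b0) = R \<inter> oct b0" "grid N \<inter> E = E" using EG RG by auto
  ultimately show ?thesis by simp
qed

lemma layer_gap_u:
  assumes "i < 8" "tight b" "tight (incr b i)" "conf N (cfg (incr b i))" "charge s"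
    and "\<And>p. cfg b p \<le> w p" "\<And>p. w p \<le> cfg (incr b i) p"
  shows "layer_gap \<beta> s N \<Lambda> b i w {p \<in> layer b i. w p = 1}"
  using layer_step[OF assms(1-4) assms(6,7) \<beta>(1) charge_bounds[OF assms(5)] \<beta>(4)] .

lemma dep_pos: "p \<in> oct b0 \<Longrightarrow> 1 \<le> dep b0 p"
  by (simp add: mem_oct_iff_dep)

text \<open>By submodularity, cutting \<open>u\<close> back to \<open>cfg b\<close> saves at least
  the excess of \<open>join u (cfg b)\<close> over \<open>cfg b\<close>. This join lies within one
  layer of \<open>cfg b\<close>, so the excess is positive, and no 1 inside \<open>oct b0\<close> is
  sacrificed.\<close>

lemma peel:
  assumes i: "i < 8" and t: "tight b" "tight (incr b i)" "conf N (cfg (incr b i))"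
    and le: "\<And>p. u p \<le> cfg (incr b i) p"
    and none: "\<And>p. p \<in> layer b i \<Longrightarrow> u p = 1 \<Longrightarrow> p \<notin> oct b0"
  shows "u p \<le> cfg b p"
proof (rule ccontr)
  assume np: "\<not> u p \<le> cfg b p"
  have cb: "conf N (cfg b)" using conf_cfg_mono[OF t(3)] le_incr by blast
  define v w where "v = meet u (cfg b)" and "w = join u (cfg b)"
  have cv: "conf N v" unfolding v_def by (rule conf_meet[OF conf_u cb])
  obtain s where s: "charge s" "en \<beta> s N u + \<eta> * D u \<le> en \<beta> s N v + \<eta> * D v"
    using minimal_charge[OF cv] by blast
  have w: "cfg b q \<le> w q" "w q \<le> cfg (incr b i) q" for q
    using le cfg_mono[of b "incr b i", OF le_incr] by (auto simp: w_def join_def)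
  have "w p \<noteq> cfg b p" using np by (auto simp: w_def join_def max_def)
  then have "w \<noteq> cfg b" by auto
  then have "en \<beta> s N (cfg b) < en \<beta> s N w"
    using layer_gap_u[OF i t s(1) w] unfolding layer_gap_def by blast
  moreover have "en \<beta> s N w + en \<beta> s N v \<le> en \<beta> s N u + en \<beta> s N (cfg b)"
    unfolding v_def w_def by (rule en_submodular[OF \<beta>_le conf_u cb])
  moreover have "D v \<le> D u"
  proof -
    have uval: "u q \<in> {-1, 0, 1}" for q using conf_u unfolding conf_def by blast
    have vp: "v q = 1 \<longleftrightarrow> u q = 1 \<and> q \<in> oct b" for q
      using uval[of q] by (auto simp: v_def meet_def cfg_def)
    have E: "{p. v p = 1 \<and> u p \<noteq> 1} = {}" unfolding vp by blast
    have R: "{p. u p = 1 \<and> v p \<noteq> 1} \<inter> oct b0 = {}"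
    proof (safe)
      fix x y assume a: "u (x, y) = 1" "v (x, y) \<noteq> 1" "(x, y) \<in> oct b0"
      then have "(x, y) \<notin> oct b" unfolding vp by blast
      moreover have "(x, y) \<in> oct (incr b i)" using le[of "(x, y)"] a(1) by (auto simp: cfg_def split: if_splits)
      ultimately show "(x, y) \<in> {}" using none a by (auto simp: layer_def)
    qed
    show ?thesis using dis_diff[OF cv refl refl] unfolding E R by simp
  qed
  then have "\<eta> * D v \<le> \<eta> * D u" using \<eta> by simp
  ultimately show False using s(2) by linarith
qed

text \<open>By submodularity, completing the layer costs at most the energy of the full layer minus
  that of the part already present. This is nonpositive in the first two cases of
  \<open>prof\<close>; in the third the dissipation gained exceeds it.\<close>

lemma extend:
  assumes i: "i < 8" and t: "tight b" "tight (incr b i)" "conf N (cfg (incr b i))"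
    and le: "\<And>p. cfg b p \<le> u p" and sub: "layer b i \<subseteq> oct b0"
    and A: "A = {p \<in> layer b i. u p = 1}"
    and prof: "odd i \<and> A \<noteq> {} \<or> 0 < \<Lambda> \<and> \<Lambda> \<le> card A \<or> 3 * \<beta> < \<eta> * real_of_int (\<Sum>p\<in>layer b i - A. dep b0 p)"
  shows "cfg (incr b i) p \<le> u p"
proof (rule ccontr)
  assume np: "\<not> cfg (incr b i) p \<le> u p"
  have cb: "conf N (cfg b)" using conf_cfg_mono[OF t(3)] le_incr by blast
  define v w where "v = join u (cfg (incr b i))" and "w = meet u (cfg (incr b i))"
  have cv: "conf N v" unfolding v_def by (rule conf_join[OF conf_u t(3)])
  obtain s where s: "charge s" "en \<beta> s N u + \<eta> * D u \<le> en \<beta> s N v + \<eta> * D v"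
    using minimal_charge[OF cv] by blast
  have w: "cfg b q \<le> w q" "w q \<le> cfg (incr b i) q" for q
    using le cfg_mono[of b "incr b i", OF le_incr] by (auto simp: w_def meet_def)
  have lay: "cfg (incr b i) q = 1" if "q \<in> layer b i" for q
    using that by (auto simp: layer_def cfg_def)
  have uval: "u q \<in> {-1, 0, 1}" for q using conf_u unfolding conf_def by blast
  have wA: "{p \<in> layer b i. w p = 1} = A"
  proof -
    have "w q = 1 \<longleftrightarrow> u q = 1" if "q \<in> layer b i" for q
      using lay[OF that] uval[of q] by (auto simp: w_def meet_def)
    then show ?thesis unfolding A by blast
  qed
  note gap = layer_gap_u[OF i t s(1) w, unfolded wA layer_gap_def]
  have sm: "en \<beta> s N v + en \<beta> s N w \<le> en \<beta> s N u + en \<beta> s N (cfg (incr b i))"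
    unfolding v_def w_def by (rule en_submodular[OF \<beta>_le conf_u t(3)])
  have uoct: "u q = 1" if "q \<in> oct b" for q
    using le[of q] that uval[of q] by (auto simp: cfg_def)
  have E: "{p. v p = 1 \<and> u p \<noteq> 1} = layer b i - A"
  proof -
    have "v q = 1 \<longleftrightarrow> u q = 1 \<or> q \<in> oct (incr b i)" for q
      using uval[of q] by (auto simp: v_def join_def cfg_def)
    then show ?thesis unfolding A layer_def using uoct by blast
  qed
  have R: "{p. u p = 1 \<and> v p \<noteq> 1} = {}"
  proof -
    have "v q = 1" if "u q = 1" for q
      using that cfg_values[of "incr b i" q] by (auto simp: v_def join_def)
    then show ?thesis by blast
  qed
  have dd: "D v - D u \<le> - real_of_int (\<Sum>p\<in>layer b i - A. dep b0 p)"
    using dis_diff[OF cv refl refl] sub unfolding E R by auto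
  have pos: "0 \<le> (\<Sum>p\<in>layer b i - A. dep b0 p)"
    using sub dep_pos by (intro sum_nonneg) force
  have w_ne: "w \<noteq> cfg (incr b i)"
  proof -
    have "w p \<noteq> cfg (incr b i) p" using np by (auto simp: w_def meet_def min_def)
    then show ?thesis by auto
  qed
  have \<eta>D: "\<eta> * D v \<le> \<eta> * D u - \<eta> * real_of_int (\<Sum>p\<in>layer b i - A. dep b0 p)"
    using mult_left_mono[OF dd, of \<eta>] \<eta> by (simp add: algebra_simps)
  consider "odd i \<and> A \<noteq> {} \<or> 0 < \<Lambda> \<and> \<Lambda> \<le> card A" | "3 * \<beta> < \<eta> * real_of_int (\<Sum>p\<in>layer b i - A. dep b0 p)"
    using prof by blast
  then show False
  proof cases
    case 1
    then have A1: "A \<noteq> {}" "odd i \<or> \<Lambda> \<le> card A" by auto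
    then have e1: "en \<beta> s N (cfg (incr b i)) \<le> en \<beta> s N w" using gap by blast
    show False
    \<comment> \<open>The energies may be equal, so strictness has two sources: if all 1s are
      present, then a zero is missing and the energy drops; otherwise a missing 1 has depth at least
      1.\<close>
    proof (cases "A = layer b i")
      case True
      then have "en \<beta> s N (cfg (incr b i)) < en \<beta> s N w" using gap A1 w_ne by blast
      moreover have "\<eta> * D v \<le> \<eta> * D u" using \<eta>D True by simp
      ultimately show False using sm s(2) by linarith
    next
      case False
      then obtain q where q: "q \<in> layer b i - A" using A by blast
      then have "1 \<le> dep b0 q" using sub dep_pos by blast
      also have "\<dots> \<le> (\<Sum>p\<in>layer b i - A. dep b0 p)"
        using q sub dep_pos finite_layer by (intro member_le_sum) force+
      finally have "0 < real_of_int (\<Sum>p\<in>layer b i - A. dep b0 p)" by linarith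
      then have "0 < \<eta> * real_of_int (\<Sum>p\<in>layer b i - A. dep b0 p)" using \<eta> by (rule mult_pos_pos[rotated])
      then show False using e1 sm s(2) \<eta>D by linarith
    qed
  next
    case 2
    have "en \<beta> s N (cfg b) \<le> en \<beta> s N w" using gap by fastforce
    \<comment> \<open>A full layer costs \<open>2 * \<beta>\<close>, plus a charge of at most
      \<open>\<beta> / 2\<close> for the additional zero of a diagonal one.\<close>
    moreover have "en \<beta> s N (cfg (incr b i)) \<le> en \<beta> s N (cfg b) + 3 * \<beta>"
      using gap charge_bounds(1)[OF s(1)] \<beta>(1) by auto
    ultimately show False using sm s(2) \<eta>D 2 by linarith
  qed
qed

text \<open>Even an incomplete outermost layer costs \<open>\<beta>\<close> of energy; minimality
  forces the dissipation that it saves to pay for this.\<close>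

lemma remove_top_layer:
  assumes i: "i < 8" and t: "tight g" "tight (incr g i)" "conf N (cfg (incr g i))"
    and le: "\<And>p. u p \<le> cfg (incr g i) p"
    and A: "A = {p \<in> layer g i. u p = 1}" "A \<noteq> {}" and sub: "layer g i \<subseteq> oct b0"
  shows "\<beta> \<le> \<eta> * real_of_int (\<Sum>p\<in>A. dep b0 p)"
proof -
  have cb: "conf N (cfg g)" using conf_cfg_mono[OF t(3)] le_incr by blast
  define v w where "v = meet u (cfg g)" and "w = join u (cfg g)"
  have cv: "conf N v" unfolding v_def by (rule conf_meet[OF conf_u cb])
  obtain s where s: "charge s" "en \<beta> s N u + \<eta> * D u \<le> en \<beta> s N v + \<eta> * D v"
    using minimal_charge[OF cv] by blast
  have w: "cfg g q \<le> w q" "w q \<le> cfg (incr g i) q" for q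
    using le cfg_mono[of g "incr g i", OF le_incr] by (auto simp: w_def join_def)
  have wA: "{p \<in> layer g i. w p = 1} = A"
    unfolding A w_def join_def layer_def by (auto simp: cfg_def max_def split: if_splits)
  have "en \<beta> s N (cfg g) + \<beta> \<le> en \<beta> s N w"
    using layer_gap_u[OF i t s(1) w] A(2) unfolding wA layer_gap_def by blast
  moreover have "en \<beta> s N w + en \<beta> s N v \<le> en \<beta> s N u + en \<beta> s N (cfg g)"
    unfolding v_def w_def by (rule en_submodular[OF \<beta>_le conf_u cb])
  moreover have "D v - D u \<le> real_of_int (\<Sum>p\<in>A. dep b0 p)"
  proof -
    have uval: "u q \<in> {-1, 0, 1}" for q using conf_u unfolding conf_def by blast
    have vp: "v q = 1 \<longleftrightarrow> u q = 1 \<and> q \<in> oct g" for q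
      using uval[of q] by (auto simp: v_def meet_def cfg_def)
    have e: "{p. v p = 1 \<and> u p \<noteq> 1} = {}" unfolding vp by blast
    have "p \<in> oct (incr g i)" if "u p = 1" for p
      using le[of p] that by (auto simp: cfg_def split: if_splits)
    then have "{p. u p = 1 \<and> v p \<noteq> 1} = A"
      unfolding A vp layer_def by blast
    moreover have "A \<inter> oct b0 = A" using sub A by auto
    ultimately show ?thesis using dis_diff[OF cv refl refl] e by simp
  qed
  then have "\<eta> * D v - \<eta> * D u \<le> \<eta> * real_of_int (\<Sum>p\<in>A. dep b0 p)"
    using \<eta> by (simp add: right_diff_distrib[symmetric])
  ultimately show ?thesis using s(2) by linarith
qed

text \<open>Removing an outermost layer of the hull and adding a layer to an inner octagon changes
  neither the energy nor the number of zeros, so only the dissipations are compared.\<close>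

lemma swap_layers:
  assumes i: "i < 8" and t: "tight b" "tight (incr b i)" "tight g" "tight (incr g i)" "conf N (cfg (incr g i))"
    and le: "\<And>p. cfg b p \<le> u p" "\<And>p. u p \<le> cfg (incr g i) p" and bg: "\<And>j. j < 8 \<Longrightarrow> b j \<le> g j"
    and A: "A = {p \<in> layer g i. u p = 1}" "A \<noteq> {}" "odd i \<or> \<Lambda> \<le> card A" and sub: "oct (incr g i) \<subseteq> oct b0"
  shows "(\<Sum>p\<in>layer b i - {p. u p = 1}. dep b0 p) \<le> (\<Sum>p\<in>A - layer b i. dep b0 p)"
proof -
  have cg: "conf N (cfg g)" using conf_cfg_mono[OF t(5)] le_incr by blast
  have bg': "incr b i j \<le> incr g i j" if "j < 8" for j using bg[OF that] by (cases "j = i") auto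
  have cb: "conf N (cfg (incr b i))" using conf_cfg_mono[OF t(5)] bg' by blast
  define v where "v = meet u (cfg g)"
  define v' where "v' = join v (cfg (incr b i))"
  define w where "w = join u (cfg g)"
  define w' where "w' = meet v (cfg (incr b i))"
  have cv: "conf N v" unfolding v_def by (rule conf_meet[OF conf_u cg])
  have cv': "conf N v'" unfolding v'_def by (rule conf_join[OF cv cb])
  obtain s where s: "charge s" "en \<beta> s N u + \<eta> * D u \<le> en \<beta> s N v' + \<eta> * D v'"
    using minimal_charge[OF cv'] by blast
  have w: "cfg g q \<le> w q" "w q \<le> cfg (incr g i) q" for q
    using le(2) cfg_mono[of g "incr g i", OF le_incr] by (auto simp: w_def join_def)
  have wA: "{p \<in> layer g i. w p = 1} = A"
    unfolding A w_def join_def layer_def by (auto simp: cfg_def max_def split: if_splits)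
  have g1: "en \<beta> s N (cfg (incr g i)) \<le> en \<beta> s N w" "en \<beta> s N (cfg (incr g i)) = en \<beta> s N (cfg g) + 2 * \<beta> + (if odd i then s else 0)"
    using layer_gap_u[OF i t(3-5) s(1) w] A(2,3) unfolding wA layer_gap_def by blast+
  have w': "cfg b q \<le> w' q" "w' q \<le> cfg (incr b i) q" for q
    using le(1) cfg_mono[of b "incr b i", OF le_incr] cfg_mono[of b g, OF bg]
    by (auto simp: w'_def v_def meet_def)
  have g2: "en \<beta> s N (cfg b) \<le> en \<beta> s N w'" "en \<beta> s N (cfg (incr b i)) = en \<beta> s N (cfg b) + 2 * \<beta> + (if odd i then s else 0)"
    using layer_gap_u[OF i t(1,2) cb s(1) w'] unfolding layer_gap_def by fastforce+
  have "en \<beta> s N w + en \<beta> s N v \<le> en \<beta> s N u + en \<beta> s N (cfg g)"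
    unfolding v_def w_def by (rule en_submodular[OF \<beta>_le conf_u cg])
  moreover have "en \<beta> s N v' + en \<beta> s N w' \<le> en \<beta> s N v + en \<beta> s N (cfg (incr b i))"
    unfolding v'_def w'_def by (rule en_submodular[OF \<beta>_le cv cb])
  \<comment> \<open>Two complete layers with the same index have the same cost, including the
    charge, so all energies cancel.\<close>
  ultimately have "\<eta> * D u \<le> \<eta> * D v'" using g1 g2 s(2) by linarith
  then have "D u \<le> D v'" using \<eta> by simp
  moreover have "D v' - D u \<le> real_of_int (\<Sum>p\<in>A - layer b i. dep b0 p) - real_of_int (\<Sum>p\<in>layer b i - {p. u p = 1}. dep b0 p)"
  proof -
    have uval: "u q \<in> {-1, 0, 1}" for q using conf_u unfolding conf_def by blast
    have ub: "u q = 1" if "q \<in> oct b" for q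
      using le(1)[of q] that uval[of q] by (auto simp: cfg_def)
    have og: "oct b \<subseteq> oct g" "oct (incr b i) \<subseteq> oct (incr g i)" using oct_mono bg bg' by blast+
    have vp: "v' q = 1 \<longleftrightarrow> u q = 1 \<and> q \<in> oct g \<or> q \<in> oct (incr b i)" for q
      using uval[of q] by (auto simp: v'_def v_def join_def meet_def cfg_def max_def min_def split: if_splits)
    have uh: "q \<in> oct (incr g i)" if "u q = 1" for q
      using le(2)[of q] that by (auto simp: cfg_def split: if_splits)
    have E: "{p. v' p = 1 \<and> u p \<noteq> 1} = layer b i - {p. u p = 1}"
      unfolding vp layer_def using ub by auto
    have R: "{p. u p = 1 \<and> v' p \<noteq> 1} = A - layer b i"
      unfolding vp layer_def A using uh og by (auto simp: layer_def)
    have R': "{p. u p = 1 \<and> v' p \<noteq> 1} \<inter> oct b0 = A - layer b i"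
      unfolding R using sub A by (auto simp: layer_def)
    have "layer b i - {p. u p = 1} \<subseteq> oct b0" using og sub by (auto simp: layer_def)
    then show ?thesis using dis_diff[OF cv' refl refl] unfolding E R' by blast
  qed
  ultimately show ?thesis by linarith
qed

end

section \<open>Estimates for heights, squares and centres\<close>

lemma side_ge:
  assumes "i < 8" "\<And>j. j < 8 \<Longrightarrow> b j \<le> c j" "c i \<le> m"
  shows "b ((i + 7) mod 8) + b ((i + 1) mod 8) - (if even i then 2 else 1) * m \<le> side c i"
  using assms(2)[of "(i + 7) mod 8"] assms(2)[of "(i + 1) mod 8"] assms(3) by (auto simp: side_def)

lemma sum_diff_zero:
  fixes b c :: "nat \<Rightarrow> int"
  assumes "\<And>i. i < 8 \<Longrightarrow> b i \<le> c i" "\<not> (\<exists>i<8. b i < c i)" "i < 8"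
  shows "b i = c i"
  using assms by (meson antisym_conv1 order_le_less)

text \<open>Provides the termination measure for moving between two octagons one height at a
  time.\<close>

lemma sum_incr_less:
  fixes b c :: "nat \<Rightarrow> int"
  assumes le: "\<And>j. j < 8 \<Longrightarrow> b j \<le> c j" "\<And>j. j < 8 \<Longrightarrow> b' j \<le> c' j"
    and ge: "\<And>j. j < 8 \<Longrightarrow> c' j - b' j \<le> c j - b j" and i: "i < 8" "c' i - b' i < c i - b i"
  shows "nat (\<Sum>j<8. c' j - b' j) < nat (\<Sum>j<8. c j - b j)"
proof -
  have "(\<Sum>j<8. c' j - b' j) < (\<Sum>j<8. c j - b j)"
    by (rule sum_strict_mono_ex1) (use ge i in auto)
  moreover have "0 \<le> (\<Sum>j<8. c' j - b' j)" using le(2) by (intro sum_nonneg) force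
  ultimately show ?thesis by simp
qed

text \<open>In \<open>cfg b\<close> no 1 is adjacent to a -1, so each bond with positive cost ends
  at a zero, and a zero has four bonds.\<close>

lemma en_cfg_le:
  assumes "0 \<le> \<beta>" "finite {p. cfg b p = 0}"
  shows "en \<beta> s N (cfg b) \<le> (4 * \<beta> + \<bar>s\<bar>) * card {p. cfg b p = 0}"
proof -
  let ?Z = "{p. cfg b p = 0}"
  have bond: "bond_cost \<beta> (cfg b p) (cfg b (p + e)) \<le> \<beta> * of_bool (p \<in> ?Z) + \<beta> * of_bool (p + e \<in> ?Z)"
    if "e = (1, 0) \<or> e = (0, 1)" for p e
  proof -
    have "p \<in> oct b \<Longrightarrow> p + e \<in> oct (\<lambda>i. b i + 1)" "p + e \<in> oct b \<Longrightarrow> p \<in> oct (\<lambda>i. b i + 1)"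
      using that by (cases p; auto simp: oct_iff)+
    then show ?thesis using assms(1) by (auto simp: bond_cost_def cfg_def)
  qed
  have shift: "(\<Sum>p\<in>grid N. of_bool (p + e \<in> ?Z)) \<le> real (card ?Z)" for e
  proof -
    have "(\<Sum>p\<in>grid N. of_bool (p + e \<in> ?Z)) = real (card (grid N \<inter> {p. p + e \<in> ?Z}))"
      by simp
    also have "card (grid N \<inter> {p. p + e \<in> ?Z}) \<le> card ?Z"
      by (rule card_inj_on_le[of "\<lambda>p. p + e"]) (use assms(2) in \<open>auto simp: inj_on_def\<close>)
    finally show ?thesis by simp
  qed
  have "site_en \<beta> s (cfg b) p \<le> (2 * \<beta> + \<bar>s\<bar>) * of_bool (p + (0, 0) \<in> ?Z)
      + \<beta> * of_bool (p + (1, 0) \<in> ?Z) + \<beta> * of_bool (p + (0, 1) \<in> ?Z)" for p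
  proof -
    have "s * of_bool (cfg b p = 0) \<le> \<bar>s\<bar> * of_bool (p \<in> ?Z)" by auto
    moreover have "p + (0, 0) = p" by (cases p) simp
    ultimately show ?thesis
      using bond[of "(1, 0)" p] bond[of "(0, 1)" p] unfolding site_en_def by (auto simp: algebra_simps)
  qed
  then have "en \<beta> s N (cfg b) \<le> (\<Sum>p\<in>grid N. (2 * \<beta> + \<bar>s\<bar>) * of_bool (p + (0, 0) \<in> ?Z)
      + \<beta> * of_bool (p + (1, 0) \<in> ?Z) + \<beta> * of_bool (p + (0, 1) \<in> ?Z))"
    unfolding en_def by (rule sum_mono)
  also have "\<dots> = (2 * \<beta> + \<bar>s\<bar>) * (\<Sum>p\<in>grid N. of_bool (p + (0, 0) \<in> ?Z))
      + \<beta> * (\<Sum>p\<in>grid N. of_bool (p + (1, 0) \<in> ?Z)) + \<beta> * (\<Sum>p\<in>grid N. of_bool (p + (0, 1) \<in> ?Z))"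
    unfolding sum.distrib sum_distrib_left ..
  also have "\<dots> \<le> (2 * \<beta> + \<bar>s\<bar>) * card ?Z + \<beta> * card ?Z + \<beta> * card ?Z"
    using assms(1) by (intro add_mono mult_left_mono shift) auto
  finally show ?thesis by (simp add: algebra_simps)
qed

text \<open>Support heights, in the order of \<open>phi\<close>, of the \<open>n\<close> by
  \<open>n\<close> square with lower left cell \<open>(a, c)\<close>, an octagon whose diagonal
  sides have length zero.\<close>

definition square :: "int \<Rightarrow> int \<Rightarrow> int \<Rightarrow> nat \<Rightarrow> int" where
  "square a c n i = [a + n - 1, a + c + 2 * (n - 1), c + n - 1, c + n - 1 - a, - a, - a - c, - c, a + n - 1 - c] ! i"

lemma square_simps:
  "square a c n 0 = a + n - 1" "square a c n 1 = a + c + 2 * (n - 1)" "square a c n 2 = c + n - 1"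
  "square a c n 3 = c + n - 1 - a" "square a c n 4 = - a" "square a c n 5 = - a - c"
  "square a c n 6 = - c" "square a c n 7 = a + n - 1 - c"
  by (simp_all add: square_def)

lemma oct_square: "oct (square a c n) = {a..<a + n} \<times> {c..<c + n}"
  by (auto simp: oct_iff square_simps)

lemma card_zeros_square:
  assumes "0 \<le> n"
  shows "finite {p. cfg (square a c n) p = 0}" "card {p. cfg (square a c n) p = 0} \<le> 4 * nat n"
proof -
  let ?S = "({a - 1} \<times> {c..<c + n} \<union> {a + n} \<times> {c..<c + n}) \<union> ({a..<a + n} \<times> {c - 1} \<union> {a..<a + n} \<times> {c + n})"
  have sub: "{p. cfg (square a c n) p = 0} \<subseteq> ?S"
    by (auto simp: cfg_def oct_iff square_simps split: if_splits)
  have fin: "finite ?S" by simp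
  show "finite {p. cfg (square a c n) p = 0}" using sub fin by (rule finite_subset)
  have "card {p. cfg (square a c n) p = 0} \<le> card ?S" using fin sub by (rule card_mono)
  also have "\<dots> \<le> (card ({a - 1} \<times> {c..<c + n}) + card ({a + n} \<times> {c..<c + n}))
      + (card ({a..<a + n} \<times> {c - 1}) + card ({a..<a + n} \<times> {c + n}))"
    by (meson card_Un_le add_mono order_trans)
  also have "\<dots> = 4 * nat n" by (simp add: card_cartesian_product)
  finally show "card {p. cfg (square a c n) p = 0} \<le> 4 * nat n" .
qed

text \<open>The centre of the bounding box serves as \<open>z\<close>; the loss of 2 leaves room for
  rounding its coordinates.\<close>

lemma octagon_centre:
  assumes "\<And>i. i < 8 \<Longrightarrow> M \<le> side X i" "0 \<le> M"
  shows "\<exists>z. \<forall>i<8. phi i z + (M - 2) \<le> X i"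
proof -
  have "\<forall>i<8. M \<le> side X i" using assms by blast
  note S = this[unfolded all_less_8 side_simps]
  define x y where "x = (X 0 - X 4) div 2" and "y = (X 2 - X 6) div 2"
  have d: "2 * x \<le> X 0 - X 4" "X 0 - X 4 \<le> 2 * x + 1" "2 * y \<le> X 2 - X 6" "X 2 - X 6 \<le> 2 * y + 1"
    unfolding x_def y_def by presburger+
  have "\<forall>i<8. phi i (x, y) + (M - 2) \<le> X i"
    unfolding all_less_8 using S d assms(2) by (simp add: phi_def)
  then show ?thesis by blast
qed

section \<open>Growing from inside and peeling from outside\<close>

context minimizing
begin

lemma \<Lambda>_pos: "0 < \<Lambda>"
  using \<beta> by (intro gr0I) auto

text \<open>The assumption \<open>len\<close> bounds the sides of every octagon between
  \<open>b\<close> and \<open>b'\<close>, so heights may be raised in any order. Each layer met on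
  the way has at least \<open>q + 1\<close> cells of depth at least \<open>m\<close>: either
  \<open>\<Lambda>\<close> of them are 1 already, or the others yield more than
  \<open>3 * \<beta>\<close>.\<close>

lemma grow:
  fixes b b' :: "nat \<Rightarrow> int"
  assumes conf0: "conf N (cfg b0)" and b'0: "\<And>i. i < 8 \<Longrightarrow> b' i \<le> b0 i"
    and m: "\<And>p. p \<in> oct b' \<Longrightarrow> m \<le> dep b0 p" "0 \<le> m" and q: "0 \<le> q"
    and prof: "3 * \<beta> < \<eta> * real_of_int (m * (q + 1 - int \<Lambda>))"
    and le: "\<And>i. i < 8 \<Longrightarrow> b i \<le> b' i"
    and len: "\<And>i. i < 8 \<Longrightarrow> q \<le> b ((i + 7) mod 8) + b ((i + 1) mod 8) - (if even i then 2 else 1) * b' i"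
    and start: "\<And>p. cfg b p \<le> u p"
  shows "cfg b' p \<le> u p"
  using le len start
proof (induction "nat (\<Sum>j<8. b' j - b j)" arbitrary: b rule: less_induct)
  case less
  show ?case
  proof (cases "\<exists>i<8. b i < b' i")
    case False
    then have "b i = b' i" if "i < 8" for i
      using sum_diff_zero[of b b' i] less.prems(1) that by blast
    then have "cfg b' = cfg b" using cfg_cong by metis
    then show ?thesis using less.prems(3) by simp
  next
    case True
    then obtain i where i: "i < 8" "b i < b' i" by blast
    have le': "incr b i j \<le> b' j" if "j < 8" for j
      using less.prems(1)[OF that] i by (cases "j = i") auto
    have sb: "q \<le> side b j" if "j < 8" for j
      using side_ge[OF that, of b b "b' j"] less.prems(1,2)[OF that] by force
    have sb': "q \<le> side (incr b i) j" if "j < 8" for j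
      using side_ge[OF that, of b "incr b i" "b' j"] less.prems(2)[OF that] le'[OF that] le_incr by force
    have t: "tight b" "tight (incr b i)"
      unfolding tight_def using sb sb' q by force+
    have c: "conf N (cfg (incr b i))"
      using conf_cfg_mono[OF conf0] le' b'0 by (meson order_trans)
    have card: "q + 1 \<le> int (card (layer b i))"
    proof -
      \<comment> \<open>The bound \<open>len\<close> uses the final height \<open>b' i\<close>; the
        present height is smaller, so the side is longer by the weight of one step.\<close>
      have "q + (if even i then 2 else 1) \<le> side b i"
        using side_ge[OF i(1), of b b "b' i - 1"] less.prems(2)[OF i(1)] i(2) by (auto split: if_splits)
      then show ?thesis unfolding card_layer[OF i(1) t] by (auto split: if_splits)
    qed
    have lb: "layer b i \<subseteq> oct b'" using oct_mono[of "incr b i" b'] le' by (auto simp: layer_def)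
    have lb0: "layer b i \<subseteq> oct b0" using lb oct_mono[of b' b0] b'0 by auto
    define A where "A = {p \<in> layer b i. u p = 1}"
    have "\<Lambda> \<le> card A \<or> 3 * \<beta> < \<eta> * real_of_int (\<Sum>p\<in>layer b i - A. dep b0 p)"
    proof (cases "\<Lambda> \<le> card A")
      case False
      have "m * (q + 1 - int \<Lambda>) \<le> m * int (card (layer b i - A))"
      proof (rule mult_left_mono[OF _ m(2)])
        have "card (layer b i - A) = card (layer b i) - card A"
          by (rule card_Diff_subset) (auto simp: A_def finite_layer)
        then show "q + 1 - int \<Lambda> \<le> int (card (layer b i - A))" using card False by linarith
      qed
      also have "\<dots> = (\<Sum>p\<in>layer b i - A. m)" by simp
      also have "\<dots> \<le> (\<Sum>p\<in>layer b i - A. dep b0 p)"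
        using m(1) lb by (intro sum_mono) blast
      finally have "real_of_int (m * (q + 1 - int \<Lambda>)) \<le> real_of_int (\<Sum>p\<in>layer b i - A. dep b0 p)"
        by (simp only: of_int_le_iff)
      then have "\<eta> * real_of_int (m * (q + 1 - int \<Lambda>)) \<le> \<eta> * real_of_int (\<Sum>p\<in>layer b i - A. dep b0 p)"
        using \<eta> by (intro mult_left_mono) simp_all
      then show ?thesis using prof by linarith
    qed simp
    then have ext: "cfg (incr b i) p \<le> u p" for p
      using extend[OF i(1) t c less.prems(3) lb0 A_def] \<Lambda>_pos by blast
    have "nat (\<Sum>j<8. b' j - incr b i j) < nat (\<Sum>j<8. b' j - b j)"
      by (rule sum_incr_less[where i = i]) (use less.prems(1) le' i le_incr in auto)
    then show ?thesis
    proof (rule less.hyps)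
      fix j :: nat assume j: "j < 8"
      show "incr b i j \<le> b' j" by (rule le'[OF j])
      have "(j + 7) mod 8 < 8" "(j + 1) mod 8 < 8" by simp_all
      then show "q \<le> incr b i ((j + 7) mod 8) + incr b i ((j + 1) mod 8) - (if even j then 2 else 1) * b' j"
        using less.prems(2)[OF j] le_incr[of b "(j + 7) mod 8" i] le_incr[of b "(j + 1) mod 8" i] by linarith
    qed (rule ext)
  qed
qed

text \<open>Every intermediate octagon is tight, so heights may be lowered in any order; the 1s
  inside \<open>oct b0\<close> lie in \<open>oct c\<close> and are never cut off.\<close>

lemma peel_path:
  fixes c c' :: "nat \<Rightarrow> int"
  assumes ones: "\<And>p. u p = 1 \<Longrightarrow> p \<in> oct b0 \<Longrightarrow> p \<in> oct c"
    and le: "\<And>i. i < 8 \<Longrightarrow> c i \<le> c' i"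
    and tight: "\<And>e. (\<And>i. i < 8 \<Longrightarrow> c i \<le> e i \<and> e i \<le> c' i) \<Longrightarrow> tight e"
    and conf: "conf N (cfg c')" and start: "\<And>p. u p \<le> cfg c' p"
  shows "u p \<le> cfg c p"
  using le tight conf start
proof (induction "nat (\<Sum>j<8. c' j - c j)" arbitrary: c' rule: less_induct)
  case less
  show ?case
  proof (cases "\<exists>i<8. c i < c' i")
    case False
    then have "c i = c' i" if "i < 8" for i
      using sum_diff_zero[of c c' i] less.prems(1) that by blast
    then have "cfg c' = cfg c" using cfg_cong by metis
    then show ?thesis using less.prems(4) by simp
  next
    case True
    then obtain i where i: "i < 8" "c i < c' i" by blast
    define e where "e = c'(i := c' i - 1)"
    have ei: "incr e i = c'" by (auto simp: e_def incr_def)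
    have le': "c j \<le> e j \<and> e j \<le> c' j" if "j < 8" for j
      using less.prems(1)[OF that] i by (auto simp: e_def)
    have t: "tight e" "tight (incr e i)"
      using less.prems(2) le' less.prems(1) unfolding ei by blast+
    have sub: "oct c \<subseteq> oct e" using oct_mono le' by blast
    have u: "u p \<le> cfg e p" for p
    proof (rule peel[OF i(1) t])
      show "conf N (cfg (incr e i))" "u p \<le> cfg (incr e i) p" for p
        unfolding ei using less.prems by blast+
      show "p \<notin> oct b0" if "p \<in> layer e i" "u p = 1" for p
        using ones[OF that(2)] that(1) sub by (auto simp: layer_def)
    qed
    have "nat (\<Sum>j<8. e j - c j) < nat (\<Sum>j<8. c' j - c j)"
      by (rule sum_incr_less[where i = i]) (use less.prems(1) le' i in \<open>auto simp: e_def\<close>)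
    then show ?thesis
    proof (rule less.hyps)
      show "c j \<le> e j" if "j < 8" for j using le'[OF that] by blast
      show "tight f" if "\<And>i. i < 8 \<Longrightarrow> c i \<le> f i \<and> f i \<le> e i" for f
        using less.prems(2) that le' by (meson order_trans)
      show "conf N (cfg e)" using conf_cfg_mono[OF less.prems(3)] le' by blast
    qed (rule u)
  qed
qed

text \<open>Each round lowers all heights by one, the diagonal ones first. Lowering both flat
  neighbours of a diagonal side of \<open>b0\<close> of length 0 first would make that side negative
  in the last round. Two lowered diagonals in turn shorten a flat side by 2, hence the assumption on
  flat sides.\<close>

lemma inside_initial:
  assumes t: "tight b0" and s: "\<And>i. i < 8 \<Longrightarrow> even i \<Longrightarrow> 2 \<le> side b0 i"
  shows "conf N (cfg (\<lambda>i. b0 i + int M)) \<Longrightarrow> (\<And>p. u p \<le> cfg (\<lambda>i. b0 i + int M) p) \<Longrightarrow> u p \<le> cfg b0 p"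
proof (induction M)
  case 0
  then show ?case by simp
next
  case (Suc M)
  let ?m = "int M"
  have S: "\<forall>i<8. (if even i then 2 else 0) \<le> side b0 i"
    using s t by (auto simp: tight_def)
  define c where "c i = b0 i + ?m + (if even i then 1 else 0)" for i
  have ones: "p \<in> oct e" if "p \<in> oct b0" "\<And>i. i < 8 \<Longrightarrow> b0 i \<le> e i" for p e
    using that oct_mono by blast
  have 1: "u p \<le> cfg c p" for p
  proof (rule peel_path)
    show "p \<in> oct c" if "p \<in> oct b0" for p by (rule ones[OF that]) (simp add: c_def)
    show "c i \<le> b0 i + int (Suc M)" for i by (simp add: c_def)
    show "conf N (cfg (\<lambda>i. b0 i + int (Suc M)))" "u p \<le> cfg (\<lambda>i. b0 i + int (Suc M)) p" for p
      using Suc.prems by blast+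
    fix e assume "\<And>i. i < 8 \<Longrightarrow> c i \<le> e i \<and> e i \<le> b0 i + int (Suc M)"
    then have "\<forall>i<8. c i \<le> e i \<and> e i \<le> b0 i + int (Suc M)" by blast
    then show "tight e"
      using S unfolding tight_iff all_less_8 side_simps by (simp add: c_def)
  qed
  have 2: "u p \<le> cfg (\<lambda>i. b0 i + int M) p" for p
  proof (rule peel_path[OF _ _ _ _ 1])
    show "p \<in> oct (\<lambda>i. b0 i + int M)" if "p \<in> oct b0" for p by (rule ones[OF that]) simp
    show "b0 i + int M \<le> c i" for i by (simp add: c_def)
    show "conf N (cfg c)"
      by (rule conf_cfg_mono[OF Suc.prems(1)]) (simp add: c_def)
    fix e assume "\<And>i. i < 8 \<Longrightarrow> b0 i + int M \<le> e i \<and> e i \<le> c i"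
    then have "\<forall>i<8. b0 i + int M \<le> e i \<and> e i \<le> c i" by blast
    then show "tight e"
      using S unfolding tight_iff all_less_8 side_simps by (simp add: c_def)
  qed
  show ?case
    by (rule Suc.IH[OF _ 2]) (rule conf_cfg_mono[OF Suc.prems(1)], simp)
qed

text \<open>Moving all heights in proportion keeps each side close to a convex combination of its
  initial and its final length. Rounding loses less than 2, which leaves \<open>q + 2\<close>, and
  raising the height of a flat side by one takes another 2; this accounts for
  \<open>q + 3\<close>.\<close>

lemma linear_path:
  fixes b X :: "nat \<Rightarrow> int"
  assumes conf0: "conf N (cfg b0)" and X0: "\<And>i. i < 8 \<Longrightarrow> X i \<le> b0 i"
    and m: "\<And>p. p \<in> oct X \<Longrightarrow> m \<le> dep b0 p" "0 \<le> m" and q: "0 \<le> q"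
    and prof: "3 * \<beta> < \<eta> * real_of_int (m * (q + 1 - int \<Lambda>))"
    and le: "\<And>i. i < 8 \<Longrightarrow> b i \<le> X i"
    and len: "\<And>i. i < 8 \<Longrightarrow> q + 3 \<le> side b i" "\<And>i. i < 8 \<Longrightarrow> q + 3 \<le> side X i"
    and start: "\<And>p. cfg b p \<le> u p"
  shows "cfg X p \<le> u p"
proof -
  \<comment> \<open>At least as large as each height difference, so that one step raises every
    height by at most one, and positive, so that it may serve as a divisor.\<close>
  define M where "M = (\<Sum>i<8. X i - b i) + 1"
  have dM: "0 \<le> X i - b i \<and> X i - b i \<le> M" if "i < 8" for i
  proof -
    have "X i - b i \<le> (\<Sum>i<8. X i - b i)" using that le by (intro member_le_sum) auto
    then show ?thesis using le[OF that] by (simp add: M_def)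
  qed
  have M: "0 < M" using le by (auto simp: M_def intro!: add_nonneg_pos sum_nonneg)
  define c where "c j i = b i + (int j * (X i - b i)) div M" for j i
  have c_le: "c j i \<le> X i" if "i < 8" "int j \<le> M" for i j
  proof -
    have "int j * (X i - b i) \<le> M * (X i - b i)" using that dM by (intro mult_right_mono) auto
    then have "(int j * (X i - b i)) div M \<le> (M * (X i - b i)) div M" using M by (intro zdiv_mono1) auto
    then show ?thesis using M by (simp add: c_def)
  qed
  have step: "c j i \<le> c (Suc j) i" "c (Suc j) i \<le> c j i + 1" if "i < 8" for i j
  proof -
    have e: "int (Suc j) * (X i - b i) = int j * (X i - b i) + (X i - b i)" by (simp add: algebra_simps)
    show "c j i \<le> c (Suc j) i"
      unfolding c_def e using dM[OF that] M by (intro add_left_mono zdiv_mono1) auto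
    have "(int j * (X i - b i) + (X i - b i)) div M \<le> (int j * (X i - b i) + 1 * M) div M"
      using dM[OF that] M by (intro zdiv_mono1) auto
    then show "c (Suc j) i \<le> c j i + 1"
      unfolding c_def e using M by (simp add: div_add_self2)
  qed
  have side_c: "q + 2 \<le> side (c j) i" if "i < 8" "int j \<le> M" for i j
  proof -
    let ?l = "(i + 7) mod 8" and ?r = "(i + 1) mod 8" and ?w = "if even i then 2 else 1 :: int"
    define f where "f k = int j * (X k - b k)" for k
    \<comment> \<open>Only the floors at the two neighbours lose, each at most \<open>M - 1\<close>
      after multiplication by \<open>M\<close>; the floor at side \<open>i\<close> enters with a
      minus sign and helps.\<close>
    have fl: "f k - (M - 1) \<le> M * (f k div M)" "M * (f k div M) \<le> f k" for k
    proof -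
      have "f k = M * (f k div M) + f k mod M" by simp
      then show "f k - (M - 1) \<le> M * (f k div M)" "M * (f k div M) \<le> f k"
        using pos_mod_bound[OF M, of "f k"] pos_mod_sign[OF M, of "f k"] by linarith+
    qed
    have "M * side (c j) i = M * side b i + M * (f ?l div M) + M * (f ?r div M) - ?w * (M * (f i div M))"
      by (simp add: side_def c_def f_def algebra_simps)
    moreover have "?w * (M * (f i div M)) \<le> ?w * f i" using fl(2)[of i] by simp
    moreover have "M * side b i + f ?l + f ?r - ?w * f i = (M - int j) * side b i + int j * side X i"
      by (simp add: side_def f_def algebra_simps)
    moreover have "(M - int j) * (q + 3) + int j * (q + 3) \<le> (M - int j) * side b i + int j * side X i"
      using len[OF that(1)] that(2) by (intro add_mono mult_left_mono) auto
    moreover have "(M - int j) * (q + 3) + int j * (q + 3) = M * (q + 1) + 2 * M"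
      by (simp add: algebra_simps)
    ultimately have "M * (q + 1) < M * side (c j) i" using fl(1)[of ?l] fl(1)[of ?r] by linarith
    then show ?thesis using M by (simp add: mult_less_cancel_left_pos)
  qed
  have "\<forall>p. cfg (c j) p \<le> u p" if "int j \<le> M" for j
    using that
  proof (induction j)
    case 0
    have "c 0 = b" by (simp add: c_def fun_eq_iff)
    then show ?case using start by simp
  next
    case (Suc j)
    have "cfg (c (Suc j)) p \<le> u p" for p
    proof (rule grow[OF conf0 _ _ m(2) q prof, of "c (Suc j)" "c j"])
      show "c (Suc j) i \<le> b0 i" if "i < 8" for i
        using c_le[OF that Suc.prems] X0[OF that] by linarith
      show "m \<le> dep b0 p" if "p \<in> oct (c (Suc j))" for p
        using m(1) that oct_mono[of "c (Suc j)" X] c_le Suc.prems by blast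
      show "c j i \<le> c (Suc j) i" if "i < 8" for i by (rule step(1)[OF that])
      show "q \<le> c j ((i + 7) mod 8) + c j ((i + 1) mod 8) - (if even i then 2 else 1) * c (Suc j) i" if "i < 8" for i
        using side_c[OF that, of j] step(2)[OF that, of j] Suc.prems by (auto simp: side_def split: if_splits)
      have "int j \<le> M" using Suc.prems by simp
      then show "cfg (c j) p \<le> u p" for p using Suc.IH by blast
    qed
    then show ?case by blast
  qed
  from this[of "nat M"] have "\<forall>p. cfg (c (nat M)) p \<le> u p" using M by simp
  moreover have "c (nat M) = X" using M by (simp add: c_def fun_eq_iff)
  ultimately show ?thesis by metis
qed

text \<open>Pigeonhole: the square splits into \<open>k * k\<close> blocks of size \<open>g\<close>.
  If none is full, then at least \<open>k * k\<close> cells of depth \<open>m\<close> or more are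
  missing. Filling the whole square costs at most \<open>20 * \<beta> * k * g\<close> and gains at
  least \<open>\<eta> * m * k * k\<close>.\<close>

lemma full_block:
  fixes a c :: int and k g :: nat and X :: "nat \<Rightarrow> int"
  assumes conf0: "conf N (cfg b0)" and X0: "\<And>i. i < 8 \<Longrightarrow> X i \<le> b0 i"
    and m: "\<And>p. p \<in> oct X \<Longrightarrow> m \<le> dep b0 p" "0 \<le> m"
    and sq: "\<And>i. i < 8 \<Longrightarrow> square a c (int (k * g)) i \<le> X i"
    and prof: "20 * \<beta> * real g < \<eta> * real_of_int m * real k" and kg: "0 < k"
  obtains x0 y0 where "a \<le> x0" "x0 + int g \<le> a + int (k * g)" "c \<le> y0" "y0 + int g \<le> c + int (k * g)"
    "\<And>x y. x0 \<le> x \<Longrightarrow> x < x0 + int g \<Longrightarrow> y0 \<le> y \<Longrightarrow> y < y0 + int g \<Longrightarrow> u (x, y) = 1"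
proof -
  note found = that
  define B where "B = square a c (int (k * g))"
  have B0: "B i \<le> b0 i" if "i < 8" for i using sq[OF that] X0[OF that] by (simp add: B_def)
  have BX: "oct B \<subseteq> oct X" using oct_mono sq unfolding B_def by blast
  have B0': "oct B \<subseteq> oct b0" using oct_mono B0 by blast
  have cB: "conf N (cfg B)" using conf_cfg_mono[OF conf0] B0 by blast
  define Miss where "Miss = oct B - {p. u p = 1}"
  have miss: "\<eta> * real_of_int m * real (card Miss) \<le> 5 * \<beta> * (4 * real (k * g))"
  proof -
    define v w where "v = join u (cfg B)" and "w = meet u (cfg B)"
    have cv: "conf N v" unfolding v_def by (rule conf_join[OF conf_u cB])
    obtain s where s: "charge s" "en \<beta> s N u + \<eta> * D u \<le> en \<beta> s N v + \<eta> * D v"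
      using minimal_charge[OF cv] by blast
    note sb = charge_bounds(1)[OF s(1)]
    have "en \<beta> s N v + en \<beta> s N w \<le> en \<beta> s N u + en \<beta> s N (cfg B)"
      unfolding v_def w_def by (rule en_submodular[OF \<beta>_le conf_u cB])
    moreover have "0 \<le> en \<beta> s N w" by (rule en_nonneg) (use \<beta>_le sb in auto)
    \<comment> \<open>At most \<open>4 * k * g\<close> zeros surround the square, each with four
      bonds of cost \<open>\<beta>\<close> and a charge below \<open>\<beta>\<close>.\<close>
    moreover have "en \<beta> s N (cfg B) \<le> 5 * \<beta> * (4 * real (k * g))"
    proof -
      have "en \<beta> s N (cfg B) \<le> (4 * \<beta> + \<bar>s\<bar>) * card {p. cfg B p = 0}"
        unfolding B_def using card_zeros_square \<beta>_le by (intro en_cfg_le) auto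
      also have "\<dots> \<le> 5 * \<beta> * (4 * real (k * g))"
      proof (rule mult_mono)
        have "card {p. cfg B p = 0} \<le> 4 * (k * g)"
          using card_zeros_square(2)[of "int (k * g)" a c] unfolding B_def by (simp only: nat_int)
        then show "real (card {p. cfg B p = 0}) \<le> 4 * real (k * g)" by linarith
      qed (use \<beta>_le sb in auto)
      finally show ?thesis .
    qed
    moreover have "D v - D u \<le> - real_of_int m * real (card Miss)"
    proof -
      have uval: "u q \<in> {-1, 0, 1}" for q using conf_u unfolding conf_def by blast
      have vp: "v q = 1 \<longleftrightarrow> u q = 1 \<or> q \<in> oct B" for q
        using uval[of q] by (auto simp: v_def join_def cfg_def)
      have E: "{p. v p = 1 \<and> u p \<noteq> 1} = Miss" unfolding vp Miss_def by blast
      have R: "{p. u p = 1 \<and> v p \<noteq> 1} = {}" unfolding vp by blast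
      have "m * int (card Miss) = (\<Sum>p\<in>Miss. m)" by simp
      also have "\<dots> \<le> (\<Sum>p\<in>Miss. dep b0 p)"
        using m BX by (intro sum_mono) (auto simp: Miss_def)
      finally have "real_of_int (m * int (card Miss)) \<le> real_of_int (\<Sum>p\<in>Miss. dep b0 p)"
        by (simp only: of_int_le_iff)
      moreover have "Miss \<subseteq> oct b0" using B0' by (auto simp: Miss_def)
      ultimately show ?thesis using dis_diff[OF cv refl refl] unfolding E R by simp
    qed
    then have "\<eta> * D v - \<eta> * D u \<le> \<eta> * (- real_of_int m * real (card Miss))"
      unfolding right_diff_distrib[symmetric] using \<eta> by (intro mult_left_mono) auto
    ultimately show ?thesis using s(2) by (simp add: algebra_simps)
  qed
  show thesis
  proof (rule ccontr)
    assume neg: "\<not> thesis"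
    have ex: "\<exists>p. p \<in> Miss \<and> a + int (i * g) \<le> fst p \<and> fst p < a + int (i * g) + int g
        \<and> c + int (j * g) \<le> snd p \<and> snd p < c + int (j * g) + int g" if "i < k" "j < k" for i j
    proof (rule ccontr)
      assume no: "\<not> ?thesis"
      have bd: "int (i * g) + int g \<le> int (k * g)" "int (j * g) + int g \<le> int (k * g)"
      proof -
        have "Suc i * g \<le> k * g" "Suc j * g \<le> k * g" using that by (intro mult_right_mono; simp)+
        then show "int (i * g) + int g \<le> int (k * g)" "int (j * g) + int g \<le> int (k * g)"
          unfolding of_nat_add[symmetric] of_nat_le_iff by (simp_all add: add.commute)
      qed
      have "u (x, y) = 1" if "a + int (i * g) \<le> x" "x < a + int (i * g) + int g"
         "c + int (j * g) \<le> y" "y < c + int (j * g) + int g" for x y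
      proof (rule ccontr)
        assume "u (x, y) \<noteq> 1"
        moreover have "0 \<le> int (i * g)" "0 \<le> int (j * g)" by simp_all
        then have "(x, y) \<in> oct B"
          unfolding B_def oct_square mem_Sigma_iff atLeastLessThan_iff using that bd by linarith
        ultimately show False using no that by (auto simp: Miss_def)
      qed
      then have thesis by (intro found[of "a + int (i * g)" "c + int (j * g)"]) (use bd in auto)
      then show False using neg by blast
    qed
    define f where "f ij = (SOME p. p \<in> Miss \<and> a + int (fst ij * g) \<le> fst p \<and> fst p < a + int (fst ij * g) + int g
        \<and> c + int (snd ij * g) \<le> snd p \<and> snd p < c + int (snd ij * g) + int g)" for ij
    have f: "f (i, j) \<in> Miss \<and> a + int (i * g) \<le> fst (f (i, j)) \<and> fst (f (i, j)) < a + int (i * g) + int g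
        \<and> c + int (j * g) \<le> snd (f (i, j)) \<and> snd (f (i, j)) < c + int (j * g) + int g" if "i < k" "j < k" for i j
      using someI_ex[OF ex[OF that]] unfolding f_def by simp
    \<comment> \<open>A coordinate determines the index of its block, so cells chosen in different
      blocks are different.\<close>
    have uniq: "i = i'" if "int (i * g) \<le> t" "t < int (i * g) + int g" "int (i' * g) \<le> t" "t < int (i' * g) + int g" for i i' t
    proof -
      have "t div int g = int i" if "int (i * g) \<le> t" "t < int (i * g) + int g" for i
        using that by (intro int_div_pos_eq[where r = "t - int (i * g)"]) auto
      then show ?thesis using that by (metis of_nat_eq_iff)
    qed
    have inj: "inj_on f ({..<k} \<times> {..<k})"
    proof (rule inj_onI)
      fix p q assume pq: "p \<in> {..<k} \<times> {..<k}" "q \<in> {..<k} \<times> {..<k}" "f p = f q"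
      then obtain i j i' j' where h: "p = (i, j)" "q = (i', j')" "i < k" "j < k" "i' < k" "j' < k" "f (i, j) = f (i', j')"
        by auto
      show "p = q"
        using f[of i j] f[of i' j'] h uniq[of i "fst (f (i, j)) - a" i'] uniq[of j "snd (f (i, j)) - c" j'] by auto
    qed
    have "card ({..<k} \<times> {..<k}) \<le> card Miss"
    proof (rule card_inj_on_le[OF inj])
      show "f ` ({..<k} \<times> {..<k}) \<subseteq> Miss" using f by auto
      show "finite Miss" unfolding Miss_def using finite_oct by simp
    qed
    then have "real k * real k \<le> real (card Miss)"
      by (simp add: card_cartesian_product flip: of_nat_mult)
    then have "\<eta> * real_of_int m * (real k * real k) \<le> \<eta> * real_of_int m * real (card Miss)"
      using \<eta> m by (intro mult_left_mono) auto
    also note miss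
    finally have "(\<eta> * real_of_int m * real k) * real k \<le> (20 * \<beta> * real g) * real k"
      by (simp add: algebra_simps)
    then show False using prof kg by simp
  qed
qed

end

section \<open>Vertices and core octagons\<close>

lemma side_phi: "i < 8 \<Longrightarrow> phi ((i + 7) mod 8) p + phi ((i + 1) mod 8) p - (if even i then 2 else 1) * phi i p = 0"
proof -
  assume "i < 8"
  then have "i \<in> {0, 1, 2, 3, 4, 5, 6, 7}" by auto
  then show ?thesis by (auto simp: phi_def simp flip: numeral_2_eq_2)
qed

text \<open>A vertex lies on two consecutive sides, so four vertices serve all eight
  indices.\<close>

lemma tight_attained:
  assumes "tight b" "i < 8"
  shows "\<exists>p\<in>oct b. phi i p = b i"
proof -
  note T = assms(1)[unfolded tight_iff]
  have "i \<in> {0, 1, 2, 3, 4, 5, 6, 7}" using assms(2) by auto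
  moreover have "\<exists>p\<in>oct b. phi 0 p = b 0" "\<exists>p\<in>oct b. phi 1 p = b 1"
    by (rule bexI[of _ "(b 0, b 1 - b 0)"], use T in \<open>simp_all add: oct_iff phi_def\<close>)+
  moreover have "\<exists>p\<in>oct b. phi 2 p = b 2" "\<exists>p\<in>oct b. phi 3 p = b 3"
    by (rule bexI[of _ "(b 2 - b 3, b 2)"], use T in \<open>simp_all add: oct_iff phi_def\<close>)+
  moreover have "\<exists>p\<in>oct b. phi 4 p = b 4" "\<exists>p\<in>oct b. phi 5 p = b 5"
    by (rule bexI[of _ "(- b 4, b 4 - b 5)"], use T in \<open>simp_all add: oct_iff phi_def\<close>)+
  moreover have "\<exists>p\<in>oct b. phi 6 p = b 6" "\<exists>p\<in>oct b. phi 7 p = b 7"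
    by (rule bexI[of _ "(b 7 - b 6, - b 6)"], use T in \<open>simp_all add: oct_iff phi_def\<close>)+
  ultimately show ?thesis by auto
qed

text \<open>The core octagons: the diagonal sides recede three times as fast as the flat ones,
  so all sides stay long.\<close>

definition shrink :: "(nat \<Rightarrow> int) \<Rightarrow> int \<Rightarrow> nat \<Rightarrow> int" where
  "shrink b m i = b i - (if even i then m else 3 * m)"

lemma side_shrink: "i < 8 \<Longrightarrow> side (shrink b m) i = side b i + (if even i then - 4 * m else m)"
proof -
  assume "i < 8"
  then have "i \<in> {0, 1, 2, 3, 4, 5, 6, 7}" by auto
  then show ?thesis by (auto simp: side_simps shrink_def)
qed

lemma dep_shrink: "0 \<le> m \<Longrightarrow> p \<in> oct (shrink b m) \<Longrightarrow> m + 1 \<le> dep b p"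
  by (force simp: le_dep_iff oct_def shrink_def split: if_splits)

lemma neighbour_cases:
  fixes i j :: nat
  assumes "j < 8" "odd j" "(j + 7) mod 8 = i \<or> (j + 1) mod 8 = i"
  shows "even i" "j = (i + 1) mod 8 \<or> j = (i + 7) mod 8"
proof -
  have "j \<in> {0, 1, 2, 3, 4, 5, 6, 7}" using assms(1) by auto
  then have "even i \<and> (j = (i + 1) mod 8 \<or> j = (i + 7) mod 8)"
    using assms(2,3) by (elim insertE) auto
  then show "even i" "j = (i + 1) mod 8 \<or> j = (i + 7) mod 8" by blast+
qed

section \<open>The core and the identification of the minimizer\<close>

context minimizing
begin

text \<open>A full block near the centre contains a small octagon, which grows by
  \<open>linear_path\<close> to the core at depth \<open>m0\<close>, far from the boundary. From
  there unit steps lead outward as long as a layer of length and depth about \<open>m\<close> pays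
  for itself, that is, down to depth \<open>K\<close>.\<close>

lemma core:
  fixes q k :: nat and m0 K L :: int
  assumes t0: "tight b0" and conf0: "conf N (cfg b0)"
    and L: "\<And>i. i < 8 \<Longrightarrow> even i \<Longrightarrow> L \<le> side b0 i" and m0: "8 * m0 \<le> L"
    and prof0: "3 * \<beta> < \<eta> * real_of_int (m0 * (int q + 1 - int \<Lambda>))"
    and seed: "20 * \<beta> * real (4 * q + 15) < \<eta> * real_of_int m0 * real k" "0 < k"
    and room: "2 * int (k * (4 * q + 15)) + 3 * (int q + 3) + 2 \<le> m0"
    and K: "int \<Lambda> + 2 \<le> K" "K \<le> m0" "3 * \<beta> < \<eta> * real_of_int (K * (K - 2 - int \<Lambda>))"
  shows "cfg (shrink b0 K) p \<le> u p"
proof -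
  \<comment> \<open>Equal to \<open>4 * j + 3\<close>: the seed octagon extends \<open>2 * j\<close>
    from its centre in each axis direction, its ring of zeros one step further.\<close>
  define g where "g = 4 * q + 15"
  define n where "n = int (k * g)"
  define j where "j = int q + 3"
  define X where "X = shrink b0 m0"
  have m0_pos: "0 \<le> m0" using K \<Lambda>_pos by linarith
  have room': "2 * n + 3 * j + 2 \<le> m0" "0 \<le> n" "3 \<le> j" using room by (simp_all add: n_def j_def g_def)
  have sideX: "m0 \<le> side X i" if "i < 8" for i
    using side_shrink[OF that, of b0 m0] L[OF that] m0 m0_pos t0 that by (auto simp: X_def tight_def)
  have X0: "X i \<le> b0 i" for i using m0_pos by (simp add: X_def shrink_def)
  have depX: "m0 \<le> dep b0 p" if "p \<in> oct X" for p
    using dep_shrink[OF m0_pos, of p b0] that by (simp add: X_def)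
  obtain z where z: "\<forall>i<8. phi i z + (m0 - 2) \<le> X i" using octagon_centre[OF sideX m0_pos] by blast
  obtain a c where ac: "z = (a, c)" by force
  have sq: "square a c (int (k * g)) i \<le> X i" if "i < 8" for i
  proof -
    have "\<forall>i<8. square a c n i \<le> X i"
      using z room' unfolding all_less_8 ac by (simp add: phi_def square_simps)
    then show ?thesis using that by (simp add: n_def)
  qed
  obtain x0 y0 where blk: "a \<le> x0" "x0 + int g \<le> a + int (k * g)" "c \<le> y0" "y0 + int g \<le> c + int (k * g)"
    "\<And>x y. x0 \<le> x \<Longrightarrow> x < x0 + int g \<Longrightarrow> y0 \<le> y \<Longrightarrow> y < y0 + int g \<Longrightarrow> u (x, y) = 1"
    using full_block[OF conf0 X0 depX m0_pos sq] seed unfolding g_def by blast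
  define cx cy where "cx = x0 + 2 * j + 1" and "cy = y0 + 2 * j + 1"
  \<comment> \<open>With flat heights \<open>2 * j\<close> and diagonal heights
    \<open>3 * j\<close>, the flat sides have length \<open>2 * j\<close> and the diagonal ones
    \<open>j = q + 3\<close>, as \<open>linear_path\<close> demands.\<close>
  define sd where "sd i = phi i (cx, cy) + (if even i then 2 * j else 3 * j)" for i
  have g: "int g = 4 * j + 3" by (simp add: g_def j_def)
  have "\<forall>i<8. sd i \<le> X i"
    using z blk(1-4) room' unfolding all_less_8 ac n_def[symmetric] g
    by (simp add: phi_def sd_def cx_def cy_def)
  then have sdX: "sd i \<le> X i" if "i < 8" for i using that by blast
  have "\<forall>i<8. j \<le> side sd i"
    using room' unfolding all_less_8 side_simps by (simp add: phi_def sd_def)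
  then have side_sd: "int q + 3 \<le> side sd i" if "i < 8" for i using that by (simp add: j_def)
  have start: "cfg sd p \<le> u p" for p
  proof -
    have 1: "oct sd \<subseteq> oct (\<lambda>i. sd i + 1)" by (rule oct_mono) simp
    have 2: "u p = 1" if "p \<in> oct (\<lambda>i. sd i + 1)"
    proof (cases p)
      case (Pair x y)
      then have "x0 \<le> x" "x < x0 + int g" "y0 \<le> y" "y < y0 + int g"
        using that room' by (simp_all add: oct_iff sd_def phi_def cx_def cy_def g)
      then show ?thesis using blk(5) Pair by blast
    qed
    have "u p \<in> {-1, 0, 1}" using conf_u unfolding conf_def by blast
    then show ?thesis using 1 2 by (auto simp: cfg_def)
  qed
  have sX3: "int q + 3 \<le> side X i" if "i < 8" for i
    using sideX[OF that] room' by (simp add: j_def)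
  have base: "cfg X p \<le> u p" for p
    by (rule linear_path[OF conf0 X0 depX m0_pos _ prof0 sdX side_sd sX3 start]) simp_all
  have chain: "\<forall>p. cfg (shrink b0 (m0 - int e)) p \<le> u p" if "int e \<le> m0 - K" for e
    using that
  proof (induction e)
    case 0
    then show ?case using base by (simp add: X_def)
  next
    case (Suc e)
    define m where "m = m0 - int e"
    have mK: "K + 1 \<le> m" "m \<le> m0" using Suc.prems by (simp_all add: m_def)
    have m_pos: "0 \<le> m" "0 \<le> m - 3" "0 \<le> m - 1" using mK K(1) \<Lambda>_pos by linarith+
    have IH: "cfg (shrink b0 m) p \<le> u p" for p
    proof -
      have "int e \<le> m0 - K" using Suc.prems by simp
      then show ?thesis using Suc.IH unfolding m_def by blast
    qed
    \<comment> \<open>The diagonal sides of \<open>shrink b0 m\<close> have length at least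
      \<open>m\<close>, and the step raises diagonal heights by 3. This leaves \<open>m - 3\<close>,
      which is the value of \<open>q\<close> for \<open>grow\<close>.\<close>
    have "cfg (shrink b0 (m - 1)) p \<le> u p" for p
    proof (rule grow[OF conf0 _ _ m_pos(1,2)])
      show "shrink b0 (m - 1) i \<le> b0 i" for i using m_pos by (simp add: shrink_def)
      show "m \<le> dep b0 p" if "p \<in> oct (shrink b0 (m - 1))" for p
        using dep_shrink[OF m_pos(3) that] by simp
      have "K * (K - 2 - int \<Lambda>) \<le> m * (m - 2 - int \<Lambda>)" using mK K(1) by (intro mult_mono) auto
      then have "real_of_int (K * (K - 2 - int \<Lambda>)) \<le> real_of_int (m * (m - 2 - int \<Lambda>))"
        by (simp only: of_int_le_iff)
      then have "\<eta> * real_of_int (K * (K - 2 - int \<Lambda>)) \<le> \<eta> * real_of_int (m * (m - 2 - int \<Lambda>))"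
        using \<eta> by (intro mult_left_mono) simp_all
      moreover have "m - 3 + 1 - int \<Lambda> = m - 2 - int \<Lambda>" by simp
      ultimately show "3 * \<beta> < \<eta> * real_of_int (m * (m - 3 + 1 - int \<Lambda>))" using K(3) by simp
      show "shrink b0 m i \<le> shrink b0 (m - 1) i" for i by (simp add: shrink_def)
      show "cfg (shrink b0 m) p \<le> u p" for p by (rule IH)
      have "\<forall>i<8. (if even i then L else 0) \<le> side b0 i" using L t0 by (auto simp: tight_def)
      then have "\<forall>i<8. m - 3 \<le> shrink b0 m ((i + 7) mod 8) + shrink b0 m ((i + 1) mod 8) - (if even i then 2 else 1) * shrink b0 (m - 1) i"
        using m0 mK m_pos unfolding all_less_8 side_simps by (simp add: shrink_def)
      then show "m - 3 \<le> shrink b0 m ((i + 7) mod 8) + shrink b0 m ((i + 1) mod 8) - (if even i then 2 else 1) * shrink b0 (m - 1) i"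
        if "i < 8" for i using that by blast
    qed
    then show ?case by (simp add: m_def algebra_simps)
  qed
  have "int (nat (m0 - K)) \<le> m0 - K" "m0 - int (nat (m0 - K)) = K" using K(2) by simp_all
  then show ?thesis using chain[of "nat (m0 - K)"] by metis
qed

text \<open>\<open>K1\<close> says that a lone cell at depth \<open>K + 1\<close> or less does not
  pay for itself. The first inequality on \<open>C\<close> keeps a flat side that cannot be extended
  within distance \<open>C\<close> of that of \<open>b0\<close>, the second excludes short outermost
  layers at depth up to \<open>C\<close>, and the third makes one unit of depth along a flat side
  outweigh all differences in length. The multiples of \<open>6 * K\<close> stem from the two
  diagonals at the ends of a flat side, which recede by at most \<open>3 * K\<close> each.\<close>

lemma is_octagon:
  fixes q k M :: nat and m0 K L C :: int
  assumes t0: "tight b0"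
    and confM: "conf N (cfg (\<lambda>i. b0 i + int M))" and startM: "\<And>p. u p \<le> cfg (\<lambda>i. b0 i + int M) p"
    and L: "\<And>i. i < 8 \<Longrightarrow> even i \<Longrightarrow> L \<le> side b0 i" and m0: "8 * m0 \<le> L"
    and prof0: "3 * \<beta> < \<eta> * real_of_int (m0 * (int q + 1 - int \<Lambda>))"
    and seed: "20 * \<beta> * real (4 * q + 15) < \<eta> * real_of_int m0 * real k" "0 < k"
    and room: "2 * int (k * (4 * q + 15)) + 3 * (int q + 3) + 2 \<le> m0"
    and K: "int \<Lambda> + 2 \<le> K" "K \<le> m0" "3 * \<beta> < \<eta> * real_of_int (K * (K - 2 - int \<Lambda>))"
    and K1: "\<eta> * real_of_int (K + 1) < \<beta>" and LK: "12 * K + 2 \<le> L"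
    and C: "0 \<le> C" "3 * \<beta> < \<eta> * real_of_int ((L - 8 * K - 1 - int \<Lambda>) * (C + 1))"
      "\<eta> * real_of_int ((6 * K + int \<Lambda> + 2) * C) < \<beta>" "(6 * K + 1) * C + (1 + int \<Lambda> + 2 * C) * C < L - 6 * K"
  shows "\<exists>b. tight b \<and> (\<forall>i<8. b i \<le> b0 i) \<and> (\<forall>i<8. even i \<longrightarrow> L - 6 * K \<le> side b i) \<and> (\<forall>i<8. odd i \<longrightarrow> 1 \<le> side b i) \<and> u = cfg b"
proof -
  have K_pos: "3 \<le> K" using K(1) \<Lambda>_pos by linarith
  have conf0: "conf N (cfg b0)" using conf_cfg_mono[OF confM] by simp
  have uval: "u p \<in> {-1, 0, 1}" for p using conf_u unfolding conf_def by blast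
  have S0: "\<forall>i<8. (if even i then L else 0) \<le> side b0 i" using L t0 by (auto simp: tight_def)
  have u0: "u p \<le> cfg b0 p" for p
    by (rule inside_initial[OF t0 _ confM startM]) (use L LK K_pos in fastforce)
  define X where "X = shrink b0 K"
  have coreX: "cfg X p \<le> u p" for p
    unfolding X_def by (rule core[OF t0 conf0 L m0 prof0 seed room K])
  define P where "P b \<longleftrightarrow> tight b \<and> (\<forall>i<8. X i \<le> b i \<and> b i \<le> b0 i) \<and> (\<forall>p. cfg b p \<le> u p)" for b
  define f where "f b = nat (\<Sum>i<8. b i - X i)" for b
  have PX: "P X"
  proof -
    have "tight X"
      unfolding tight_def X_def using side_shrink[of _ b0 K] L t0 LK K_pos by (force simp: tight_def)
    then show ?thesis using coreX K_pos by (simp add: P_def) (simp add: X_def shrink_def)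
  qed
  have bound: "\<forall>b. P b \<longrightarrow> f b < f b0 + 1"
  proof (intro allI impI)
    fix b assume "P b"
    then have "(\<Sum>i<8. b i - X i) \<le> (\<Sum>i<8. b0 i - X i)" by (intro sum_mono) (auto simp: P_def)
    then show "f b < f b0 + 1" by (simp add: f_def less_Suc_eq_le nat_mono)
  qed
  obtain b where b: "P b" "\<forall>c. P c \<longrightarrow> f c \<le> f b"
    using ex_has_greatest_nat[OF PX bound] by blast
  have tb: "tight b" and bX: "\<And>i. i < 8 \<Longrightarrow> X i \<le> b i" and bb0: "\<And>i. i < 8 \<Longrightarrow> b i \<le> b0 i" and bu: "\<And>p. cfg b p \<le> u p"
    using b(1) by (auto simp: P_def)
  have maximal: "\<not> (\<forall>p. cfg (incr b i) p \<le> u p)" if "i < 8" "tight (incr b i)" "b i < b0 i" for i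
  proof
    assume "\<forall>p. cfg (incr b i) p \<le> u p"
    moreover have "X j \<le> incr b i j \<and> incr b i j \<le> b0 j" if "j < 8" for j
      using bX[OF that] bb0[OF that] \<open>b i < b0 i\<close> by (cases "j = i") auto
    ultimately have "P (incr b i)" using that by (simp add: P_def)
    then have "f (incr b i) \<le> f b" using b(2) by blast
    moreover have "(\<Sum>j<8. b j - X j) < (\<Sum>j<8. incr b i j - X j)"
      by (rule sum_strict_mono_ex1) (use that(1) le_incr in \<open>auto intro!: bexI[of _ i]\<close>)
    moreover have "0 \<le> (\<Sum>j<8. b j - X j)" using bX by (intro sum_nonneg) force
    ultimately show False by (simp add: f_def)
  qed
  define Ones where "Ones = {p. u p = 1}"
  have u_oct: "u p = 1" if "p \<in> oct b" for p
    using bu[of p] that uval[of p] by (auto simp: cfg_def)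
  have "Ones \<subseteq> grid N" using conf_ones_grid[OF conf_u] by (auto simp: Ones_def)
  then have Ones_fin: "finite Ones" using finite_grid by (rule finite_subset)
  have Ones_ne: "Ones \<noteq> {}" using tight_attained[OF tb, of 0] u_oct by (auto simp: Ones_def)
  have Ones_b0: "Ones \<subseteq> oct b0"
  proof
    fix p assume "p \<in> Ones"
    then show "p \<in> oct b0" using u0[of p] by (auto simp: Ones_def cfg_def split: if_splits)
  qed
  define h where "h i = Max (phi i ` Ones)" for i
  have h_ge: "phi i p \<le> h i" if "u p = 1" for i p
    unfolding h_def using Ones_fin that by (intro Max_ge) (auto simp: Ones_def)
  have h_att: "\<exists>p. u p = 1 \<and> phi i p = h i" for i
  proof -
    have "h i \<in> phi i ` Ones" unfolding h_def using Ones_fin Ones_ne by (intro Max_in) auto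
    then obtain p where "h i = phi i p" "p \<in> Ones" by (rule imageE)
    then show ?thesis by (intro exI[of _ p]) (simp add: Ones_def)
  qed
  have bh: "b i \<le> h i" if "i < 8" for i
  proof -
    have "\<exists>p\<in>oct b. phi i p = b i" by (rule tight_attained[OF tb that])
    then obtain p where "p \<in> oct b" "phi i p = b i" by blast
    then show ?thesis using h_ge[OF u_oct, of p i] by simp
  qed
  have hb0: "h i \<le> b0 i" if "i < 8" for i
  proof -
    obtain p where p: "u p = 1" "phi i p = h i" using h_att by blast
    then have "p \<in> oct b0" using Ones_b0 unfolding Ones_def by blast
    then show ?thesis using p(2) that unfolding oct_def by auto
  qed
  \<comment> \<open>Three consecutive functionals satisfy the side relation with equality at every
    cell; evaluate it at a 1 that attains \<open>h i\<close>.\<close>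
  have th: "tight h"
    unfolding tight_def
  proof (intro allI impI)
    fix i :: nat assume i: "i < 8"
    obtain p where p: "u p = 1" "phi i p = h i" using h_att by blast
    show "0 \<le> side h i"
      using side_phi[OF i, of p] h_ge[OF p(1), of "(i + 7) mod 8"] h_ge[OF p(1), of "(i + 1) mod 8"] p(2)
      by (simp add: side_def)
  qed
  have hX: "\<forall>i<8. shrink b0 K i \<le> h i" using bX bh by (force simp: X_def)
  have bX': "\<forall>i<8. shrink b0 K i \<le> b i" using bX by (simp add: X_def)
  have hb0': "\<forall>i<8. h i \<le> b0 i" and bb0': "\<forall>i<8. b i \<le> b0 i" using hb0 bb0 by blast+
  \<comment> \<open>Applies to all octagons between the core and \<open>b0\<close>.\<close>
  have even_ge: "L - 6 * K \<le> c ((i + 7) mod 8) + c ((i + 1) mod 8) - 2 * b0 i"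
    if i: "i < 8" "even i" and c: "\<forall>i<8. shrink b0 K i \<le> c i" for c i
  proof -
    have nb: "(i + 7) mod 8 < 8" "(i + 1) mod 8 < 8" "odd ((i + 7) mod 8)" "odd ((i + 1) mod 8)"
      using i by presburger+
    show ?thesis
      using c[rule_format, OF nb(1)] c[rule_format, OF nb(2)] nb(3,4) L[OF i] i(2)
      by (simp add: shrink_def side_def)
  qed
  have even_h: "L - 6 * K \<le> side h i" and even_b: "L - 6 * K \<le> side b i" if "i < 8" "even i" for i
    using even_ge[OF that hX] even_ge[OF that bX'] hb0[OF that(1)] bb0[OF that(1)] that(2)
    by (simp_all add: side_def)
  have uh: "u p \<le> cfg h p" for p
  proof -
    \<comment> \<open>Diagonal heights are lowered first: as long as the flat heights are those of
      \<open>b0\<close>, diagonal sides are no shorter than in \<open>b0\<close>, and once the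
      diagonal heights are those of \<open>h\<close>, no shorter than in \<open>h\<close>.\<close>
    define c where "c i = (if even i then b0 i else h i)" for i
    have Ones_h: "p \<in> oct h" if "u p = 1" for p using h_ge[OF that] by (simp add: oct_def)
    have h_c: "h i \<le> c i" "c i \<le> b0 i" if "i < 8" for i using hb0[OF that] by (auto simp: c_def)
    have 1: "u p \<le> cfg c p" for p
    proof (rule peel_path[OF _ h_c(2) _ conf0 u0])
      show "p \<in> oct c" if "u p = 1" for p using Ones_h[OF that] oct_mono[of h c] h_c(1) by blast
      fix e assume "\<And>i. i < 8 \<Longrightarrow> c i \<le> e i \<and> e i \<le> b0 i"
      then have "\<forall>i<8. c i \<le> e i \<and> e i \<le> b0 i" by blast
      then have e: "\<And>i. i < 8 \<Longrightarrow> c i \<le> e i" "\<And>i. i < 8 \<Longrightarrow> e i \<le> b0 i" by blast+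
      show "tight e"
        unfolding tight_def
      proof (intro allI impI)
        fix i :: nat assume i: "i < 8"
        show "0 \<le> side e i"
        proof (cases "even i")
          case True
          have "\<forall>i<8. shrink b0 K i \<le> c i" using hX h_c(1) by (meson order_trans)
          then show ?thesis
            using even_ge[OF i True, of c] side_ge[of i c e "b0 i", OF i e(1) e(2)[OF i]] True LK K_pos by simp
        next
          case False
          have "odd i" using False .
          then have "even ((i + 7) mod 8)" "even ((i + 1) mod 8)" by presburger+
          then show ?thesis
            using side_ge[of i c e "b0 i", OF i e(1) e(2)[OF i]] False t0[unfolded tight_def, rule_format, OF i]
            by (simp add: c_def side_def)
        qed
      qed
    qed
    show ?thesis
    proof (rule peel_path[OF _ h_c(1) _ _ 1])
      show "p \<in> oct h" if "u p = 1" for p using Ones_h[OF that] .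
      show "conf N (cfg c)" using conf_cfg_mono[OF conf0] h_c(2) by blast
      fix e assume "\<And>i. i < 8 \<Longrightarrow> h i \<le> e i \<and> e i \<le> c i"
      then have "\<forall>i<8. h i \<le> e i \<and> e i \<le> c i" by blast
      then have e: "\<And>i. i < 8 \<Longrightarrow> h i \<le> e i" "\<And>i. i < 8 \<Longrightarrow> e i \<le> c i" by blast+
      show "tight e"
        unfolding tight_def
      proof (intro allI impI)
        fix i :: nat assume i: "i < 8"
        show "0 \<le> side e i"
        proof (cases "even i")
          case True
          then show ?thesis
            using even_ge[OF i True hX] side_ge[of i h e "c i", OF i e(1) e(2)[OF i]] LK K_pos by (simp add: c_def)
        next
          case False
          then show ?thesis
            using side_ge[of i h e "c i", OF i e(1) e(2)[OF i]] False th[unfolded tight_def, rule_format, OF i]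
            by (simp add: c_def side_def)
        qed
      qed
    qed
  qed
  have lower: "incr (h(i := h i - 1)) i = h" for i by (simp add: incr_def)
  have confh: "conf N (cfg h)" using conf_cfg_mono[OF conf0] hb0 by blast
  have oct_h: "oct h \<subseteq> oct b0" using oct_mono hb0 by blast
  have top_ne: "{p \<in> layer (h(i := h i - 1)) i. u p = 1} \<noteq> {}" if i: "i < 8" for i
  proof -
    obtain p where p: "u p = 1" "phi i p = h i" using h_att by blast
    have "p \<in> oct h" using h_ge[OF p(1)] by (simp add: oct_def)
    moreover have "p \<notin> oct (h(i := h i - 1))" using p(2) i by (auto simp: oct_def intro!: exI[of _ i])
    ultimately have "p \<in> layer (h(i := h i - 1)) i" using lower by (simp add: layer_def)
    then show ?thesis using p(1) by blast
  qed
  have top_phi: "phi i p = h i" if "i < 8" "p \<in> layer (h(i := h i - 1)) i" for i p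
  proof -
    have "p \<in> oct h" "p \<notin> oct (h(i := h i - 1))" using that(2) lower by (auto simp: layer_def)
    then obtain j where "j < 8" "phi j p \<le> h j" "(h(i := h i - 1)) j < phi j p" by (auto simp: oct_def not_le)
    then show ?thesis by (cases "j = i") auto
  qed
  \<comment> \<open>Lowering a height shortens both neighbouring sides by one. Flat neighbours have
    length to spare, diagonal ones must have length at least 1.\<close>
  have tight_low: "tight (h(i := h i - 1))" if i: "i < 8" "odd i \<or> 1 \<le> side h ((i + 1) mod 8) \<and> 1 \<le> side h ((i + 7) mod 8)" for i
  proof -
    show ?thesis
      unfolding tight_def
    proof (intro allI impI)
      fix j :: nat assume j: "j < 8"
      have th': "0 \<le> side h j" "even j \<Longrightarrow> 1 \<le> side h j"
        using th j even_h[OF j] LK K_pos by (auto simp: tight_def)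
      show "0 \<le> side (h(i := h i - 1)) j"
      proof (cases "j = i")
        case True
        have "(i + 7) mod 8 \<noteq> i" "(i + 1) mod 8 \<noteq> i" using i(1) by presburger+
        then show ?thesis using th' True by (simp add: side_def split: if_splits)
      next
        case False
        then have one: "side h j - 1 \<le> side (h(i := h i - 1)) j"
          if "\<not> ((j + 7) mod 8 = i \<and> (j + 1) mod 8 = i)" using that by (auto simp: side_def)
        have ne: "\<not> ((j + 7) mod 8 = i \<and> (j + 1) mod 8 = i)" by presburger
        show ?thesis
        proof (cases "even j")
          case True
          then show ?thesis using one[OF ne] th' by simp
        next
          case odd: False
          show ?thesis
          proof (cases "(j + 7) mod 8 = i \<or> (j + 1) mod 8 = i")
            case True
            then have "j = (i + 1) mod 8 \<or> j = (i + 7) mod 8" "even i"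
              using neighbour_cases[OF j odd True] by blast+
            then have "1 \<le> side h j" using i(2) by auto
            then show ?thesis using one[OF ne] by simp
          next
            case no: False
            then show ?thesis using th' False by (simp add: side_def)
          qed
        qed
      qed
    qed
  qed
  \<comment> \<open>A diagonal side of length 0 is a single corner cell. It lies on a flat side of
    the hull, hence at depth at most \<open>K + 1\<close>, and removing it would be
    profitable.\<close>
  have odd_h: "1 \<le> side h i" if i: "i < 8" "odd i" for i
  proof (rule ccontr)
    assume "\<not> 1 \<le> side h i"
    then have s0: "side h i = 0" using th[unfolded tight_def, rule_format, OF i(1)] by simp
    define g where "g = h(i := h i - 1)"
    have tg: "tight g" "tight (incr g i)" "conf N (cfg (incr g i))" "incr g i = h"
      unfolding g_def lower using tight_low i th confh by auto
    have ne: "(i + 7) mod 8 \<noteq> i" "(i + 1) mod 8 \<noteq> i" using i(1) by presburger+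
    have "side g i = 1" using s0 ne i(2) by (simp add: g_def side_def)
    then have "card (layer g i) = 1" using card_layer[OF i(1) tg(1,2)] i(2) by simp
    then obtain p where p: "layer g i = {p}" by (rule card_1_singletonE)
    have A: "{p \<in> layer g i. u p = 1} = {p}" using top_ne[OF i(1)] p unfolding g_def by auto
    have "\<beta> \<le> \<eta> * real_of_int (\<Sum>p\<in>{p}. dep b0 p)"
      using remove_top_layer[OF i(1) tg(1-3) _ A[symmetric]] uh tg(4) oct_h unfolding layer_def by auto
    moreover have "dep b0 p \<le> K + 1"
    proof -
      let ?j = "(i + 1) mod 8"
      have up: "u p = 1" using A by auto
      have "phi i p = h i" using top_phi[OF i(1)] p unfolding g_def by auto
      then have "phi ?j p = h ?j"
        using side_phi[OF i(1), of p] s0 i(2) h_ge[OF up, of ?j] h_ge[OF up, of "(i + 7) mod 8"] by (simp add: side_def)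
      moreover have "?j < 8" "even ?j" using i(2) by presburger+
      moreover have "b0 ?j - K \<le> h ?j" using hX[rule_format, OF \<open>?j < 8\<close>] \<open>even ?j\<close> by (simp add: shrink_def)
      ultimately show ?thesis using dep_le[of ?j b0 p] by linarith
    qed
    then have "\<eta> * real_of_int (dep b0 p) \<le> \<eta> * real_of_int (K + 1)" using \<eta> by (intro mult_left_mono) simp_all
    ultimately show False using K1 by simp
  qed
  have tight_up: "tight (incr b i)" if i: "i < 8" "(if even i then 2 else 1) \<le> side b i" for i
    unfolding tight_def
  proof (intro allI impI)
    fix j :: nat assume j: "j < 8"
    show "0 \<le> side (incr b i) j"
    proof (cases "j = i")
      case True
      have "(i + 7) mod 8 \<noteq> i" "(i + 1) mod 8 \<noteq> i" using i(1) by presburger+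
      then show ?thesis using i(2) True by (simp add: side_def split: if_splits)
    next
      case False
      then have "side b j \<le> side (incr b i) j"
        using le_incr[of b "(j + 7) mod 8" i] le_incr[of b "(j + 1) mod 8" i] by (simp add: side_def)
      then show ?thesis using tb j by (fastforce simp: tight_def)
    qed
  qed
  \<comment> \<open>By maximality the layer next to \<open>b\<close> is nearly free of 1s, while the
    outermost hull layer must be long; exchanging the two would lower the dissipation.\<close>
  have even_eq: "h i = b i" if i: "i < 8" "even i" for i
  proof (rule ccontr)
    assume "h i \<noteq> b i"
    then have lt: "b i < h i" using bh[OF i(1)] by simp
    have lt0: "b i < b0 i" using lt hb0[OF i(1)] by simp
    \<comment> \<open>Depth of the cells in the layer next to side \<open>i\<close> of
      \<open>b\<close>, away from its two ends.\<close>
    define \<tau> where "\<tau> = b0 i - b i"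
    have \<tau>: "1 \<le> \<tau>" "\<tau> \<le> K" using lt0 bX'[rule_format, OF i(1)] i(2) by (auto simp: \<tau>_def shrink_def)
    have ti: "tight (incr b i)" by (rule tight_up[OF i(1)]) (use even_b[OF i] LK K_pos i in simp)
    have ib0: "incr b i j \<le> b0 j" if "j < 8" for j using bb0[OF that] lt0 by (cases "j = i") auto
    have lay0: "layer b i \<subseteq> oct b0" using oct_mono[of "incr b i" b0] ib0 by (auto simp: layer_def)
    have ci: "conf N (cfg (incr b i))" using conf_cfg_mono[OF conf0] ib0 by blast
    define A where "A = {p \<in> layer b i. u p = 1}"
    obtain p where np: "\<not> cfg (incr b i) p \<le> u p" using maximal[OF i(1) ti lt0] by blast
    have "\<not> (odd i \<and> A \<noteq> {} \<or> 0 < \<Lambda> \<and> \<Lambda> \<le> card A \<or> 3 * \<beta> < \<eta> * real_of_int (\<Sum>p\<in>layer b i - A. dep b0 p))"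
      using extend[OF i(1) tb ti ci bu lay0 A_def, of p] np by blast
    then have "\<not> \<Lambda> \<le> card A" "\<not> 3 * \<beta> < \<eta> * real_of_int (\<Sum>p\<in>layer b i - A. dep b0 p)"
      using \<Lambda>_pos by blast+
    then have notprof: "card A < \<Lambda>" "\<eta> * real_of_int (\<Sum>p\<in>layer b i - A. dep b0 p) \<le> 3 * \<beta>"
      by linarith+
    define s where "s = side b i"
    have s: "L - 6 * K \<le> s" using even_b[OF i] by (simp add: s_def)
    define Bad where "Bad = {p \<in> layer b i. dep b0 p < \<tau>}"
    have bad: "int (card Bad) \<le> 2 * \<tau>"
      unfolding Bad_def \<tau>_def
    proof (rule card_shallow_flat[OF i tb ti bb0 _ lt0])
      show "b0 i - b i \<le> side b j" if "j < 8" "even j" for j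
        using even_b[OF that] LK K_pos \<tau> unfolding \<tau>_def by linarith
    qed
    \<comment> \<open>Of the \<open>s - 1\<close> cells of the layer fewer than
      \<open>\<Lambda>\<close> are 1 and at most \<open>2 * \<tau>\<close> are shallow; all others
      are missing at depth at least \<open>\<tau>\<close>.\<close>
    have low: "\<tau> * (s - 1 - int \<Lambda> - 2 * \<tau>) \<le> (\<Sum>p\<in>layer b i - A. dep b0 p)"
    proof -
      have fin: "finite A" "finite Bad" using finite_layer by (auto simp: A_def Bad_def)
      have "card (layer b i) \<le> card (layer b i - A - Bad) + card A + card Bad"
      proof -
        have "layer b i \<subseteq> (layer b i - A - Bad) \<union> A \<union> Bad" by auto
        then have "card (layer b i) \<le> card ((layer b i - A - Bad) \<union> A \<union> Bad)"
          using fin finite_layer by (intro card_mono) auto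
        also have "\<dots> \<le> card (layer b i - A - Bad) + card A + card Bad"
          by (meson card_Un_le add_mono le_refl order_trans)
        finally show ?thesis .
      qed
      moreover have "int (card (layer b i)) = s - 1"
        using card_layer[OF i(1) tb ti] i(2) s LK K_pos by (simp add: s_def)
      ultimately have cd: "s - 1 - int \<Lambda> - 2 * \<tau> \<le> int (card (layer b i - A - Bad))"
        using notprof(1) bad by linarith
      have "\<tau> * (s - 1 - int \<Lambda> - 2 * \<tau>) \<le> \<tau> * int (card (layer b i - A - Bad))"
        using cd \<tau> by (intro mult_left_mono) auto
      also have "\<dots> = (\<Sum>p\<in>layer b i - A - Bad. \<tau>)" by simp
      also have "\<dots> \<le> (\<Sum>p\<in>layer b i - A - Bad. dep b0 p)"
        by (rule sum_mono) (auto simp: Bad_def)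
      also have "\<dots> \<le> (\<Sum>p\<in>layer b i - A. dep b0 p)"
        using finite_layer lay0 dep_pos by (intro sum_mono2) force+
      finally show ?thesis .
    qed
    \<comment> \<open>At a distance beyond \<open>C\<close> the missing cells alone would pay for
      completing the layer, against maximality.\<close>
    have \<tau>C: "\<tau> \<le> C"
    proof (rule ccontr)
      assume "\<not> \<tau> \<le> C"
      have pos: "0 < L - 8 * K - 1 - int \<Lambda>"
      proof (rule ccontr)
        assume "\<not> 0 < L - 8 * K - 1 - int \<Lambda>"
        then have "(L - 8 * K - 1 - int \<Lambda>) * (C + 1) \<le> 0" using C(1) by (intro mult_nonpos_nonneg) auto
        then have "\<eta> * real_of_int ((L - 8 * K - 1 - int \<Lambda>) * (C + 1)) \<le> 0"
          using \<eta> by (intro mult_nonneg_nonpos) (simp_all only: of_int_le_0_iff less_imp_le)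
        then show False using C(2) \<beta>(1) by linarith
      qed
      have "(L - 8 * K - 1 - int \<Lambda>) * (C + 1) \<le> (s - 1 - int \<Lambda> - 2 * \<tau>) * \<tau>"
        using s \<tau> \<open>\<not> \<tau> \<le> C\<close> C(1) pos by (intro mult_mono) auto
      then have "(L - 8 * K - 1 - int \<Lambda>) * (C + 1) \<le> (\<Sum>p\<in>layer b i - A. dep b0 p)"
        using low by (simp add: mult.commute)
      then have "real_of_int ((L - 8 * K - 1 - int \<Lambda>) * (C + 1)) \<le> real_of_int (\<Sum>p\<in>layer b i - A. dep b0 p)"
        by (simp only: of_int_le_iff)
      then have "\<eta> * real_of_int ((L - 8 * K - 1 - int \<Lambda>) * (C + 1)) \<le> \<eta> * real_of_int (\<Sum>p\<in>layer b i - A. dep b0 p)"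
        using \<eta> by (intro mult_left_mono) simp_all
      then show False using C(2) notprof(2) by linarith
    qed
    define g where "g = h(i := h i - 1)"
    have nb: "(i + 7) mod 8 \<noteq> i" "(i + 1) mod 8 \<noteq> i" "(i + 7) mod 8 < 8" "(i + 1) mod 8 < 8"
      "odd ((i + 7) mod 8)" "odd ((i + 1) mod 8)"
      using i by presburger+
    have tg: "tight g" "tight (incr g i)" "conf N (cfg (incr g i))" "incr g i = h"
      unfolding g_def lower using tight_low[OF i(1)] odd_h nb th confh by auto
    define AH where "AH = {p \<in> layer g i. u p = 1}"
    have AH_ne: "AH \<noteq> {}" unfolding AH_def g_def by (rule top_ne[OF i(1)])
    have finAH: "finite AH" using finite_layer by (simp add: AH_def)
    have dep_AH: "dep b0 p \<le> \<tau> + 1 - (h i - b i)" if "p \<in> AH" for p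
      using top_phi[OF i(1), of p] dep_le[OF i(1), of b0 p] that by (simp add: AH_def g_def \<tau>_def)
    have layg: "layer g i \<subseteq> oct b0" using oct_h tg(4) by (auto simp: layer_def)
    have side_gh: "side g i = side h i + 2" using nb i(2) by (simp add: g_def side_def)
    have side_hb: "side h i \<le> s + 6 * K"
    proof -
      have "h j \<le> b j + 3 * K" if "j < 8" for j
        using hb0[OF that] bX'[rule_format, OF that] K_pos by (auto simp: shrink_def split: if_splits)
      from this[OF nb(3)] this[OF nb(4)] show ?thesis using lt i(2) by (simp add: side_def s_def)
    qed
    \<comment> \<open>All cells of the outermost layer have depth at most \<open>C\<close>, so few
      of them cannot save \<open>\<beta>\<close>. The bound exceeds \<open>\<Lambda>\<close> plus
      the excess length of the hull row over the inner one.\<close>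
    have large: "6 * K + int \<Lambda> + 2 < int (card AH)"
    proof (rule ccontr)
      assume small: "\<not> 6 * K + int \<Lambda> + 2 < int (card AH)"
      have "(\<Sum>p\<in>AH. dep b0 p) \<le> (\<Sum>p\<in>AH. C)"
        using dep_AH lt \<tau>C by (intro sum_mono) force
      also have "\<dots> \<le> (6 * K + int \<Lambda> + 2) * C" using small C(1) by (auto intro!: mult_right_mono)
      finally have "real_of_int (\<Sum>p\<in>AH. dep b0 p) \<le> real_of_int ((6 * K + int \<Lambda> + 2) * C)" by (simp only: of_int_le_iff)
      then have "\<eta> * real_of_int (\<Sum>p\<in>AH. dep b0 p) \<le> \<eta> * real_of_int ((6 * K + int \<Lambda> + 2) * C)"
        using \<eta> by (intro mult_left_mono) simp_all
      moreover have "\<beta> \<le> \<eta> * real_of_int (\<Sum>p\<in>AH. dep b0 p)"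
        using remove_top_layer[OF i(1) tg(1-3) _ AH_def AH_ne layg] uh tg(4) by simp
      ultimately show False using C(3) by linarith
    qed
    have bg: "b j \<le> g j" if "j < 8" for j using bh[OF that] lt by (auto simp: g_def)
    have swap: "(\<Sum>p\<in>layer b i - {p. u p = 1}. dep b0 p) \<le> (\<Sum>p\<in>AH - layer b i. dep b0 p)"
      using swap_layers[OF i(1) tb ti tg(1-3) bu _ bg AH_def AH_ne] uh tg(4) large oct_h K_pos by simp
    have eqA: "layer b i - {p. u p = 1} = layer b i - A" by (auto simp: A_def)
    have cg: "int (card (layer g i)) = side h i + 1"
      using card_layer[OF i(1) tg(1,2)] i(2) side_gh even_h[OF i] LK K_pos by simp
    show False
    proof (cases "h i = b i + 1")
      \<comment> \<open>Both layers lie in one row. The hull row has at most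
        \<open>6 * K + 2\<close> cells more, and fewer than \<open>\<Lambda>\<close> cells of the
        inner layer are 1, too few for \<open>large\<close>.\<close>
      case True
      have sub: "layer b i \<subseteq> layer g i"
      proof
        fix x assume x: "x \<in> layer b i"
        then have "x \<in> oct (incr b i)" "x \<notin> oct b" by (auto simp: layer_def)
        then obtain j where "j < 8" "b j < phi j x" "phi j x \<le> incr b i j" by (auto simp: oct_def not_le)
        then have ph: "phi i x = h i" using True by (cases "j = i") auto
        have "incr b i j \<le> h j" if "j < 8" for j using bh[OF that] True by (cases "j = i") auto
        then have "x \<in> oct h" using oct_mono[of "incr b i" h] \<open>x \<in> oct (incr b i)\<close> by blast
        moreover have "x \<notin> oct g" using ph i(1) by (auto simp: oct_def g_def intro!: exI[of _ i])
        ultimately show "x \<in> layer g i" using tg(4) by (simp add: layer_def)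
      qed
      have "AH \<subseteq> A \<union> (layer g i - layer b i)" by (auto simp: A_def AH_def)
      then have "card AH \<le> card (A \<union> (layer g i - layer b i))"
        using finite_layer by (intro card_mono) (auto simp: A_def)
      also have "\<dots> \<le> card A + card (layer g i - layer b i)" by (rule card_Un_le)
      also have "card (layer g i - layer b i) = card (layer g i) - card (layer b i)"
        using sub finite_layer by (rule card_Diff_subset[rotated])
      finally have "card AH \<le> card A + (card (layer g i) - card (layer b i))" .
      moreover have "card (layer b i) \<le> card (layer g i)" using sub finite_layer by (intro card_mono)
      moreover have "int (card (layer b i)) = s - 1"
        using card_layer[OF i(1) tb ti] i(2) s LK K_pos by (simp add: s_def)
      ultimately show False using large notprof(1) cg side_hb by linarith
    next
      \<comment> \<open>The hull cells now have depth at most \<open>\<tau> - 1\<close>, most of the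
        inner ones depth \<open>\<tau>\<close>. Summed over about \<open>s\<close> cells, this unit
        decides the exchange.\<close>
      case False
      then have h2: "b i + 2 \<le> h i" using lt by linarith
      have "(\<Sum>p\<in>AH - layer b i. dep b0 p) \<le> (\<Sum>p\<in>AH. dep b0 p)"
        using finAH dep_pos layg by (intro sum_mono2) (force simp: AH_def)+
      also have "\<dots> \<le> (\<Sum>p\<in>AH. \<tau> - 1)" using dep_AH h2 by (intro sum_mono) force
      also have "\<dots> = int (card AH) * (\<tau> - 1)" by simp
      also have "\<dots> \<le> (s + 6 * K + 1) * (\<tau> - 1)"
      proof (rule mult_right_mono)
        have "card AH \<le> card (layer g i)" using finite_layer by (intro card_mono) (auto simp: AH_def)
        then show "int (card AH) \<le> s + 6 * K + 1" using cg side_hb by linarith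
      qed (use \<tau> in simp)
      finally have "\<tau> * (s - 1 - int \<Lambda> - 2 * \<tau>) \<le> (s + 6 * K + 1) * (\<tau> - 1)"
        using swap low unfolding eqA by linarith
      then have "s \<le> (6 * K + 1) * (\<tau> - 1) + (1 + int \<Lambda> + 2 * \<tau>) * \<tau>" by (simp add: algebra_simps)
      also have "\<dots> \<le> (6 * K + 1) * C + (1 + int \<Lambda> + 2 * C) * C"
        using \<tau> \<tau>C K_pos by (intro add_mono mult_mono) auto
      finally show False using C(4) s by linarith
    qed
  qed
  \<comment> \<open>By maximality the diagonal layer next to \<open>b\<close> contains no 1 at all,
    since a single one would make its completion profitable.\<close>
  have odd_eq: "h i = b i" if i: "i < 8" "odd i" for i
  proof (rule ccontr)
    assume "h i \<noteq> b i"
    then have lt: "b i < h i" using bh[OF i(1)] by simp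
    have lt0: "b i < b0 i" using lt hb0[OF i(1)] by simp
    have nb: "(i + 7) mod 8 < 8" "(i + 1) mod 8 < 8" "even ((i + 7) mod 8)" "even ((i + 1) mod 8)" "(i + 7) mod 8 \<noteq> i" "(i + 1) mod 8 \<noteq> i"
      using i by presburger+
    have "side b i \<ge> 1"
      using odd_h[OF i] lt even_eq[OF nb(1,3)] even_eq[OF nb(2,4)] i(2) by (simp add: side_def)
    then have ti: "tight (incr b i)" by (intro tight_up[OF i(1)]) (use i in simp)
    have ib0: "incr b i j \<le> b0 j" if "j < 8" for j using bb0[OF that] lt0 by (cases "j = i") auto
    have lay0: "layer b i \<subseteq> oct b0" using oct_mono[of "incr b i" b0] ib0 by (auto simp: layer_def)
    have ci: "conf N (cfg (incr b i))" using conf_cfg_mono[OF conf0] ib0 by blast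
    obtain p where np: "\<not> cfg (incr b i) p \<le> u p" using maximal[OF i(1) ti lt0] by blast
    have A: "{p \<in> layer b i. u p = 1} = {}"
      using extend[OF i(1) tb ti ci bu lay0 refl, of p] np i(2) by blast
    define g where "g = h(i := h i - 1)"
    have tg: "tight g" "tight (incr g i)" "conf N (cfg (incr g i))" "incr g i = h"
      unfolding g_def lower using tight_low[OF i(1)] i(2) th confh by auto
    define AH where "AH = {p \<in> layer g i. u p = 1}"
    have AH_ne: "AH \<noteq> {}" unfolding AH_def g_def by (rule top_ne[OF i(1)])
    have gj: "g j = b j" if "j < 8" "even j" for j
      using even_eq[OF that] that i(2) by (auto simp: g_def)
    have bg: "b j \<le> g j" if "j < 8" for j using bh[OF that] lt by (auto simp: g_def)
    \<comment> \<open>If the hull were just one step ahead, the two layers would coincide, but one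
      of them is free of 1s and the other is not.\<close>
    have bgi: "b i < g i"
    proof (rule ccontr)
      assume "\<not> b i < g i"
      then have "g i = b i" using bg[OF i(1)] by simp
      then have "layer g i = layer b i" using layer_diagonal_eq[OF i tb ti tg(1,2) gj] by simp
      then show False using A AH_ne by (simp add: AH_def)
    qed
    have layg: "layer g i \<subseteq> oct b0" using oct_h tg(4) by (auto simp: layer_def)
    have "(\<Sum>p\<in>layer b i - {p. u p = 1}. dep b0 p) \<le> (\<Sum>p\<in>AH - layer b i. dep b0 p)"
      using swap_layers[OF i(1) tb ti tg(1-3) bu _ bg AH_def AH_ne] uh tg(4) i(2) oct_h by simp
    also have "layer b i - {p. u p = 1} = layer b i" using A by auto
    also have "(\<Sum>p\<in>AH - layer b i. dep b0 p) \<le> (\<Sum>p\<in>layer g i. dep b0 p)"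
      using finite_layer dep_pos layg by (intro sum_mono2) (force simp: AH_def)+
    also have "\<dots> < (\<Sum>p\<in>layer b i. dep b0 p)"
    proof (rule sum_dep_diagonal_layers[OF i tb ti tg(1,2) gj bgi _ bb0])
      show "g i < b0 i" using hb0[OF i(1)] by (simp add: g_def)
      show "2 * (b0 i - b i) \<le> side b j" if "j < 8" "even j" for j
        using even_b[OF that] bX'[rule_format, OF i(1)] i(2) LK K_pos by (simp add: shrink_def)
    qed
    finally show False by simp
  qed
  have "h i = b i" if "i < 8" for i using even_eq[OF that] odd_eq[OF that] by blast
  then have cf: "cfg h = cfg b" by (rule cfg_cong)
  have "u = cfg b"
  proof
    fix p show "u p = cfg b p" using uh[of p] bu[of p] cf by simp
  qed
  moreover have "1 \<le> side b i" if "i < 8" "odd i" for i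
  proof -
    have "side b i = side h i"
      using \<open>\<And>i. i < 8 \<Longrightarrow> h i = b i\<close> that(1) by (simp add: side_def)
    then show ?thesis using odd_h[OF that] by simp
  qed
  ultimately show ?thesis using tb bb0 even_b by blast
qed

end

subsection \<open>Octagons in the plane\<close>

definition emb :: "real \<Rightarrow> cell \<Rightarrow> point" where
  "emb \<epsilon> p = (\<epsilon> * of_int (fst p), \<epsilon> * of_int (snd p))"

definition nrm :: "nat \<Rightarrow> point" where
  "nrm i = [(1, 0), (1, 1), (0, 1), (-1, 1), (-1, 0), (-1, -1), (0, -1), (1, -1)] ! i"

definition octagon_of :: "real \<Rightarrow> (nat \<Rightarrow> int) \<Rightarrow> point set" where
  "octagon_of \<epsilon> b = {x. \<forall>i<8. nrm i \<bullet> x \<le> \<epsilon> * of_int (b i)}"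

lemma less_8_cases: "i < 8 \<longleftrightarrow> i \<in> {0, 1, 2, 3, 4, 5, 6, 7 :: nat}"
  by auto

lemma nrm_emb: "i < 8 \<Longrightarrow> nrm i \<bullet> emb \<epsilon> p = \<epsilon> * of_int (phi i p)"
  unfolding less_8_cases by (auto simp: nrm_def emb_def phi_def algebra_simps)

lemma nrm_nonzero: "i < 8 \<Longrightarrow> nrm i \<noteq> 0"
  unfolding less_8_cases by (auto simp: nrm_def zero_prod_def)

lemma lattice_pts_eq: "lattice_pts \<epsilon> = range (emb \<epsilon>)"
  by (auto simp: lattice_pts_def emb_def image_def)

lemma inj_emb: "0 < \<epsilon> \<Longrightarrow> inj (emb \<epsilon>)"
  by (auto simp: inj_def emb_def prod_eq_iff)

lemma emb_mem_octagon_of: "0 < \<epsilon> \<Longrightarrow> emb \<epsilon> p \<in> octagon_of \<epsilon> b \<longleftrightarrow> p \<in> oct b"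
  by (auto simp: octagon_of_def oct_def nrm_emb)

lemma octagon_of_lattice: "0 < \<epsilon> \<Longrightarrow> octagon_of \<epsilon> b \<inter> lattice_pts \<epsilon> = emb \<epsilon> ` oct b"
  unfolding lattice_pts_eq using emb_mem_octagon_of by auto

text \<open>Each of the four edge directions has two opposite normals, which gives the eight
  \<open>nrm i\<close>; the positive factor preserves the sense of an inequality.\<close>

lemma normal_eq_nrm:
  assumes d: "d \<in> {(1, 0), (0, 1), (1, 1), (1, -1 :: real)}" and a: "a \<noteq> 0" "a \<bullet> d = 0"
  shows "\<exists>i<8. \<exists>c>0. a = c *\<^sub>R nrm i"
proof -
  obtain p q where pq: "a = (p, q)" by force
  have wit: "\<exists>i<8. \<exists>c>0. a = c *\<^sub>R nrm i" if "i < 8" "0 < c" "a = c *\<^sub>R nrm i" for i c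
    using that by blast
  consider "d = (1, 0)" | "d = (0, 1)" | "d = (1, 1)" | "d = (1, -1)" using d by blast
  then show ?thesis
  proof cases
    case 1
    then have "p = 0" "q \<noteq> 0" using a by (auto simp: pq zero_prod_def)
    then show ?thesis using wit[of 2 q] wit[of 6 "- q"] by (cases "0 < q") (auto simp: pq nrm_def)
  next
    case 2
    then have "q = 0" "p \<noteq> 0" using a by (auto simp: pq zero_prod_def)
    then show ?thesis using wit[of 0 p] wit[of 4 "- p"] by (cases "0 < p") (auto simp: pq nrm_def)
  next
    case 3
    then have "q = - p" "p \<noteq> 0" using a by (auto simp: pq zero_prod_def)
    then show ?thesis using wit[of 7 p] wit[of 3 "- p"] by (cases "0 < p") (auto simp: pq nrm_def)
  next
    case 4
    then have "q = p" "p \<noteq> 0" using a by (auto simp: pq zero_prod_def)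
    then show ?thesis using wit[of 1 p] wit[of 5 "- p"] by (cases "0 < p") (auto simp: pq nrm_def)
  qed
qed

text \<open>An edge avoids the interior, so a point of its relative interior lies on one of the
  eight bounding lines. A linear functional that attains its maximum over the edge at such a point
  is constant on the edge, which is therefore parallel to that line.\<close>

lemma octagon_octagon_of:
  assumes \<epsilon>: "0 < \<epsilon>" and len: "\<And>i. i < 8 \<Longrightarrow> 1 \<le> side b i"
  shows "octagon (octagon_of \<epsilon> b)"
proof -
  let ?A = "octagon_of \<epsilon> b"
  let ?H = "\<lambda>i. {x. nrm i \<bullet> x \<le> \<epsilon> * of_int (b i)}"
  have A_eq: "?A = \<Inter>(?H ` {..<8})" by (auto simp: octagon_of_def)
  have poly: "polyhedron ?A"
    unfolding A_eq polyhedron_def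
  proof (intro exI[of _ "?H ` {..<8}"] conjI ballI)
    fix h assume "h \<in> ?H ` {..<8}"
    then obtain i where i: "i < 8" "h = ?H i" by auto
    show "\<exists>a b. a \<noteq> 0 \<and> h = {x. a \<bullet> x \<le> b}"
      using nrm_nonzero[OF i(1)] i(2) by (intro exI[of _ "nrm i"] exI[of _ "\<epsilon> * of_int (b i)"] conjI)
  qed simp_all
  have "?A \<subseteq> cbox (- \<epsilon> * b 4, - \<epsilon> * b 6) (\<epsilon> * b 0, \<epsilon> * b 2)"
  proof
    fix x assume "x \<in> ?A"
    then have "\<forall>i<8. nrm i \<bullet> x \<le> \<epsilon> * of_int (b i)" by (simp add: octagon_of_def)
    then show "x \<in> cbox (- \<epsilon> * b 4, - \<epsilon> * b 6) (\<epsilon> * b 0, \<epsilon> * b 2)"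
      unfolding all_less_8 by (cases x) (auto simp: nrm_def cbox_Pair_eq)
  qed
  then have pt: "polytope ?A"
    using poly bounded_subset[OF bounded_cbox] polytope_eq_bounded_polyhedron by blast
  \<comment> \<open>The centre of the bounding box satisfies all inequalities strictly since the
    sides have positive length. Hence the octagon is two-dimensional and differs from each of its
    edges.\<close>
  define z :: point where "z = (\<epsilon> * (of_int (b 0 - b 4) / 2), \<epsilon> * (of_int (b 2 - b 6) / 2))"
  have "\<forall>i<8. 1 \<le> side b i" using len by blast
  note S = this[unfolded all_less_8 side_simps]
  have "\<forall>i<8. nrm i \<bullet> z < \<epsilon> * of_int (b i)"
  proof -
    have R: "1 \<le> real_of_int (b 7) + b 1 - 2 * b 0 \<and> 1 \<le> real_of_int (b 0) + b 2 - b 1 \<and> 1 \<le> real_of_int (b 1) + b 3 - 2 * b 2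
      \<and> 1 \<le> real_of_int (b 2) + b 4 - b 3 \<and> 1 \<le> real_of_int (b 3) + b 5 - 2 * b 4 \<and> 1 \<le> real_of_int (b 4) + b 6 - b 5
      \<and> 1 \<le> real_of_int (b 5) + b 7 - 2 * b 6 \<and> 1 \<le> real_of_int (b 6) + b 0 - b 7"
      using S by linarith
    have e: "nrm i \<bullet> z = \<epsilon> * (nrm i \<bullet> (of_int (b 0 - b 4) / 2, of_int (b 2 - b 6) / 2))" for i
    proof -
      have "z = \<epsilon> *\<^sub>R (of_int (b 0 - b 4) / 2, of_int (b 2 - b 6) / 2)" by (simp add: z_def)
      then show ?thesis by (simp only: inner_scaleR_right)
    qed
    have "\<forall>i<8. nrm i \<bullet> (of_int (b 0 - b 4) / 2, of_int (b 2 - b 6) / 2) < of_int (b i)"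
      unfolding all_less_8 using R by (simp add: nrm_def field_simps)
    then show ?thesis unfolding e using \<epsilon> by simp
  qed
  moreover have interior_I: "x \<in> interior ?A" if "\<forall>i<8. nrm i \<bullet> x < \<epsilon> * of_int (b i)" for x
  proof (rule interiorI[of "\<Inter>((\<lambda>i. {x. nrm i \<bullet> x < \<epsilon> * of_int (b i)}) ` {..<8})"])
    show "open (\<Inter>((\<lambda>i. {x. nrm i \<bullet> x < \<epsilon> * of_int (b i)}) ` {..<8}))"
      by (intro open_INT) (auto intro: open_halfspace_lt)
  qed (use that in \<open>auto simp: octagon_of_def intro: less_imp_le\<close>)
  ultimately have zi: "z \<in> interior ?A" by blast
  then have "affine hull ?A = UNIV" using affine_hull_nonempty_interior by blast
  then have dim: "aff_dim ?A = 2"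
    using aff_dim_affine_hull[of ?A] aff_dim_UNIV[where 'n = point] by simp
  have "\<exists>d\<in>{(1, 0), (0, 1), (1, 1), (1, -1)}. \<forall>x\<in>S. \<forall>y\<in>S. \<exists>t::real. y - x = t *\<^sub>R d" if S: "S edge_of ?A" for S
  proof -
    have face: "S face_of ?A" and S1: "aff_dim S = 1" using S by (auto simp: edge_of_def)
    have cS: "convex S" using face by (rule face_of_imp_convex)
    have SA: "S \<subseteq> ?A" using face by (rule face_of_imp_subset)
    have "S \<noteq> {}" using S1 by auto
    then have "rel_interior S \<noteq> {}" using rel_interior_eq_empty[OF cS] by simp
    then obtain x where x: "x \<in> rel_interior S" by blast
    have xS: "x \<in> S" using x rel_interior_subset by blast
    have "S \<noteq> ?A" using S1 dim by auto
    then have "x \<notin> interior ?A" using face_of_disjoint_interior[OF face] xS by blast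
    then obtain i where i: "i < 8" "\<epsilon> * of_int (b i) \<le> nrm i \<bullet> x" using interior_I not_le by blast
    have le: "nrm i \<bullet> y \<le> \<epsilon> * of_int (b i)" if "y \<in> S" for y
      using SA that i(1) by (auto simp: octagon_of_def)
    have eq: "nrm i \<bullet> y = nrm i \<bullet> x" if y: "y \<in> S" for y
    proof -
      \<comment> \<open>The segment from \<open>y\<close> through a relative interior point can be
        prolonged within \<open>S\<close>; if \<open>y\<close> were lower than \<open>x\<close>, the
        prolongation would exceed the bound.\<close>
      obtain e where e: "1 < e" "(1 - e) *\<^sub>R y + e *\<^sub>R x \<in> S"
        using x y convex_rel_interior_iff[OF cS \<open>S \<noteq> {}\<close>] by blast
      have "(1 - e) * (nrm i \<bullet> y) + e * (nrm i \<bullet> x) \<le> \<epsilon> * of_int (b i)"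
        using le[OF e(2)] by (simp add: inner_add_right)
      then have "(e - 1) * (nrm i \<bullet> x) \<le> (e - 1) * (nrm i \<bullet> y)" using i(2) by (simp add: algebra_simps)
      then have "nrm i \<bullet> x \<le> nrm i \<bullet> y" using e(1) by simp
      then show ?thesis using le[OF y] i(2) by linarith
    qed
    have "\<exists>d\<in>{(1, 0), (0, 1), (1, 1), (1, -1)}. \<forall>v. nrm i \<bullet> v = 0 \<longrightarrow> (\<exists>t::real. v = t *\<^sub>R d)"
    proof -
      have w: "\<exists>t::real. v = t *\<^sub>R d" if "snd d * fst v = fst d * snd v" "fst d = 1 \<or> fst d = 0 \<and> snd d = 1" for v d :: point
      proof (cases "fst d = 1")
        case True
        then have "v = fst v *\<^sub>R d" using that by (cases v, cases d) (auto simp: mult.commute)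
        then show ?thesis by blast
      next
        case False
        then have "v = snd v *\<^sub>R d" using that by (cases v, cases d) auto
        then show ?thesis by blast
      qed
      consider "i = 0 \<or> i = 4" | "i = 1 \<or> i = 5" | "i = 2 \<or> i = 6" | "i = 3 \<or> i = 7"
        using i(1) unfolding less_8_cases by auto
      then show ?thesis
      proof cases
        case 1 then show ?thesis by (intro bexI[of _ "(0, 1)"] allI impI w) (auto simp: nrm_def)
      next
        case 2 then show ?thesis by (intro bexI[of _ "(1, -1)"] allI impI w) (auto simp: nrm_def)
      next
        case 3 then show ?thesis by (intro bexI[of _ "(1, 0)"] allI impI w) (auto simp: nrm_def)
      next
        case 4 then show ?thesis by (intro bexI[of _ "(1, 1)"] allI impI w) (auto simp: nrm_def)
      qed
    qed
    then obtain d where d: "d \<in> {(1, 0), (0, 1), (1, 1), (1, -1)}" "\<And>v. nrm i \<bullet> v = 0 \<Longrightarrow> \<exists>t::real. v = t *\<^sub>R d"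
      by blast
    have "\<exists>t::real. y - x' = t *\<^sub>R d" if "x' \<in> S" "y \<in> S" for x' y
      using d(2)[of "y - x'"] eq that by (simp add: inner_diff_right)
    then show ?thesis using d(1) by blast
  qed
  moreover have "?A \<noteq> {}" using zi interior_subset by blast
  ultimately show ?thesis unfolding octagon_def using pt by blast
qed

lemma tight_Max:
  assumes fin: "finite J" "J \<noteq> {}" and b: "\<And>i. b i = Max (phi i ` J)"
  shows "tight b"
  unfolding tight_def
proof (intro allI impI)
  fix i :: nat assume i: "i < 8"
  have "b i \<in> phi i ` J" unfolding b using fin by (intro Max_in) auto
  then obtain p where p: "b i = phi i p" "p \<in> J" by (rule imageE)
  have "phi j p \<le> b j" for j unfolding b using fin p(2) by (intro Max_ge) auto
  then show "0 \<le> side b i"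
    using side_phi[OF i, of p] p(1) unfolding side_def
    by (smt (verit, best))
qed

text \<open>A lattice point outside \<open>A\<close> violates the inequality of some facet. Facets
  of a two-dimensional polygon are edges, so the normal is a positive multiple of some
  \<open>nrm i\<close>, and the point exceeds the maximal height of the lattice points of
  \<open>A\<close> in that direction. The two pairs of points in \<open>I\<close> guarantee
  dimension two.\<close>

lemma octagon_imp_oct:
  assumes \<epsilon>: "0 < \<epsilon>" and A: "octagon A" and I: "I = A \<inter> lattice_pts \<epsilon>"
    and h: "x1 \<in> I" "x2 \<in> I" "snd x1 = snd x2" "fst x1 \<noteq> fst x2"
    and v: "y1 \<in> I" "y2 \<in> I" "fst y1 = fst y2" "snd y1 \<noteq> snd y2"
  shows "\<exists>b. tight b \<and> I = emb \<epsilon> ` oct b"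
proof -
  have pA: "polytope A" and edges: "\<And>S. S edge_of A \<Longrightarrow>
        \<exists>d\<in>{(1, 0), (0, 1), (1, 1), (1, -1)}. \<forall>x\<in>S. \<forall>y\<in>S. \<exists>t::real. y - x = t *\<^sub>R d"
    using A by (auto simp: octagon_def)
  define J where "J = {p. emb \<epsilon> p \<in> A}"
  have IJ: "I = emb \<epsilon> ` J" unfolding I J_def lattice_pts_eq by auto
  have finJ: "finite J"
  proof -
    obtain R where R: "\<And>x. x \<in> A \<Longrightarrow> norm x \<le> R"
      using polytope_imp_bounded[OF pA] unfolding bounded_iff by blast
    have "J \<subseteq> {-\<lceil>R / \<epsilon>\<rceil>..\<lceil>R / \<epsilon>\<rceil>} \<times> {-\<lceil>R / \<epsilon>\<rceil>..\<lceil>R / \<epsilon>\<rceil>}"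
    proof
      fix p assume "p \<in> J"
      then have n: "norm (emb \<epsilon> p) \<le> R" using R by (simp add: J_def)
      have "norm (fst (emb \<epsilon> p)) \<le> R" "norm (snd (emb \<epsilon> p)) \<le> R"
        using norm_fst_le[of "fst (emb \<epsilon> p)" "snd (emb \<epsilon> p)"] norm_snd_le[of "snd (emb \<epsilon> p)" "fst (emb \<epsilon> p)"] n by simp_all
      then have "\<epsilon> * \<bar>real_of_int (fst p)\<bar> \<le> R" "\<epsilon> * \<bar>real_of_int (snd p)\<bar> \<le> R"
        using \<epsilon> by (simp_all add: emb_def abs_mult)
      then have "\<bar>real_of_int (fst p)\<bar> \<le> R / \<epsilon>" "\<bar>real_of_int (snd p)\<bar> \<le> R / \<epsilon>"
        using \<epsilon> by (simp_all add: field_simps)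
      then have "real_of_int \<bar>fst p\<bar> \<le> real_of_int \<lceil>R / \<epsilon>\<rceil>" "real_of_int \<bar>snd p\<bar> \<le> real_of_int \<lceil>R / \<epsilon>\<rceil>"
        using le_of_int_ceiling[of "R / \<epsilon>"] unfolding of_int_abs by linarith+
      then have "\<bar>fst p\<bar> \<le> \<lceil>R / \<epsilon>\<rceil>" "\<bar>snd p\<bar> \<le> \<lceil>R / \<epsilon>\<rceil>" by (simp_all only: of_int_le_iff)
      then show "p \<in> {-\<lceil>R / \<epsilon>\<rceil>..\<lceil>R / \<epsilon>\<rceil>} \<times> {-\<lceil>R / \<epsilon>\<rceil>..\<lceil>R / \<epsilon>\<rceil>}" by (cases p) auto
    qed
    then show ?thesis by (rule finite_subset) auto
  qed
  have J_ne: "J \<noteq> {}" using h(1) IJ by auto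
  have dim: "aff_dim A = 2"
  proof (rule antisym)
    show "aff_dim A \<le> 2" using aff_dim_le_DIM[of A] by simp
    show "2 \<le> aff_dim A"
    proof (rule ccontr)
      assume "\<not> 2 \<le> aff_dim A"
      then have "aff_dim A < DIM(point)" by simp
      then obtain a c where a: "a \<noteq> 0" "A \<subseteq> {x. a \<bullet> x = c}" by (rule aff_lowdim_subset_hyperplane)
      have "a \<bullet> x1 = a \<bullet> x2" "a \<bullet> y1 = a \<bullet> y2" using a(2) h v I by auto
      then have "fst a * (fst x1 - fst x2) = 0" "snd a * (snd y1 - snd y2) = 0"
        using h(3) v(3) by (simp_all add: inner_prod_def algebra_simps)
      then have "fst a = 0" "snd a = 0" using h(4) v(4) by simp_all
      then show False using a(1) by (simp add: prod_eq_iff)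
    qed
  qed
  define b where "b i = Max (phi i ` J)" for i
  have tb: "tight b" by (rule tight_Max[OF finJ J_ne b_def])
  have J_oct: "J \<subseteq> oct b" unfolding oct_def b_def using finJ by (auto intro!: Max_ge)
  have "oct b \<subseteq> J"
  proof
    fix p assume p: "p \<in> oct b"
    show "p \<in> J"
    proof (rule ccontr)
      assume "p \<notin> J"
      then have pn: "emb \<epsilon> p \<notin> A" by (simp add: J_def)
      \<comment> \<open>An irredundant family of half planes, so that each of them comes from a
        facet.\<close>
      obtain F where F: "finite F" "A = affine hull A \<inter> \<Inter>F" "\<forall>h\<in>F. \<exists>a b. a \<noteq> 0 \<and> h = {x. a \<bullet> x \<le> b}"
        "\<forall>F'. F' \<subset> F \<longrightarrow> A \<subset> affine hull A \<inter> \<Inter>F'"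
        using polytope_imp_polyhedron[OF pA] unfolding polyhedron_Int_affine_minimal by blast
      obtain a c where ac: "\<And>h. h \<in> F \<Longrightarrow> a h \<noteq> 0 \<and> h = {x. a h \<bullet> x \<le> c h}"
        using F(3) by metis
      have "aff_dim A = int DIM(point)" using dim by simp
      then have "affine hull A = UNIV" using aff_dim_eq_full by blast
      then obtain h where h: "h \<in> F" "emb \<epsilon> p \<notin> h" using F(2) pn by blast
      have h_eq: "h = {x. a h \<bullet> x \<le> c h}" using ac[OF h(1)] by blast
      have viol: "c h < a h \<bullet> emb \<epsilon> p"
      proof (rule ccontr)
        assume "\<not> c h < a h \<bullet> emb \<epsilon> p"
        then have "emb \<epsilon> p \<in> {x. a h \<bullet> x \<le> c h}" by simp
        then show False using h(2) h_eq by blast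
      qed
      define S where "S = A \<inter> {x. a h \<bullet> x = c h}"
      have "S facet_of A"
        using facet_of_polyhedron_explicit[OF F(1,2) ac, of S] F(4) h(1) unfolding S_def by blast
      then have "S edge_of A" "aff_dim S = 1" using dim by (auto simp: facet_of_def edge_of_def)
      then obtain d where d: "d \<in> {(1, 0), (0, 1), (1, 1), (1, -1)}" "\<forall>x\<in>S. \<forall>y\<in>S. \<exists>t::real. y - x = t *\<^sub>R d"
        using edges by blast
      have "\<exists>x\<in>S. \<exists>y\<in>S. x \<noteq> y"
      proof (rule ccontr)
        assume "\<not> ?thesis"
        then have "S = {} \<or> (\<exists>x. S = {x})" by blast
        then show False using \<open>aff_dim S = 1\<close> by auto
      qed
      then obtain x y where xy: "x \<in> S" "y \<in> S" "x \<noteq> y" by blast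
      then obtain t where t: "y - x = t *\<^sub>R d" using d(2) by blast
      have "a h \<bullet> (y - x) = 0" using xy by (simp add: S_def inner_diff_right)
      moreover have "t \<noteq> 0" using t xy(3) by auto
      ultimately have "a h \<bullet> d = 0" unfolding t by simp
      then obtain i r where ir: "i < 8" "0 < r" "a h = r *\<^sub>R nrm i"
        using normal_eq_nrm[OF d(1)] ac[OF h(1)] by blast
      have "b i \<in> phi i ` J" unfolding b_def using finJ J_ne by (intro Max_in) auto
      then obtain q where q: "b i = phi i q" "q \<in> J" by (rule imageE)
      have "emb \<epsilon> q \<in> h" using q(2) F(2) h(1) by (auto simp: J_def)
      then have "emb \<epsilon> q \<in> {x. a h \<bullet> x \<le> c h}" using h_eq by blast
      then have "r * (nrm i \<bullet> emb \<epsilon> q) \<le> c h" unfolding ir(3) by simp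
      then have "r * (\<epsilon> * of_int (phi i q)) \<le> c h" unfolding nrm_emb[OF ir(1)] .
      moreover have "r * (\<epsilon> * of_int (phi i p)) \<le> r * (\<epsilon> * of_int (phi i q))"
        using p q(1) ir \<epsilon> by (auto simp: oct_def)
      moreover have "c h < r * (\<epsilon> * of_int (phi i p))"
        using viol unfolding ir(3) inner_scaleR_left nrm_emb[OF ir(1)] .
      ultimately show False by linarith
    qed
  qed
  then have "J = oct b" using J_oct by blast
  then show ?thesis using tb IJ by blast
qed

lemma Collect_image: "{y \<in> f ` A. P y} = f ` {x \<in> A. P (f x)}"
  by auto

lemma card_extreme_slice:
  assumes "i < 8" "even i" "tight b"
  shows "int (card {p \<in> oct b. phi i p = b i}) \<le> side b i + 1"
proof -
  have *: "int (card S) \<le> hi - lo + 1" if "f ` S \<subseteq> {lo..hi}" "inj_on f S" "lo \<le> hi + 1" for S :: "cell set" and f :: "cell \<Rightarrow> int" and lo hi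
  proof -
    have "card S = card (f ` S)" using that(2) by (simp add: card_image)
    also have "\<dots> \<le> card {lo..hi}" using that(1) by (intro card_mono) auto
    finally show ?thesis using that(3) by simp
  qed
  note T = assms(3)[unfolded tight_iff]
  have "i \<in> {0, 2, 4, 6}" using assms(1,2) by auto
  moreover have "int (card {p \<in> oct b. phi 0 p = b 0}) \<le> (b 1 - b 0) - (b 0 - b 7) + 1"
    by (rule *[of snd]) (use T in \<open>auto simp: oct_iff phi_def inj_on_def\<close>)
  moreover have "int (card {p \<in> oct b. phi 2 p = b 2}) \<le> (b 1 - b 2) - (b 2 - b 3) + 1"
    by (rule *[of fst]) (use T in \<open>auto simp: oct_iff phi_def inj_on_def\<close>)
  moreover have "int (card {p \<in> oct b. phi 4 p = b 4}) \<le> (b 3 - b 4) - (b 4 - b 5) + 1"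
    by (rule *[of snd]) (use T in \<open>auto simp: oct_iff phi_def inj_on_def\<close>)
  moreover have "int (card {p \<in> oct b. phi 6 p = b 6}) \<le> (b 7 - b 6) - (b 6 - b 5) + 1"
    by (rule *[of fst]) (use T in \<open>auto simp: oct_iff phi_def inj_on_def\<close>)
  ultimately show ?thesis by (auto simp: side_simps)
qed

text \<open>The external slices are the lattice points on the flat sides, so assumption (H) bounds
  the flat sides from below and says nothing about the diagonal ones.\<close>

lemma external_slices_emb:
  assumes \<epsilon>: "0 < \<epsilon>" and t: "tight b" and c: "\<forall>P\<in>set (external_slices (emb \<epsilon> ` oct b)). c \<le> real (card P)"
    and i: "i < 8" "even i"
  shows "c \<le> real_of_int (side b i) + 1"
proof -
  have sl: "{P \<in> emb \<epsilon> ` oct b. \<forall>q\<in>emb \<epsilon> ` oct b. nrm i \<bullet> q \<le> nrm i \<bullet> P} = emb \<epsilon> ` {p \<in> oct b. phi i p = b i}"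
  proof -
    obtain p0 where p0: "p0 \<in> oct b" "phi i p0 = b i" using tight_attained[OF t i(1)] by blast
    have "(\<forall>q\<in>oct b. phi i q \<le> phi i p) \<longleftrightarrow> phi i p = b i" if "p \<in> oct b" for p
    proof
      assume "\<forall>q\<in>oct b. phi i q \<le> phi i p"
      then have "b i \<le> phi i p" using p0 by auto
      then show "phi i p = b i" using that i(1) by (auto simp: oct_def intro: antisym)
    qed (use i(1) in \<open>auto simp: oct_def\<close>)
    then have "(\<forall>q\<in>emb \<epsilon> ` oct b. nrm i \<bullet> q \<le> nrm i \<bullet> emb \<epsilon> p) \<longleftrightarrow> phi i p = b i" if "p \<in> oct b" for p
      using that \<epsilon> by (simp add: nrm_emb[OF i(1)])
    then have "{p \<in> oct b. \<forall>q\<in>emb \<epsilon> ` oct b. nrm i \<bullet> q \<le> nrm i \<bullet> emb \<epsilon> p} = {p \<in> oct b. phi i p = b i}"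
      by (intro Collect_cong conj_cong refl)
    then show ?thesis unfolding Collect_image by simp
  qed
  have "emb \<epsilon> ` {p \<in> oct b. phi i p = b i} \<in> set (external_slices (emb \<epsilon> ` oct b))"
  proof -
    have "i \<in> {0, 2, 4, 6}" using i by auto
    moreover have "nrm 0 \<bullet> P = fst P" "nrm 2 \<bullet> P = snd P" "nrm 4 \<bullet> P = - fst P" "nrm 6 \<bullet> P = - snd P" for P
      by (cases P; simp add: nrm_def)+
    ultimately show ?thesis
      unfolding sl[symmetric] external_slices_def by (elim insertE) simp_all
  qed
  then have "c \<le> real (card (emb \<epsilon> ` {p \<in> oct b. phi i p = b i}))" using c by blast
  also have "card (emb \<epsilon> ` {p \<in> oct b. phi i p = b i}) = card {p \<in> oct b. phi i p = b i}"
    using inj_emb[OF \<epsilon>] by (intro card_image) (auto intro: inj_on_subset)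
  finally show ?thesis using card_extreme_slice[OF i t] by linarith
qed

lemma l1norm_emb: "0 < \<epsilon> \<Longrightarrow> l1norm (emb \<epsilon> p - emb \<epsilon> q) = \<epsilon> * of_int (\<bar>fst p - fst q\<bar> + \<bar>snd p - snd q\<bar>)"
  by (simp add: l1norm_def emb_def abs_mult distrib_left flip: right_diff_distrib)

text \<open>A zero exceeds some height by exactly one. A violated flat height is repaired by
  stepping back along its axis; if only a diagonal height is violated, two steps repair it, and
  since the sides have positive length one of them stays within the other constraints.\<close>

lemma zero_neighbour:
  assumes "tight b" "\<And>i. i < 8 \<Longrightarrow> 1 \<le> side b i" "cfg b p = 0"
  shows "\<exists>q\<in>oct b. \<bar>fst p - fst q\<bar> + \<bar>snd p - snd q\<bar> = 1"
proof -
  obtain x y where p: "p = (x, y)" by force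
  have "\<forall>i<8. 1 \<le> side b i" using assms(2) by blast
  note S = this[unfolded all_less_8 side_simps]
  have m: "(x, y) \<in> oct (\<lambda>i. b i + 1)" "(x, y) \<notin> oct b"
    using assms(3) by (auto simp: cfg_def p split: if_splits)
  have "(x - 1, y) \<in> oct b \<or> (x + 1, y) \<in> oct b \<or> (x, y - 1) \<in> oct b \<or> (x, y + 1) \<in> oct b"
  proof (rule ccontr)
    assume n: "\<not> ?thesis"
    consider "x = b 0 + 1" | "y = b 2 + 1" | "- x = b 4 + 1" | "- y = b 6 + 1"
      | "x \<le> b 0" "y \<le> b 2" "- x \<le> b 4" "- y \<le> b 6"
      using m(1) by (force simp: oct_iff)
    then show False
    proof cases
      case 1 then have "(x - 1, y) \<in> oct b" using m(1) S by (simp add: oct_iff)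
      then show False using n by blast
    next
      case 2 then have "(x, y - 1) \<in> oct b" using m(1) S by (simp add: oct_iff)
      then show False using n by blast
    next
      case 3 then have "(x + 1, y) \<in> oct b" using m(1) S by (simp add: oct_iff)
      then show False using n by blast
    next
      case 4 then have "(x, y + 1) \<in> oct b" using m(1) S by (simp add: oct_iff)
      then show False using n by blast
    next
      case 5
      then consider "x + y = b 1 + 1" | "y - x = b 3 + 1" | "- x - y = b 5 + 1" | "x - y = b 7 + 1"
        using m by (force simp: oct_iff)
      then show False
      proof cases
        case 1
        then have "(x - 1, y) \<in> oct b \<or> (x, y - 1) \<in> oct b" using m(1) S 5 by (auto simp: oct_iff)
        then show False using n by blast
      next
        case 2
        then have "(x + 1, y) \<in> oct b \<or> (x, y - 1) \<in> oct b" using m(1) S 5 by (auto simp: oct_iff)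
        then show False using n by blast
      next
        case 3
        then have "(x + 1, y) \<in> oct b \<or> (x, y + 1) \<in> oct b" using m(1) S 5 by (auto simp: oct_iff)
        then show False using n by blast
      next
        case 4
        then have "(x - 1, y) \<in> oct b \<or> (x, y + 1) \<in> oct b" using m(1) S 5 by (auto simp: oct_iff)
        then show False using n by blast
      qed
    qed
  qed
  then show ?thesis by (auto simp: p intro: bexI[rotated])
qed

text \<open>Distances are multiples of \<open>\<epsilon>\<close>, so distance
  \<open>\<epsilon>\<close> means a nearest neighbour in the octagon; one lattice step raises each
  height by at most one and thus ends in the ring of zeros.\<close>

lemma outer_bdry_emb:
  assumes \<epsilon>: "0 < \<epsilon>" and t: "tight b" "\<And>i. i < 8 \<Longrightarrow> 1 \<le> side b i"
  shows "outer_bdry \<epsilon> (emb \<epsilon> ` oct b) = emb \<epsilon> ` {p. cfg b p = 0}"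
proof -
  have inj: "emb \<epsilon> p \<in> emb \<epsilon> ` oct b \<longleftrightarrow> p \<in> oct b" for p
    using inj_emb[OF \<epsilon>] by (simp add: inj_image_mem_iff)
  have key: "dist_bdry \<epsilon> (emb \<epsilon> p) (emb \<epsilon> ` oct b) = ennreal \<epsilon> \<longleftrightarrow> cfg b p = 0" if p: "p \<notin> oct b" for p
  proof -
    let ?n = "\<lambda>q. \<bar>fst p - fst q\<bar> + \<bar>snd p - snd q\<bar>"
    have d: "dist_bdry \<epsilon> (emb \<epsilon> p) (emb \<epsilon> ` oct b) = (INF q\<in>oct b. ennreal (\<epsilon> * of_int (?n q)))"
      using p inj unfolding dist_bdry_def by (simp add: l1norm_emb[OF \<epsilon>] image_comp)
    have n1: "1 \<le> ?n q" if "q \<in> oct b" for q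
    proof -
      have "p \<noteq> q" using p that by auto
      then show ?thesis by (cases p; cases q) auto
    qed
    show ?thesis
    proof
      assume "cfg b p = 0"
      then obtain q where q: "q \<in> oct b" "?n q = 1" using zero_neighbour[OF t] by blast
      have "(INF q\<in>oct b. ennreal (\<epsilon> * of_int (?n q))) \<le> ennreal \<epsilon>"
        by (rule INF_lower2[OF q(1)]) (simp add: q(2))
      moreover have "ennreal \<epsilon> \<le> (INF q\<in>oct b. ennreal (\<epsilon> * of_int (?n q)))"
      proof (rule INF_greatest)
        fix q assume "q \<in> oct b"
        then have "real_of_int 1 \<le> real_of_int (?n q)" using n1 by (simp only: of_int_le_iff)
        then have "\<epsilon> * 1 \<le> \<epsilon> * of_int (?n q)" using \<epsilon> by (intro mult_left_mono) auto
        then show "ennreal \<epsilon> \<le> ennreal (\<epsilon> * of_int (?n q))" by (intro ennreal_leI) simp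
      qed
      ultimately show "dist_bdry \<epsilon> (emb \<epsilon> p) (emb \<epsilon> ` oct b) = ennreal \<epsilon>" unfolding d by (rule antisym)
    next
      assume "dist_bdry \<epsilon> (emb \<epsilon> p) (emb \<epsilon> ` oct b) = ennreal \<epsilon>"
      then have "(INF q\<in>oct b. ennreal (\<epsilon> * of_int (?n q))) < ennreal (\<epsilon> * 2)"
        unfolding d using \<epsilon> by (simp add: ennreal_less_iff)
      then obtain q where q: "q \<in> oct b" "ennreal (\<epsilon> * of_int (?n q)) < ennreal (\<epsilon> * 2)"
        by (auto simp: INF_less_iff)
      then have "\<epsilon> * of_int (?n q) < \<epsilon> * 2" using \<epsilon> by (subst (asm) ennreal_less_iff) auto
      then have "real_of_int (?n q) < 2" using \<epsilon> by simp
      then have "?n q \<le> 1" by linarith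
      then have "p \<in> oct (\<lambda>i. b i + 1)" using q(1) by (cases p; cases q) (auto simp: oct_iff)
      then show "cfg b p = 0" using p by (simp add: cfg_def)
    qed
  qed
  have "outer_bdry \<epsilon> (emb \<epsilon> ` oct b) = emb \<epsilon> ` {p. p \<notin> oct b \<and> dist_bdry \<epsilon> (emb \<epsilon> p) (emb \<epsilon> ` oct b) = ennreal \<epsilon>}"
  proof -
    have "lattice_pts \<epsilon> - emb \<epsilon> ` oct b = emb \<epsilon> ` (- oct b)"
      unfolding lattice_pts_eq using image_set_diff[OF inj_emb[OF \<epsilon>], of UNIV "oct b"] by (simp add: Compl_eq_Diff_UNIV)
    then show ?thesis unfolding outer_bdry_def by (simp add: Collect_image)
  qed
  also have "{p. p \<notin> oct b \<and> dist_bdry \<epsilon> (emb \<epsilon> p) (emb \<epsilon> ` oct b) = ennreal \<epsilon>} = {p. cfg b p = 0}"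
    using key by (auto simp: cfg_eq_1_iff[symmetric])
  finally show ?thesis .
qed

subsection \<open>The functional in lattice units\<close>

definition cell_of :: "real \<Rightarrow> point \<Rightarrow> cell" where
  "cell_of \<epsilon> x = (\<lfloor>fst x / \<epsilon>\<rfloor>, \<lfloor>snd x / \<epsilon>\<rfloor>)"

text \<open>The restriction yields the extensional functions that \<open>admissible\<close> asks
  for.\<close>

definition lift :: "real \<Rightarrow> (cell \<Rightarrow> int) \<Rightarrow> point \<Rightarrow> real" where
  "lift \<epsilon> v = restrict (\<lambda>x. of_int (v (cell_of \<epsilon> x))) (lattice_pts \<epsilon>)"

lemma cell_of_emb: "0 < \<epsilon> \<Longrightarrow> cell_of \<epsilon> (emb \<epsilon> p) = p"
  by (simp add: cell_of_def emb_def)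

lemma lift_emb: "0 < \<epsilon> \<Longrightarrow> lift \<epsilon> v (emb \<epsilon> p) = of_int (v p)"
  by (simp add: lift_def lattice_pts_eq cell_of_emb)

lemma level_lift: "0 < \<epsilon> \<Longrightarrow> {x \<in> lattice_pts \<epsilon>. lift \<epsilon> v x = of_int c} = emb \<epsilon> ` {p. v p = c}"
  unfolding lattice_pts_eq Collect_image by (simp add: lift_emb)

lemma ones_lift: "0 < \<epsilon> \<Longrightarrow> ones \<epsilon> (lift \<epsilon> v) = emb \<epsilon> ` {p. v p = 1}"
  using level_lift[of \<epsilon> v 1] by (simp add: ones_def)

lemma zeros_lift: "0 < \<epsilon> \<Longrightarrow> zeros \<epsilon> (lift \<epsilon> v) = emb \<epsilon> ` {p. v p = 0}"
  using level_lift[of \<epsilon> v 0] by (simp add: zeros_def)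

lemma card_emb: "0 < \<epsilon> \<Longrightarrow> card (emb \<epsilon> ` S) = card S"
  by (rule card_image) (rule inj_on_subset[OF inj_emb subset_UNIV])

lemma lift_admissible:
  assumes "0 < \<epsilon>" "\<And>p. v p \<in> {-1, 0, 1}" "finite {p. v p = 0}"
  shows "lift \<epsilon> v \<in> admissible \<epsilon>"
proof -
  have "lift \<epsilon> v x \<in> {-1, 0, 1}" if "x \<in> lattice_pts \<epsilon>" for x
    using assms(2)[of "cell_of \<epsilon> x"] that by (auto simp: lift_def)
  moreover have "lift \<epsilon> v x = undefined" if "x \<notin> lattice_pts \<epsilon>" for x
    using that by (simp add: lift_def)
  ultimately show ?thesis
    unfolding admissible_def using assms(1,3) by (auto simp: zeros_lift PiE_iff extensional_def)
qed

lemma admissible_imp_lift: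
  assumes "0 < \<epsilon>" "u \<in> admissible \<epsilon>"
  obtains v where "u = lift \<epsilon> v" "\<And>p. v p \<in> {-1, 0, 1}" "finite {p. v p = 0}"
proof -
  define v where "v p = (if u (emb \<epsilon> p) = 1 then 1 else if u (emb \<epsilon> p) = 0 then 0 else (-1 :: int))" for p
  have u: "u x \<in> {-1, 0, 1}" if "x \<in> lattice_pts \<epsilon>" for x
    using assms(2) that unfolding admissible_def by (auto dest: PiE_mem)
  have "u = lift \<epsilon> v"
  proof
    fix x
    show "u x = lift \<epsilon> v x"
    proof (cases "x \<in> lattice_pts \<epsilon>")
      case True
      then obtain p where "x = emb \<epsilon> p" unfolding lattice_pts_eq by blast
      then show ?thesis using u[OF True] assms(1) by (auto simp: lift_emb v_def)
    next
      case False
      have "u \<in> lattice_pts \<epsilon> \<rightarrow>\<^sub>E {-1, 0, 1}" using assms(2) by (simp add: admissible_def)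
      then show ?thesis using False PiE_arb by (simp add: lift_def) fastforce
    qed
  qed
  moreover from this have "finite (emb \<epsilon> ` {p. v p = 0})"
    using assms by (auto simp: admissible_def zeros_lift)
  then have "finite {p. v p = 0}"
    using inj_emb[OF assms(1)] by (meson finite_imageD inj_on_subset subset_UNIV)
  ultimately show thesis using that by (auto simp: v_def)
qed

text \<open>A lower or left end together with one of the two positive directions names each
  unordered bond exactly once.\<close>

definition bond :: "real \<Rightarrow> cell \<times> cell \<Rightarrow> point set" where
  "bond \<epsilon> pe = {emb \<epsilon> (fst pe), emb \<epsilon> (fst pe + snd pe)}"

lemma bonds_eq:
  assumes \<epsilon>: "0 < \<epsilon>"
  shows "bonds \<epsilon> = bond \<epsilon> ` (UNIV \<times> {(1, 0), (0, 1)})"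
proof -
  have dist: "dist (emb \<epsilon> p) (emb \<epsilon> q) = \<epsilon> \<longleftrightarrow> (fst p - fst q)\<^sup>2 + (snd p - snd q)\<^sup>2 = 1" for p q
  proof -
    have "dist (emb \<epsilon> p) (emb \<epsilon> q) = \<epsilon> * sqrt (of_int ((fst p - fst q)\<^sup>2 + (snd p - snd q)\<^sup>2))"
    proof -
      have "(dist (\<epsilon> * real_of_int (fst p)) (\<epsilon> * real_of_int (fst q)))\<^sup>2 + (dist (\<epsilon> * real_of_int (snd p)) (\<epsilon> * real_of_int (snd q)))\<^sup>2
        = \<epsilon>\<^sup>2 * of_int ((fst p - fst q)\<^sup>2 + (snd p - snd q)\<^sup>2)"
        by (simp add: dist_real_def power2_eq_square algebra_simps)
      then show ?thesis
        using \<epsilon> unfolding emb_def dist_Pair_Pair by (simp add: real_sqrt_mult)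
    qed
    also have "\<dots> = \<epsilon> \<longleftrightarrow> sqrt (of_int ((fst p - fst q)\<^sup>2 + (snd p - snd q)\<^sup>2)) = 1" using \<epsilon> by simp
    also have "\<dots> \<longleftrightarrow> (fst p - fst q)\<^sup>2 + (snd p - snd q)\<^sup>2 = 1"
      unfolding real_sqrt_eq_1_iff by (simp only: of_int_eq_1_iff)
    finally show ?thesis .
  qed
  have unit: "a\<^sup>2 + b\<^sup>2 = 1 \<longleftrightarrow> (a, b) \<in> {(1, 0), (0, 1), (-1, 0), (0, -1)}" for a b :: int
  proof
    assume h: "a\<^sup>2 + b\<^sup>2 = 1"
    have "a\<^sup>2 \<le> 1" "b\<^sup>2 \<le> 1" using h zero_le_power2[of a] zero_le_power2[of b] by linarith+
    then have "\<bar>a\<bar> \<le> 1" "\<bar>b\<bar> \<le> 1" unfolding abs_square_le_1 .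
    then have "a \<in> {-1, 0, 1}" "b \<in> {-1, 0, 1}" by auto
    then show "(a, b) \<in> {(1, 0), (0, 1), (-1, 0), (0, -1)}" using h by auto
  qed auto
  show ?thesis
  proof (intro equalityI subsetI)
    fix B assume "B \<in> bonds \<epsilon>"
    then obtain p q where B: "B = {emb \<epsilon> p, emb \<epsilon> q}" "dist (emb \<epsilon> p) (emb \<epsilon> q) = \<epsilon>"
      unfolding bonds_def lattice_pts_eq by blast
    have "(fst p - fst q, snd p - snd q) \<in> {(1, 0), (0, 1), (-1, 0), (0, -1)}"
      using B(2) unfolding dist unit .
    then have "(p = q + (1, 0) \<or> p = q + (0, 1)) \<or> (q = p + (1, 0) \<or> q = p + (0, 1))"
      by (cases p; cases q) auto
    then show "B \<in> bond \<epsilon> ` (UNIV \<times> {(1, 0), (0, 1)})"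
    proof
      assume "p = q + (1, 0) \<or> p = q + (0, 1)"
      then obtain e where e: "e \<in> {(1, 0), (0, 1)}" "p = q + e" by blast
      have "B = bond \<epsilon> (q, e)" using B(1) e(2) by (simp add: bond_def insert_commute)
      then show ?thesis by (rule image_eqI) (use e(1) in simp)
    next
      assume "q = p + (1, 0) \<or> q = p + (0, 1)"
      then obtain e where e: "e \<in> {(1, 0), (0, 1)}" "q = p + e" by blast
      have "B = bond \<epsilon> (p, e)" using B(1) e(2) by (simp add: bond_def)
      then show ?thesis by (rule image_eqI) (use e(1) in simp)
    qed
  next
    fix B assume "B \<in> bond \<epsilon> ` (UNIV \<times> {(1, 0), (0, 1)})"
    then obtain pe where pe: "B = bond \<epsilon> pe" "pe \<in> UNIV \<times> {(1, 0), (0, 1)}" by (rule imageE)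
    define p e where "p = fst pe" and "e = snd pe"
    have B: "B = {emb \<epsilon> p, emb \<epsilon> (p + e)}" "e = (1, 0) \<or> e = (0, 1)"
      using pe by (auto simp: bond_def p_def e_def)
    have "dist (emb \<epsilon> p) (emb \<epsilon> (p + e)) = \<epsilon>" unfolding dist using B(2) by auto
    then show "B \<in> bonds \<epsilon>" unfolding bonds_def lattice_pts_eq using B(1) by blast
  qed
qed

lemma inj_bond: "0 < \<epsilon> \<Longrightarrow> inj_on (bond \<epsilon>) (UNIV \<times> {(1, 0), (0, 1)})"
proof (rule inj_onI)
  fix x y assume \<epsilon>: "0 < \<epsilon>" and h: "x \<in> UNIV \<times> {(1, 0), (0, 1)}" "y \<in> UNIV \<times> {(1, 0), (0, 1)}" "bond \<epsilon> x = bond \<epsilon> y"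
  then have "emb \<epsilon> (fst x) = emb \<epsilon> (fst y) \<and> emb \<epsilon> (fst x + snd x) = emb \<epsilon> (fst y + snd y)
     \<or> emb \<epsilon> (fst x) = emb \<epsilon> (fst y + snd y) \<and> emb \<epsilon> (fst x + snd x) = emb \<epsilon> (fst y)"
    unfolding bond_def doubleton_eq_iff by blast
  then have "fst x = fst y \<and> fst x + snd x = fst y + snd y \<or> fst x = fst y + snd y \<and> fst x + snd x = fst y"
    using inj_emb[OF \<epsilon>] by (auto dest: injD)
  then show "x = y" using h(1,2) by (cases x; cases y) auto
qed

lemma conf_outside: "conf N v \<Longrightarrow> N \<le> \<bar>fst p\<bar> \<or> N \<le> \<bar>snd p\<bar> \<Longrightarrow> v p = -1"
proof -
  assume v: "conf N v" and p: "N \<le> \<bar>fst p\<bar> \<or> N \<le> \<bar>snd p\<bar>"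
  have "v (fst p, snd p) \<noteq> -1 \<longrightarrow> \<bar>fst p\<bar> < N \<and> \<bar>snd p\<bar> < N" using v unfolding conf_def by blast
  then show ?thesis using p by auto
qed

text \<open>Bonds that start outside the grid join two -1s and cost nothing, so the infinite sum
  reduces to a finite one.\<close>

lemma energy_lift:
  assumes \<epsilon>: "0 < \<epsilon>" and k: "k \<le> 1" and v: "conf N v"
  shows "energy k \<epsilon> (lift \<epsilon> v) = ennreal (\<epsilon> * en (1 - k) 0 N v)"
proof -
  let ?E = "{(1, 0), (0, 1)} :: cell set"
  let ?c = "\<lambda>pe. bond_cost (1 - k) (v (fst pe)) (v (fst pe + snd pe))"
  have val: "v p = -1 \<or> v p = 0 \<or> v p = 1" for p
  proof -
    have "v p \<in> {-1, 0, 1}" using v unfolding conf_def by blast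
    then show ?thesis by blast
  qed
  have summand: "ennreal (\<epsilon> * (1 - prod (lift \<epsilon> v) (bond \<epsilon> pe) - k * (1 - (prod (lift \<epsilon> v) (bond \<epsilon> pe))\<^sup>2))) = ennreal (\<epsilon> * ?c pe)"
    if "pe \<in> UNIV \<times> ?E" for pe
  proof -
    have "fst pe \<noteq> fst pe + snd pe" using that by (cases "fst pe") (auto simp: zero_prod_def)
    then have "emb \<epsilon> (fst pe) \<noteq> emb \<epsilon> (fst pe + snd pe)" using inj_emb[OF \<epsilon>] by (auto dest: injD)
    then have "prod (lift \<epsilon> v) (bond \<epsilon> pe) = of_int (v (fst pe)) * of_int (v (fst pe + snd pe))"
      using \<epsilon> by (simp add: bond_def lift_emb)
    moreover have "1 - of_int a * of_int b - k * (1 - (of_int a * of_int b)\<^sup>2) = bond_cost (1 - k) a b"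
      if "a = -1 \<or> a = 0 \<or> a = 1" "b = -1 \<or> b = 0 \<or> b = 1" for a b
      using that by (elim disjE) (simp_all add: bond_cost_def)
    ultimately show ?thesis using val by simp
  qed
  have "energy k \<epsilon> (lift \<epsilon> v) = (\<Sum>\<^sub>\<infinity>pe\<in>UNIV \<times> ?E. ennreal (\<epsilon> * ?c pe))"
    unfolding energy_def bonds_eq[OF \<epsilon>] infsum_reindex[OF inj_bond[OF \<epsilon>]] o_def
    by (rule infsum_cong) (rule summand)
  also have "\<dots> = (\<Sum>\<^sub>\<infinity>pe\<in>grid N \<times> ?E. ennreal (\<epsilon> * ?c pe))"
  proof (rule infsum_cong_neutral)
    fix pe assume pe: "pe \<in> UNIV \<times> ?E - grid N \<times> ?E"
    obtain x y e where e: "pe = ((x, y), e)" "e = (1, 0) \<or> e = (0, 1)" "(x, y) \<notin> grid N" using pe by auto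
    have "N < \<bar>x\<bar> \<or> N < \<bar>y\<bar>" using e(3) by (auto simp: grid_def)
    then have "v (x, y) = -1" "v ((x, y) + e) = -1"
      using e(2) by (auto intro!: conf_outside[OF v])
    then show "ennreal (\<epsilon> * ?c pe) = 0" by (simp add: e(1) bond_cost_simps)
  qed auto
  also have "\<dots> = (\<Sum>pe\<in>grid N \<times> ?E. ennreal (\<epsilon> * ?c pe))"
    by (rule infsum_finite) simp
  also have "\<dots> = ennreal (\<Sum>pe\<in>grid N \<times> ?E. \<epsilon> * ?c pe)"
    using \<epsilon> k by (intro sum_ennreal mult_nonneg_nonneg bond_cost_nonneg) auto
  also have "(\<Sum>pe\<in>grid N \<times> ?E. \<epsilon> * ?c pe) = \<epsilon> * en (1 - k) 0 N v"
  proof -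
    have "(\<Sum>pe\<in>grid N \<times> ?E. ?c pe) = (\<Sum>p\<in>grid N. \<Sum>e\<in>?E. bond_cost (1 - k) (v p) (v (p + e)))"
    proof -
      have "(\<Sum>pe\<in>grid N \<times> ?E. ?c pe) = (\<Sum>(p, e)\<in>grid N \<times> ?E. bond_cost (1 - k) (v p) (v (p + e)))"
        by (rule sum.cong) auto
      also have "\<dots> = (\<Sum>p\<in>grid N. \<Sum>e\<in>?E. bond_cost (1 - k) (v p) (v (p + e)))"
        by (rule sum.cartesian_product[symmetric])
      finally show ?thesis .
    qed
    then show ?thesis
      unfolding en_def site_en_def sum_distrib_left[symmetric] by simp
  qed
  finally show ?thesis .
qed

section \<open>Distance to the boundary in lattice steps\<close>

definition dst :: "real \<Rightarrow> (nat \<Rightarrow> int) \<Rightarrow> cell \<Rightarrow> real" where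
  "dst \<epsilon> b p = enn2real (dist_bdry \<epsilon> (emb \<epsilon> p) (emb \<epsilon> ` oct b)) / \<epsilon>"

lemma phi_lipschitz: "i < 8 \<Longrightarrow> \<bar>phi i p - phi i q\<bar> \<le> \<bar>fst p - fst q\<bar> + \<bar>snd p - snd q\<bar>"
  unfolding less_8_cases by (auto simp: phi_def)

lemma phi_direction: "i < 8 \<Longrightarrow> \<exists>e. \<bar>fst e\<bar> + \<bar>snd e\<bar> = 1 \<and> (\<forall>p c. phi i (fst p + c * fst e, snd p + c * snd e) = phi i p + c)"
proof -
  assume "i < 8"
  moreover have "\<exists>e. \<bar>fst e\<bar> + \<bar>snd e\<bar> = 1 \<and> (\<forall>p c. phi i (fst p + c * fst e, snd p + c * snd e) = phi i p + c)"
    if "i \<in> {0, 1, 7}" for i using that by (intro exI[of _ "(1, 0)"]) (auto simp: phi_def)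
  moreover have "\<exists>e. \<bar>fst e\<bar> + \<bar>snd e\<bar> = 1 \<and> (\<forall>p c. phi i (fst p + c * fst e, snd p + c * snd e) = phi i p + c)"
    if "i \<in> {2, 3}" for i using that by (intro exI[of _ "(0, 1)"]) (auto simp: phi_def)
  moreover have "\<exists>e. \<bar>fst e\<bar> + \<bar>snd e\<bar> = 1 \<and> (\<forall>p c. phi i (fst p + c * fst e, snd p + c * snd e) = phi i p + c)"
    if "i \<in> {4, 5}" for i using that by (intro exI[of _ "(-1, 0)"]) (auto simp: phi_def)
  moreover have "\<exists>e. \<bar>fst e\<bar> + \<bar>snd e\<bar> = 1 \<and> (\<forall>p c. phi i (fst p + c * fst e, snd p + c * snd e) = phi i p + c)"
    if "i \<in> {6}" for i using that by (intro exI[of _ "(0, -1)"]) (auto simp: phi_def)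
  ultimately show ?thesis unfolding less_8_cases by blast
qed

text \<open>Each \<open>phi i\<close> grows by at most one per lattice step, and by exactly one
  along a suitable direction. The shortest way out is therefore a straight walk towards the side
  that realizes the minimum in \<open>dep\<close>.\<close>

lemma dist_bdry_inside:
  assumes \<epsilon>: "0 < \<epsilon>" and p: "p \<in> oct b"
  shows "dist_bdry \<epsilon> (emb \<epsilon> p) (emb \<epsilon> ` oct b) = ennreal (\<epsilon> * of_int (dep b p))"
proof -
  let ?n = "\<lambda>q. \<bar>fst p - fst q\<bar> + \<bar>snd p - snd q\<bar>"
  have inj: "emb \<epsilon> q \<in> emb \<epsilon> ` oct b \<longleftrightarrow> q \<in> oct b" for q
    using inj_emb[OF \<epsilon>] by (simp add: inj_image_mem_iff)
  have "lattice_pts \<epsilon> - emb \<epsilon> ` oct b = emb \<epsilon> ` (- oct b)"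
    unfolding lattice_pts_eq using image_set_diff[OF inj_emb[OF \<epsilon>], of UNIV "oct b"] by (simp add: Compl_eq_Diff_UNIV)
  then have d: "dist_bdry \<epsilon> (emb \<epsilon> p) (emb \<epsilon> ` oct b) = (INF q\<in>- oct b. ennreal (\<epsilon> * of_int (?n q)))"
    using p inj unfolding dist_bdry_def by (simp add: l1norm_emb[OF \<epsilon>] image_comp)
  show ?thesis
    unfolding d
  proof (rule antisym)
    have "dep b p - 1 \<in> (\<lambda>i. b i - phi i p) ` {..<8}"
      unfolding dep_def by (simp, rule Min_in) (auto simp: lessThan_empty_iff)
    then obtain i where i: "i < 8" "dep b p = b i - phi i p + 1" by auto
    obtain e where e: "\<bar>fst e\<bar> + \<bar>snd e\<bar> = 1" "\<forall>p c. phi i (fst p + c * fst e, snd p + c * snd e) = phi i p + c"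
      using phi_direction[OF i(1)] by blast
    define q where "q = (fst p + dep b p * fst e, snd p + dep b p * snd e)"
    have "phi i q = phi i p + dep b p" using e(2) by (simp add: q_def)
    then have "q \<in> - oct b" using i by (auto simp: oct_def)
    moreover have "?n q = dep b p"
    proof -
      have "?n q = \<bar>dep b p\<bar> * (\<bar>fst e\<bar> + \<bar>snd e\<bar>)" by (simp add: q_def abs_mult distrib_left)
      then show ?thesis using e(1) p by (simp add: mem_oct_iff_dep)
    qed
    ultimately show "(INF q\<in>- oct b. ennreal (\<epsilon> * of_int (?n q))) \<le> ennreal (\<epsilon> * of_int (dep b p))"
      by (intro INF_lower2[of q]) simp_all
    show "ennreal (\<epsilon> * of_int (dep b p)) \<le> (INF q\<in>- oct b. ennreal (\<epsilon> * of_int (?n q)))"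
    proof (rule INF_greatest)
      fix q assume "q \<in> - oct b"
      then obtain i where i: "i < 8" "b i < phi i q" by (auto simp: oct_def not_le)
      have "dep b p \<le> ?n q" using dep_le[OF i(1), of b p] phi_lipschitz[OF i(1), of p q] i(2) by linarith
      then have "real_of_int (dep b p) \<le> real_of_int (?n q)" by (simp only: of_int_le_iff)
      then show "ennreal (\<epsilon> * of_int (dep b p)) \<le> ennreal (\<epsilon> * of_int (?n q))"
        using \<epsilon> by (intro ennreal_leI mult_left_mono) auto
    qed
  qed
qed

lemma dist_bdry_outside:
  assumes \<epsilon>: "0 < \<epsilon>" and p: "p \<notin> oct b" and ne: "oct b \<noteq> {}"
  shows "ennreal \<epsilon> \<le> dist_bdry \<epsilon> (emb \<epsilon> p) (emb \<epsilon> ` oct b)" "dist_bdry \<epsilon> (emb \<epsilon> p) (emb \<epsilon> ` oct b) < \<infinity>"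
proof -
  let ?n = "\<lambda>q. \<bar>fst p - fst q\<bar> + \<bar>snd p - snd q\<bar>"
  have inj: "emb \<epsilon> q \<in> emb \<epsilon> ` oct b \<longleftrightarrow> q \<in> oct b" for q
    using inj_emb[OF \<epsilon>] by (simp add: inj_image_mem_iff)
  have d: "dist_bdry \<epsilon> (emb \<epsilon> p) (emb \<epsilon> ` oct b) = (INF q\<in>oct b. ennreal (\<epsilon> * of_int (?n q)))"
    using p inj unfolding dist_bdry_def by (simp add: l1norm_emb[OF \<epsilon>] image_comp)
  show "ennreal \<epsilon> \<le> dist_bdry \<epsilon> (emb \<epsilon> p) (emb \<epsilon> ` oct b)"
    unfolding d
  proof (rule INF_greatest)
    fix q assume "q \<in> oct b"
    then have "p \<noteq> q" using p by auto
    then have "1 \<le> ?n q" by (cases p; cases q) auto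
    then have "real_of_int 1 \<le> real_of_int (?n q)" by (simp only: of_int_le_iff)
    then have "\<epsilon> * 1 \<le> \<epsilon> * of_int (?n q)" using \<epsilon> by (intro mult_left_mono) auto
    then show "ennreal \<epsilon> \<le> ennreal (\<epsilon> * of_int (?n q))" by (intro ennreal_leI) simp
  qed
  obtain q where "q \<in> oct b" using ne by blast
  then have "(INF q\<in>oct b. ennreal (\<epsilon> * of_int (?n q))) \<le> ennreal (\<epsilon> * of_int (?n q))" by (rule INF_lower)
  then show "dist_bdry \<epsilon> (emb \<epsilon> p) (emb \<epsilon> ` oct b) < \<infinity>"
    unfolding d by (rule order_le_less_trans) simp
qed

lemma dst_props:
  assumes \<epsilon>: "0 < \<epsilon>" and ne: "oct b \<noteq> {}"
  shows "p \<in> oct b \<Longrightarrow> dst \<epsilon> b p = of_int (dep b p)" "0 \<le> dst \<epsilon> b p"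
    "dist_bdry \<epsilon> (emb \<epsilon> p) (emb \<epsilon> ` oct b) = ennreal (\<epsilon> * dst \<epsilon> b p)"
    "ennreal \<epsilon> \<le> dist_bdry \<epsilon> (emb \<epsilon> p) (emb \<epsilon> ` oct b)"
proof -
  show 0: "0 \<le> dst \<epsilon> b p" using \<epsilon> by (simp add: dst_def)
  show 1: "dst \<epsilon> b p = of_int (dep b p)" if "p \<in> oct b"
  proof -
    have "0 \<le> \<epsilon> * real_of_int (dep b p)" using \<epsilon> that by (simp add: mem_oct_iff_dep)
    then show ?thesis unfolding dst_def dist_bdry_inside[OF \<epsilon> that] using \<epsilon> by simp
  qed
  have fin: "dist_bdry \<epsilon> (emb \<epsilon> p) (emb \<epsilon> ` oct b) < \<infinity>"
    by (cases "p \<in> oct b") (simp_all add: dist_bdry_inside[OF \<epsilon>] dist_bdry_outside(2)[OF \<epsilon> _ ne, simplified])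
  then show "dist_bdry \<epsilon> (emb \<epsilon> p) (emb \<epsilon> ` oct b) = ennreal (\<epsilon> * dst \<epsilon> b p)"
    using \<epsilon> by (simp add: dst_def)
  show "ennreal \<epsilon> \<le> dist_bdry \<epsilon> (emb \<epsilon> p) (emb \<epsilon> ` oct b)"
  proof (cases "p \<in> oct b")
    case True
    then have "1 \<le> real_of_int (dep b p)" by (simp add: mem_oct_iff_dep)
    then have "\<epsilon> * 1 \<le> \<epsilon> * real_of_int (dep b p)" using \<epsilon> by (intro mult_left_mono) auto
    then show ?thesis unfolding dist_bdry_inside[OF \<epsilon> True] by (intro ennreal_leI) simp
  qed (rule dist_bdry_outside(1)[OF \<epsilon> _ ne])
qed

text \<open>With time step \<open>\<zeta> * \<epsilon>\<close> the dissipation carries the factor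
  \<open>\<epsilon> ^ 3 / (\<zeta> * \<epsilon>)\<close> and the penalty
  \<open>\<epsilon> powr \<gamma> / (\<zeta> * \<epsilon>)\<close>. Dividing by the factor
  \<open>\<epsilon>\<close> of the energy leaves the weights \<open>\<epsilon> / \<zeta>\<close> and
  \<open>\<epsilon> powr (\<gamma> - 2) / \<zeta>\<close>.\<close>

lemma functional_lift:
  assumes \<epsilon>: "0 < \<epsilon>" and \<zeta>: "0 < \<zeta>" and k: "k \<le> 1" and v: "conf N v" and ne: "oct b \<noteq> {}"
    and sub: "oct b \<subseteq> grid N" and w: "ones \<epsilon> w = emb \<epsilon> ` oct b"
  shows "functional k (\<zeta> * \<epsilon>) \<gamma> \<epsilon> (lift \<epsilon> v) w = ennreal (\<epsilon> * (en (1 - k) 0 N v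
     + \<epsilon> / \<zeta> * dis N (oct b) (dst \<epsilon> b) v + \<epsilon> powr (\<gamma> - 2) / \<zeta> * \<bar>nz N v - real (card (zeros \<epsilon> w))\<bar>))"
proof -
  let ?S = "{p. (v p = 1) \<noteq> (p \<in> oct b)}"
  have SG: "?S \<subseteq> grid N" using conf_ones_grid[OF v] sub by blast
  have "sym_diff (ones \<epsilon> (lift \<epsilon> v)) (ones \<epsilon> w) = emb \<epsilon> ` ?S"
  proof -
    have "emb \<epsilon> ` {p. v p = 1} - emb \<epsilon> ` oct b = emb \<epsilon> ` ({p. v p = 1} - oct b)"
      "emb \<epsilon> ` oct b - emb \<epsilon> ` {p. v p = 1} = emb \<epsilon> ` (oct b - {p. v p = 1})"
      using image_set_diff[OF inj_emb[OF \<epsilon>]] by blast+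
    then show ?thesis unfolding ones_lift[OF \<epsilon>] w by blast
  qed
  then have "(\<Sum>\<^sub>\<infinity>p\<in>sym_diff (ones \<epsilon> (lift \<epsilon> v)) (ones \<epsilon> w). ennreal (\<epsilon>\<^sup>2) * dist_bdry \<epsilon> p (ones \<epsilon> w))
     = (\<Sum>\<^sub>\<infinity>p\<in>?S. ennreal (\<epsilon>\<^sup>2) * dist_bdry \<epsilon> (emb \<epsilon> p) (emb \<epsilon> ` oct b))"
    unfolding w using infsum_reindex[OF inj_on_subset[OF inj_emb[OF \<epsilon>] subset_UNIV]] by (simp add: o_def)
  also have "\<dots> = (\<Sum>p\<in>?S. ennreal (\<epsilon>\<^sup>2) * dist_bdry \<epsilon> (emb \<epsilon> p) (emb \<epsilon> ` oct b))"
    by (rule infsum_finite) (rule finite_subset[OF SG finite_grid])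
  also have "\<dots> = (\<Sum>p\<in>?S. ennreal (\<epsilon> ^ 3 * dst \<epsilon> b p))"
  proof (rule sum.cong[OF refl])
    fix p
    have e: "\<epsilon> ^ 3 * dst \<epsilon> b p = \<epsilon>\<^sup>2 * (\<epsilon> * dst \<epsilon> b p)" by (simp add: power3_eq_cube power2_eq_square)
    show "ennreal (\<epsilon>\<^sup>2) * dist_bdry \<epsilon> (emb \<epsilon> p) (emb \<epsilon> ` oct b) = ennreal (\<epsilon> ^ 3 * dst \<epsilon> b p)"
      unfolding dst_props(3)[OF \<epsilon> ne] e
      by (rule ennreal_mult[symmetric]) (use \<epsilon> dst_props(2)[OF \<epsilon> ne, of p] in auto)
  qed
  also have "\<dots> = ennreal (\<Sum>p\<in>?S. \<epsilon> ^ 3 * dst \<epsilon> b p)"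
    using \<epsilon> dst_props(2)[OF \<epsilon> ne] by (intro sum_ennreal) simp
  also have "(\<Sum>p\<in>?S. \<epsilon> ^ 3 * dst \<epsilon> b p) = \<epsilon> ^ 3 * dis N (oct b) (dst \<epsilon> b) v"
  proof -
    have "dis N (oct b) (dst \<epsilon> b) v = (\<Sum>p\<in>grid N \<inter> ?S. dst \<epsilon> b p)"
    proof -
      have "(\<Sum>p\<in>grid N \<inter> ?S. dst \<epsilon> b p) = (\<Sum>p\<in>grid N. if p \<in> ?S then dst \<epsilon> b p else 0)"
        by (rule sum.inter_restrict) simp
      also have "\<dots> = dis N (oct b) (dst \<epsilon> b) v"
        unfolding dis_def by (rule sum.cong) auto
      finally show ?thesis by simp
    qed
    moreover have "grid N \<inter> ?S = ?S" using SG by blast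
    ultimately show ?thesis by (simp add: sum_distrib_left)
  qed
  finally have D: "(\<Sum>\<^sub>\<infinity>p\<in>sym_diff (ones \<epsilon> (lift \<epsilon> v)) (ones \<epsilon> w). ennreal (\<epsilon>\<^sup>2) * dist_bdry \<epsilon> p (ones \<epsilon> w))
     = ennreal (\<epsilon> ^ 3 * dis N (oct b) (dst \<epsilon> b) v)" .
  have Z: "real (card (zeros \<epsilon> (lift \<epsilon> v))) = nz N v"
  proof -
    have "{p. v p = 0} \<subseteq> grid N"
    proof
      fix p assume "p \<in> {p. v p = 0}"
      then have "\<not> (N \<le> \<bar>fst p\<bar> \<or> N \<le> \<bar>snd p\<bar>)" using conf_outside[OF v, of p] by auto
      then show "p \<in> grid N" by (cases p) (auto simp: grid_def)
    qed
    then have "grid N \<inter> {p. v p = 0} = {p. v p = 0}" by blast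
    then show ?thesis unfolding zeros_lift[OF \<epsilon>] card_emb[OF \<epsilon>] nz_def by simp
  qed
  have d0: "0 \<le> dis N (oct b) (dst \<epsilon> b) v"
    unfolding dis_def using dst_props(2)[OF \<epsilon> ne] by (intro sum_nonneg) simp
  have e0: "0 \<le> en (1 - k) 0 N v" using k by (intro en_nonneg) auto
  let ?z = "\<bar>nz N v - real (card (zeros \<epsilon> w))\<bar>"
  have "functional k (\<zeta> * \<epsilon>) \<gamma> \<epsilon> (lift \<epsilon> v) w = ennreal (\<epsilon> * en (1 - k) 0 N v)
     + ennreal (1 / (\<zeta> * \<epsilon>)) * (ennreal (\<epsilon> ^ 3 * dis N (oct b) (dst \<epsilon> b) v) + ennreal (\<epsilon> powr \<gamma> * ?z))"
    unfolding functional_def D Z energy_lift[OF \<epsilon> k v] ..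
  also have "\<dots> = ennreal (\<epsilon> * en (1 - k) 0 N v + 1 / (\<zeta> * \<epsilon>) * (\<epsilon> ^ 3 * dis N (oct b) (dst \<epsilon> b) v + \<epsilon> powr \<gamma> * ?z))"
  proof -
    let ?A = "\<epsilon> ^ 3 * dis N (oct b) (dst \<epsilon> b) v" and ?B = "\<epsilon> powr \<gamma> * ?z"
    have nn: "0 \<le> ?A" "0 \<le> ?B" using \<epsilon> d0 by simp_all
    have "ennreal ?A + ennreal ?B = ennreal (?A + ?B)" using nn by (rule ennreal_plus[symmetric])
    moreover have "ennreal (1 / (\<zeta> * \<epsilon>)) * ennreal (?A + ?B) = ennreal (1 / (\<zeta> * \<epsilon>) * (?A + ?B))"
      by (rule ennreal_mult[symmetric]) (use \<epsilon> \<zeta> nn in auto)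
    moreover have "ennreal (\<epsilon> * en (1 - k) 0 N v) + ennreal (1 / (\<zeta> * \<epsilon>) * (?A + ?B))
        = ennreal (\<epsilon> * en (1 - k) 0 N v + 1 / (\<zeta> * \<epsilon>) * (?A + ?B))"
      by (rule ennreal_plus[symmetric]) (use \<epsilon> \<zeta> nn e0 in auto)
    ultimately show ?thesis by simp
  qed
  also have "\<epsilon> * en (1 - k) 0 N v + 1 / (\<zeta> * \<epsilon>) * (\<epsilon> ^ 3 * dis N (oct b) (dst \<epsilon> b) v + \<epsilon> powr \<gamma> * ?z)
     = \<epsilon> * (en (1 - k) 0 N v + \<epsilon> / \<zeta> * dis N (oct b) (dst \<epsilon> b) v + \<epsilon> powr (\<gamma> - 2) / \<zeta> * ?z)"
  proof -
    have "\<epsilon> powr \<gamma> = \<epsilon> powr (\<gamma> - 2) * (\<epsilon> * \<epsilon>)"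
      using powr_add[of \<epsilon> "\<gamma> - 2" 2] \<epsilon> by (simp add: power2_eq_square)
    then show ?thesis using \<epsilon> \<zeta> by (simp add: field_simps power3_eq_cube)
  qed
  finally show ?thesis .
qed

text \<open>Each site of the symmetric difference contributes at least \<open>\<epsilon> ^ 3\<close>
  to the dissipation sum. The argument supplies what admissibility does not, as it bounds only the
  set of zeros.\<close>

lemma finite_ones_of_finite_functional:
  assumes \<epsilon>: "0 < \<epsilon>" and \<zeta>: "0 < \<zeta>" and ne: "oct b \<noteq> {}" and w: "ones \<epsilon> w = emb \<epsilon> ` oct b"
    and fin: "functional k (\<zeta> * \<epsilon>) \<gamma> \<epsilon> u w < \<infinity>"
  shows "finite (ones \<epsilon> u)"
proof (rule ccontr)
  assume "infinite (ones \<epsilon> u)"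
  moreover have "finite (ones \<epsilon> w)" unfolding w using finite_oct by simp
  ultimately have inf: "infinite (sym_diff (ones \<epsilon> u) (ones \<epsilon> w))" by (simp add: Diff_infinite_finite)
  have "(\<Sum>\<^sub>\<infinity>p\<in>sym_diff (ones \<epsilon> u) (ones \<epsilon> w). ennreal (\<epsilon>\<^sup>2) * dist_bdry \<epsilon> p (ones \<epsilon> w)) = \<infinity>"
  proof (rule infsum_superconst_infinite_ennreal[OF _ _ inf])
    fix x assume "x \<in> sym_diff (ones \<epsilon> u) (ones \<epsilon> w)"
    then have "x \<in> lattice_pts \<epsilon>" by (auto simp: ones_def)
    then obtain p where p: "x = emb \<epsilon> p" unfolding lattice_pts_eq by blast
    show "ennreal (\<epsilon>\<^sup>2) * ennreal \<epsilon> \<le> ennreal (\<epsilon>\<^sup>2) * dist_bdry \<epsilon> x (ones \<epsilon> w)"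
      unfolding p w using dst_props(4)[OF \<epsilon> ne] by (intro mult_left_mono) auto
  next
    show "0 < ennreal (\<epsilon>\<^sup>2) * ennreal \<epsilon>" using \<epsilon> by (simp add: ennreal_mult[symmetric])
  qed
  then have "functional k (\<zeta> * \<epsilon>) \<gamma> \<epsilon> u w = \<infinity>"
    unfolding functional_def using \<epsilon> \<zeta> by (simp add: ennreal_mult_eq_top_iff)
  then show False using fin by simp
qed

subsection \<open>One step of the scheme\<close>

lemma conf_of_finite:
  assumes "\<And>p. v p \<in> {-1, 0, 1}" "finite {p. v p \<noteq> -1}"
  shows "\<exists>N. conf N v"
proof -
  define N where "N = (\<Sum>p\<in>{p. v p \<noteq> -1}. \<bar>fst p\<bar> + \<bar>snd p\<bar>) + 1"
  have "\<bar>x\<bar> < N \<and> \<bar>y\<bar> < N" if "v (x, y) \<noteq> -1" for x y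
  proof -
    have "\<bar>fst (x, y)\<bar> + \<bar>snd (x, y)\<bar> \<le> (\<Sum>p\<in>{p. v p \<noteq> -1}. \<bar>fst p\<bar> + \<bar>snd p\<bar>)"
      using that assms(2) by (intro member_le_sum[of "(x, y)"]) auto
    then show ?thesis by (auto simp: N_def)
  qed
  then have "conf N v" unfolding conf_def using assms(1) by blast
  then show ?thesis by blast
qed

lemma finite_subset_oct: "finite S \<Longrightarrow> \<exists>M::nat. S \<subseteq> oct (\<lambda>i. b i + int M)"
proof -
  assume S: "finite S"
  define M where "M = (\<Sum>p\<in>S. \<Sum>i<8. \<bar>phi i p - b i\<bar>)"
  have M0: "0 \<le> M" unfolding M_def by (intro sum_nonneg) simp
  have "phi i p \<le> b i + M" if "p \<in> S" "i < 8" for p i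
  proof -
    have "\<bar>phi i p - b i\<bar> \<le> (\<Sum>i<8. \<bar>phi i p - b i\<bar>)" using that by (intro member_le_sum) auto
    also have "\<dots> \<le> M" unfolding M_def using that S by (intro member_le_sum) (auto intro: sum_nonneg)
    finally show ?thesis by linarith
  qed
  then show ?thesis using M0 by (intro exI[of _ "nat M"]) (auto simp: oct_def)
qed

lemma two_points: "2 \<le> card P \<Longrightarrow> \<exists>x\<in>P. \<exists>y\<in>P. x \<noteq> y"
proof -
  assume P: "2 \<le> card P"
  then have "finite P" by (intro card_ge_0_finite) simp
  then have "\<not> (\<forall>x\<in>P. \<forall>y\<in>P. x = y)" using P card_le_Suc0_iff_eq[of P] by simp
  then show ?thesis by blast
qed

lemma finite_support_lift:
  assumes "0 < \<epsilon>" "finite {p. v p = 0}" "finite (ones \<epsilon> (lift \<epsilon> v))" "\<And>p. v p \<in> {-1, 0, 1}"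
  shows "finite {p. v p \<noteq> -1}"
proof -
  have "finite {p. v p = 1}"
    using assms(1,3) unfolding ones_lift[OF assms(1)]
    by (meson finite_imageD inj_on_subset inj_emb subset_UNIV)
  moreover have "{p. v p \<noteq> -1} \<subseteq> {p. v p = 0} \<union> {p. v p = 1}" using assms(4) by auto
  ultimately show ?thesis using assms(2) by (meson finite_UnI finite_subset)
qed

lemma minimizer_is_octagon:
  fixes q kk \<Lambda> :: nat and m0 K L C :: int
  assumes k: "k < 1" and \<zeta>: "0 < \<zeta>" and \<epsilon>: "0 < \<epsilon>"
    and u0: "u0 \<in> admissible \<epsilon>" and min: "minimizer k (\<zeta> * \<epsilon>) \<gamma> \<epsilon> u0 u1"
    and oct0: "discrete_octagon \<epsilon> (ones \<epsilon> u0)"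
    and slices: "\<forall>P\<in>set (external_slices (ones \<epsilon> u0)). c / \<epsilon> \<le> real (card P)" and c2: "2 \<le> c / \<epsilon>"
    and \<beta>: "\<beta> = 1 - k" and \<eta>: "\<eta> = \<epsilon> / \<zeta>"
    and \<delta>: "\<epsilon> powr (\<gamma> - 2) / \<zeta> \<le> \<beta> / 2" "\<epsilon> powr (\<gamma> - 2) / \<zeta> \<le> (2 - 3 * \<beta>) / 2"
    and \<Lambda>: "\<beta> < real \<Lambda> * ((2 - 3 * \<beta>) / 2)"
    and L: "real_of_int L \<le> c / \<epsilon> - 1" and m0: "8 * m0 \<le> L"
    and prof0: "3 * \<beta> < \<eta> * real_of_int (m0 * (int q + 1 - int \<Lambda>))"
    and seed: "20 * \<beta> * real (4 * q + 15) < \<eta> * real_of_int m0 * real kk" "0 < kk"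
    and room: "2 * int (kk * (4 * q + 15)) + 3 * (int q + 3) + 2 \<le> m0"
    and K: "int \<Lambda> + 2 \<le> K" "K \<le> m0" "3 * \<beta> < \<eta> * real_of_int (K * (K - 2 - int \<Lambda>))"
    and K1: "\<eta> * real_of_int (K + 1) < \<beta>" and LK: "12 * K + 2 \<le> L"
    and C: "0 \<le> C" "3 * \<beta> < \<eta> * real_of_int ((L - 8 * K - 1 - int \<Lambda>) * (C + 1))"
      "\<eta> * real_of_int ((6 * K + int \<Lambda> + 2) * C) < \<beta>" "(6 * K + 1) * C + (1 + int \<Lambda> + 2 * C) * C < L - 6 * K"
  shows "discrete_octagon \<epsilon> (ones \<epsilon> u1) \<and> ones \<epsilon> u1 \<subseteq> ones \<epsilon> u0 \<and> outer_bdry \<epsilon> (ones \<epsilon> u1) = zeros \<epsilon> u1"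
proof -
  have \<beta>0: "0 < \<beta>" using k \<beta> by simp
  obtain A where A: "octagon A" "ones \<epsilon> u0 = A \<inter> lattice_pts \<epsilon>" using oct0 by (auto simp: discrete_octagon_def)
  have card2: "2 \<le> card P" if "P \<in> set (external_slices (ones \<epsilon> u0))" for P
  proof -
    have "2 \<le> real (card P)" using slices that c2 by fastforce
    then show ?thesis by linarith
  qed
  obtain x1 x2 where x: "x1 \<in> ones \<epsilon> u0" "x2 \<in> ones \<epsilon> u0" "snd x1 = snd x2" "fst x1 \<noteq> fst x2"
  proof -
    have "2 \<le> card {p \<in> ones \<epsilon> u0. \<forall>q\<in>ones \<epsilon> u0. snd p \<le> snd q}"
      by (rule card2) (simp add: external_slices_def)
    then obtain p q where pq: "p \<in> ones \<epsilon> u0" "q \<in> ones \<epsilon> u0" "snd p \<le> snd q" "snd q \<le> snd p" "p \<noteq> q"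
      using two_points by blast
    show thesis by (rule that[OF pq(1,2)]) (use pq(3-5) in \<open>simp_all add: prod_eq_iff\<close>)
  qed
  obtain y1 y2 where y: "y1 \<in> ones \<epsilon> u0" "y2 \<in> ones \<epsilon> u0" "fst y1 = fst y2" "snd y1 \<noteq> snd y2"
  proof -
    have "2 \<le> card {p \<in> ones \<epsilon> u0. \<forall>q\<in>ones \<epsilon> u0. fst p \<le> fst q}"
      by (rule card2) (simp add: external_slices_def)
    then obtain p q where pq: "p \<in> ones \<epsilon> u0" "q \<in> ones \<epsilon> u0" "fst p \<le> fst q" "fst q \<le> fst p" "p \<noteq> q"
      using two_points by blast
    show thesis by (rule that[OF pq(1,2)]) (use pq(3-5) in \<open>simp_all add: prod_eq_iff\<close>)
  qed
  obtain b0 where b0: "tight b0" "ones \<epsilon> u0 = emb \<epsilon> ` oct b0"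
    using octagon_imp_oct[OF \<epsilon> A x y] by blast
  have ne: "oct b0 \<noteq> {}" using x(1) b0(2) by auto
  have sides: "L \<le> side b0 i" if "i < 8" "even i" for i
  proof -
    have "c / \<epsilon> \<le> real_of_int (side b0 i) + 1"
      using external_slices_emb[OF \<epsilon> b0(1) _ that] slices unfolding b0(2) by blast
    then show ?thesis using L by linarith
  qed
  define F where "F u = functional k (\<zeta> * \<epsilon>) \<gamma> \<epsilon> u u0" for u
  have u1: "u1 \<in> admissible \<epsilon>" and F_min: "\<And>v. v \<in> admissible \<epsilon> \<Longrightarrow> F u1 \<le> F v"
    using min by (auto simp: minimizer_def F_def)
  obtain v0 where v0: "u0 = lift \<epsilon> v0" "\<And>p. v0 p \<in> {-1, 0, 1}" "finite {p. v0 p = 0}"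
    using admissible_imp_lift[OF \<epsilon> u0] by blast
  have "finite {p. v0 p \<noteq> -1}"
    using finite_support_lift[OF \<epsilon> v0(3) _ v0(2)] finite_oct b0(2) v0(1) by simp
  then obtain N0 where N0: "conf N0 v0" using conf_of_finite[of v0] v0(2) by blast
  have "oct b0 = {p. v0 p = 1}"
    using b0(2) unfolding v0(1) ones_lift[OF \<epsilon>] inj_image_eq_iff[OF inj_emb[OF \<epsilon>]] by simp
  then have "oct b0 \<subseteq> grid N0" using conf_ones_grid[OF N0] by blast
  \<comment> \<open>The initial datum is itself a competitor of finite value, so the minimizer has
    finitely many 1s and bounded support.\<close>
  then have "F (lift \<epsilon> v0) < \<infinity>"
    unfolding F_def using functional_lift[OF \<epsilon> \<zeta> _ N0 ne _ b0(2)] k by simp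
  then have "F u1 < \<infinity>" using F_min[OF u0] v0(1) by auto
  then have fin1: "finite (ones \<epsilon> u1)"
    unfolding F_def by (rule finite_ones_of_finite_functional[OF \<epsilon> \<zeta> ne b0(2)])
  obtain u where u: "u1 = lift \<epsilon> u" "\<And>p. u p \<in> {-1, 0, 1}" "finite {p. u p = 0}"
    using admissible_imp_lift[OF \<epsilon> u1] by blast
  have supp: "finite {p. u p \<noteq> -1}"
    using finite_support_lift[OF \<epsilon> u(3) _ u(2)] fin1 u(1) by simp
  \<comment> \<open>The minimizer is not yet known to stay inside the initial octagon, so the grid
    has to hold a larger octagon around its support, from which peeling starts.\<close>
  obtain M :: nat where M: "{p. u p \<noteq> -1} \<subseteq> oct (\<lambda>i. b0 i + int M)" using finite_subset_oct[OF supp] by blast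
  have uM: "u p \<le> cfg (\<lambda>i. b0 i + int M) p" for p
    using M u(2)[of p] by (cases "u p = -1") (auto simp: cfg_def)
  have "finite {p. cfg (\<lambda>i. b0 i + int M) p \<noteq> -1}"
    by (rule finite_subset[OF _ finite_UnI[OF finite_oct finite_oct, of "\<lambda>i. b0 i + int M" "\<lambda>i. b0 i + int M + 1"]])
       (auto simp: cfg_def split: if_splits)
  then obtain N where N: "conf N (cfg (\<lambda>i. b0 i + int M))" using conf_of_finite[of "cfg (\<lambda>i. b0 i + int M)"] cfg_values by blast
  have conf_u: "conf N u" by (rule conf_mono[OF N u(2) uM])
  have "conf N (cfg b0)" by (rule conf_cfg_mono[OF N]) simp
  then have grid0: "oct b0 \<subseteq> grid N" using conf_ones_grid cfg_eq_1_iff by blast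
  have F_lift: "F (lift \<epsilon> v) = ennreal (\<epsilon> * (en \<beta> 0 N v + \<eta> * dis N (oct b0) (dst \<epsilon> b0) v
      + \<epsilon> powr (\<gamma> - 2) / \<zeta> * \<bar>nz N v - real (card (zeros \<epsilon> u0))\<bar>))" if "conf N v" for v
    unfolding F_def \<beta> \<eta> using functional_lift[OF \<epsilon> \<zeta> _ that ne grid0 b0(2)] k by simp
  interpret minimizing \<beta> \<eta> "\<epsilon> powr (\<gamma> - 2) / \<zeta>" "real (card (zeros \<epsilon> u0))" N \<Lambda> b0 "dst \<epsilon> b0" u
  proof
    show "0 \<le> \<epsilon> powr (\<gamma> - 2) / \<zeta>" "0 < \<eta>" using \<epsilon> \<zeta> by (simp_all add: \<eta>)
    show "dst \<epsilon> b0 p = real_of_int (dep b0 p)" if "p \<in> oct b0" for p by (rule dst_props(1)[OF \<epsilon> ne that])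
    show "0 \<le> dst \<epsilon> b0 p" for p by (rule dst_props(2)[OF \<epsilon> ne])
    fix v assume v: "conf N v"
    have zf: "finite {p. v p = 0}"
    proof (rule finite_subset[OF _ finite_grid])
      show "{p. v p = 0} \<subseteq> grid N"
      proof
        fix p assume "p \<in> {p. v p = 0}"
        then have "\<not> (N \<le> \<bar>fst p\<bar> \<or> N \<le> \<bar>snd p\<bar>)" using conf_outside[OF v, of p] by auto
        then show "p \<in> grid N" by (cases p) (auto simp: grid_def)
      qed
    qed
    have "v p \<in> {-1, 0, 1}" for p using v unfolding conf_def by blast
    then have "lift \<epsilon> v \<in> admissible \<epsilon>" using lift_admissible[OF \<epsilon> _ zf] by blast
    then have "F (lift \<epsilon> u) \<le> F (lift \<epsilon> v)" using F_min u(1) by simp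
    moreover have "0 \<le> en \<beta> 0 N v + \<eta> * dis N (oct b0) (dst \<epsilon> b0) v
      + \<epsilon> powr (\<gamma> - 2) / \<zeta> * \<bar>nz N v - real (card (zeros \<epsilon> u0))\<bar>"
    proof -
      have "0 \<le> en \<beta> 0 N v" using \<beta>0 by (intro en_nonneg) auto
      moreover have "0 \<le> dis N (oct b0) (dst \<epsilon> b0) v"
        unfolding dis_def using dst_props(2)[OF \<epsilon> ne] by (intro sum_nonneg) simp
      ultimately show ?thesis using \<epsilon> \<zeta> by (simp add: \<eta>)
    qed
    ultimately have "\<epsilon> * (en \<beta> 0 N u + \<eta> * dis N (oct b0) (dst \<epsilon> b0) u
      + \<epsilon> powr (\<gamma> - 2) / \<zeta> * \<bar>nz N u - real (card (zeros \<epsilon> u0))\<bar>)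
      \<le> \<epsilon> * (en \<beta> 0 N v + \<eta> * dis N (oct b0) (dst \<epsilon> b0) v
      + \<epsilon> powr (\<gamma> - 2) / \<zeta> * \<bar>nz N v - real (card (zeros \<epsilon> u0))\<bar>)"
      unfolding F_lift[OF v] F_lift[OF conf_u] using \<epsilon> by (subst (asm) ennreal_le_iff) auto
    then show "en \<beta> 0 N u + \<eta> * dis N (oct b0) (dst \<epsilon> b0) u
      + \<epsilon> powr (\<gamma> - 2) / \<zeta> * \<bar>nz N u - real (card (zeros \<epsilon> u0))\<bar>
      \<le> en \<beta> 0 N v + \<eta> * dis N (oct b0) (dst \<epsilon> b0) v
      + \<epsilon> powr (\<gamma> - 2) / \<zeta> * \<bar>nz N v - real (card (zeros \<epsilon> u0))\<bar>"
      using \<epsilon> by simp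
  qed (use \<beta>0 \<delta> \<Lambda> conf_u in simp_all)
  obtain b where b: "tight b" "\<forall>i<8. b i \<le> b0 i" "\<forall>i<8. even i \<longrightarrow> L - 6 * K \<le> side b i" "\<forall>i<8. odd i \<longrightarrow> 1 \<le> side b i" "u = cfg b"
    using is_octagon[OF b0(1) N uM sides m0 prof0 seed room K K1 LK C] by blast
  have len: "1 \<le> side b i" if "i < 8" for i
  proof (cases "even i")
    case True
    then have "L - 6 * K \<le> side b i" using b(3) that by blast
    then show ?thesis using LK K(1) \<Lambda>_pos by linarith
  qed (use b(4) that in blast)
  have ones1: "ones \<epsilon> u1 = emb \<epsilon> ` oct b"
    unfolding u(1) b(5) ones_lift[OF \<epsilon>] by (simp add: cfg_eq_1_iff)
  have "discrete_octagon \<epsilon> (ones \<epsilon> u1)"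
    unfolding discrete_octagon_def ones1 octagon_of_lattice[OF \<epsilon>, symmetric]
    using octagon_octagon_of[OF \<epsilon> len] by blast
  moreover have "ones \<epsilon> u1 \<subseteq> ones \<epsilon> u0"
    unfolding ones1 b0(2) using oct_mono b(2) by (intro image_mono) blast
  moreover have "outer_bdry \<epsilon> (ones \<epsilon> u1) = zeros \<epsilon> u1"
    unfolding ones1 using outer_bdry_emb[OF \<epsilon> b(1) len] u(1) zeros_lift[OF \<epsilon>] b(5) by simp
  ultimately show ?thesis by blast
qed

section \<open>Smallness conditions on the lattice spacing\<close>

definition small_step :: "real \<Rightarrow> real \<Rightarrow> real \<Rightarrow> real \<Rightarrow> real \<Rightarrow> real \<Rightarrow> real \<Rightarrow> real \<Rightarrow> real \<Rightarrow> bool" where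
  "small_step \<beta> \<zeta> \<gamma> c A C R l \<epsilon> \<longleftrightarrow>
    2 \<le> c / \<epsilon> \<and> \<epsilon> powr (\<gamma> - 2) / \<zeta> \<le> \<beta> / 2 \<and> \<epsilon> powr (\<gamma> - 2) / \<zeta> \<le> (2 - 3 * \<beta>) / 2 \<and>
    c / (16 * \<zeta>) \<le> \<epsilon> / \<zeta> * ((c / \<epsilon> - 2) / 8 - 1) \<and> R \<le> (c / \<epsilon> - 2) / 8 - 1 \<and>
    l + A / sqrt \<epsilon> \<le> (c / \<epsilon> - 2) / 8 - 1 \<and> \<epsilon> / \<zeta> * (l + A / sqrt \<epsilon> + 1) < \<beta> \<and>
    12 * (l + A / sqrt \<epsilon>) + 2 \<le> c / \<epsilon> - 2 \<and>
    3 * \<beta> < \<epsilon> / \<zeta> * ((c / \<epsilon> - 2) - 8 * (l + A / sqrt \<epsilon>) - 1 - l) * (C + 1) \<and>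
    \<epsilon> / \<zeta> * ((6 * (l + A / sqrt \<epsilon>) + l + 2) * C) < \<beta> \<and>
    (6 * (l + A / sqrt \<epsilon>) + 1) * C + (1 + l + 2 * C) * C < c / \<epsilon> - 2 - 6 * (l + A / sqrt \<epsilon>)"

text \<open>The conditions are those of \<open>minimizer_is_octagon\<close>, with
  \<open>l + A / sqrt \<epsilon>\<close> as an upper bound for \<open>K\<close>, and
  \<open>c / \<epsilon> - 2\<close> and \<open>(c / \<epsilon> - 2) / 8 - 1\<close> as lower bounds
  for \<open>L\<close> and \<open>m0\<close>. They hold for small \<open>\<epsilon>\<close> because
  \<open>K\<close> is negligible against \<open>L\<close> and \<open>\<epsilon> * K\<close> tends to
  0.\<close>

lemma eventually_small_step:
  fixes \<beta> \<zeta> \<gamma> c A C R l :: real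
  assumes "0 < \<beta>" "3 * \<beta> < 2" "0 < \<zeta>" "2 < \<gamma>" "0 < c" "0 < A" "3 * \<beta> < c / (2 * \<zeta>) * (C + 1)" "0 \<le> C"
  shows "\<exists>e>0. \<forall>\<epsilon>. 0 < \<epsilon> \<and> \<epsilon> \<le> e \<longrightarrow> small_step \<beta> \<zeta> \<gamma> c A C R l \<epsilon>"
proof -
  have pos: "0 < 2 - 3 * \<beta>" "0 < \<gamma> - 2" using assms by auto
  have e1: "eventually (\<lambda>\<epsilon>. 2 \<le> c / \<epsilon>) (at_right 0)"
    using assms(5) by real_asymp
  have z: "((\<lambda>\<epsilon>. \<epsilon> powr (\<gamma> - 2) / \<zeta>) \<longlongrightarrow> 0) (at_right 0)"
    using pos(2) assms(3) by real_asymp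
  have e2: "eventually (\<lambda>\<epsilon>. \<epsilon> powr (\<gamma> - 2) / \<zeta> < \<beta> / 2) (at_right 0)"
    by (rule order_tendstoD(2)[OF z]) (use assms in simp)
  have e3: "eventually (\<lambda>\<epsilon>. \<epsilon> powr (\<gamma> - 2) / \<zeta> < (2 - 3 * \<beta>) / 2) (at_right 0)"
    by (rule order_tendstoD(2)[OF z]) (use assms in simp)
  have z4': "((\<lambda>\<epsilon>. \<epsilon> / \<zeta> * ((c / \<epsilon> - 2) / 8 - 1)) \<longlongrightarrow> inverse \<zeta> * c / 8) (at_right 0)"
    using assms(3,5) by real_asymp
  have z4: "((\<lambda>\<epsilon>. \<epsilon> / \<zeta> * ((c / \<epsilon> - 2) / 8 - 1)) \<longlongrightarrow> c / (8 * \<zeta>)) (at_right 0)"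
    using z4' by (simp add: field_simps)
  have e4: "eventually (\<lambda>\<epsilon>. c / (16 * \<zeta>) < \<epsilon> / \<zeta> * ((c / \<epsilon> - 2) / 8 - 1)) (at_right 0)"
    by (rule order_tendstoD(1)[OF z4]) (use assms in \<open>simp add: field_simps\<close>)
  have z5: "filterlim (\<lambda>\<epsilon>. (c / \<epsilon> - 2) / 8 - 1) at_top (at_right 0)" using assms(5) by real_asymp
  have e5: "eventually (\<lambda>\<epsilon>. R \<le> (c / \<epsilon> - 2) / 8 - 1) (at_right 0)"
    using z5 unfolding filterlim_at_top by blast
  have z6: "filterlim (\<lambda>\<epsilon>. (c / \<epsilon> - 2) / 8 - 1 - (l + A / sqrt \<epsilon>)) at_top (at_right 0)"
    using assms(5,6) by real_asymp
  have e6: "eventually (\<lambda>\<epsilon>. 0 \<le> (c / \<epsilon> - 2) / 8 - 1 - (l + A / sqrt \<epsilon>)) (at_right 0)"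
    using z6 unfolding filterlim_at_top by blast
  have z7: "((\<lambda>\<epsilon>. \<epsilon> / \<zeta> * (l + A / sqrt \<epsilon> + 1)) \<longlongrightarrow> 0) (at_right 0)"
    using assms(3,6) by real_asymp
  have e7: "eventually (\<lambda>\<epsilon>. \<epsilon> / \<zeta> * (l + A / sqrt \<epsilon> + 1) < \<beta>) (at_right 0)"
    by (rule order_tendstoD(2)[OF z7 assms(1)])
  have z8: "filterlim (\<lambda>\<epsilon>. c / \<epsilon> - 2 - (12 * (l + A / sqrt \<epsilon>) + 2)) at_top (at_right 0)"
    using assms(5,6) by real_asymp
  have e8: "eventually (\<lambda>\<epsilon>. 0 \<le> c / \<epsilon> - 2 - (12 * (l + A / sqrt \<epsilon>) + 2)) (at_right 0)"
    using z8 unfolding filterlim_at_top by blast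
  have z9: "((\<lambda>\<epsilon>. \<epsilon> / \<zeta> * ((c / \<epsilon> - 2) - 8 * (l + A / sqrt \<epsilon>) - 1 - l)) \<longlongrightarrow> inverse \<zeta> * c) (at_right 0)"
    using assms(3,5,6) by real_asymp
  have e9: "eventually (\<lambda>\<epsilon>. c / (2 * \<zeta>) < \<epsilon> / \<zeta> * ((c / \<epsilon> - 2) - 8 * (l + A / sqrt \<epsilon>) - 1 - l)) (at_right 0)"
    by (rule order_tendstoD(1)[OF z9]) (use assms in \<open>simp add: field_simps\<close>)
  have z10: "((\<lambda>\<epsilon>. \<epsilon> / \<zeta> * (6 * (l + A / sqrt \<epsilon>) + l + 2)) \<longlongrightarrow> 0) (at_right 0)"
    using assms(3,6) by real_asymp
  have "((\<lambda>\<epsilon>. \<epsilon> / \<zeta> * (6 * (l + A / sqrt \<epsilon>) + l + 2) * C) \<longlongrightarrow> 0 * C) (at_right 0)"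
    by (intro tendsto_mult z10 tendsto_const)
  then have e10: "eventually (\<lambda>\<epsilon>. \<epsilon> / \<zeta> * (6 * (l + A / sqrt \<epsilon>) + l + 2) * C < \<beta>) (at_right 0)"
    using order_tendstoD(2)[of _ 0 "at_right 0" \<beta>] assms(1) by simp
  \<comment> \<open>The factor \<open>\<epsilon> / c\<close> normalizes the leading term
    \<open>c / \<epsilon>\<close> to 1, and all other terms tend to 0.\<close>
  have z11: "((\<lambda>\<epsilon>. \<epsilon> / c * (c / \<epsilon> - 2 - 6 * (l + A / sqrt \<epsilon>) - (6 * (l + A / sqrt \<epsilon>) + 1) * C - (1 + l + 2 * C) * C))
      \<longlongrightarrow> 1) (at_right 0)"
  proof -
    have z: "((\<lambda>\<epsilon>. \<epsilon> / c * (c / \<epsilon> - 2 - 6 * (l + A / sqrt \<epsilon>))) \<longlongrightarrow> 1) (at_right 0)"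
        "((\<lambda>\<epsilon>. \<epsilon> / c * (6 * (l + A / sqrt \<epsilon>) + 1)) \<longlongrightarrow> 0) (at_right 0)"
        "((\<lambda>\<epsilon>. \<epsilon> / c) \<longlongrightarrow> 0) (at_right 0)"
      using assms(5,6) by real_asymp+
    have "((\<lambda>\<epsilon>. \<epsilon> / c * (c / \<epsilon> - 2 - 6 * (l + A / sqrt \<epsilon>)) - \<epsilon> / c * (6 * (l + A / sqrt \<epsilon>) + 1) * C
        - \<epsilon> / c * ((1 + l + 2 * C) * C)) \<longlongrightarrow> 1 - 0 * C - 0 * ((1 + l + 2 * C) * C)) (at_right 0)"
      by (intro tendsto_diff tendsto_mult[OF z(2) tendsto_const] tendsto_mult[OF z(3) tendsto_const] z(1))
    then show ?thesis by (simp only: right_diff_distrib mult.assoc mult_zero_left diff_0_right)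
  qed
  have e11: "eventually (\<lambda>\<epsilon>. 0 < \<epsilon> / c * (c / \<epsilon> - 2 - 6 * (l + A / sqrt \<epsilon>) - (6 * (l + A / sqrt \<epsilon>) + 1) * C - (1 + l + 2 * C) * C)) (at_right 0)"
    by (rule order_tendstoD(1)[OF z11]) simp
  have "eventually (small_step \<beta> \<zeta> \<gamma> c A C R l) (at_right 0)"
    using e1 e2 e3 e4 e5 e6 e7 e8 e9 e10 e11 eventually_at_right_less[of "0::real"]
  proof eventually_elim
    case (elim \<epsilon>)
    have "3 * \<beta> < \<epsilon> / \<zeta> * ((c / \<epsilon> - 2) - 8 * (l + A / sqrt \<epsilon>) - 1 - l) * (C + 1)"
      by (rule less_le_trans[OF assms(7)]) (use elim(9) assms(8) in \<open>intro mult_right_mono; simp\<close>)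
    moreover have "(6 * (l + A / sqrt \<epsilon>) + 1) * C + (1 + l + 2 * C) * C < c / \<epsilon> - 2 - 6 * (l + A / sqrt \<epsilon>)"
    proof -
      have "0 < \<epsilon> / c" using elim(12) assms(5) by simp
      from zero_less_mult_pos[OF elim(11) this]
      have "0 < (c / \<epsilon> - 2 - 6 * (l + A / sqrt \<epsilon>)) - (6 * (l + A / sqrt \<epsilon>) + 1) * C - (1 + l + 2 * C) * C" .
      moreover have "y + z < x" if "0 < x - y - z" for x y z :: real using that by simp
      ultimately show ?thesis by blast
    qed
    moreover have "\<epsilon> / \<zeta> * ((6 * (l + A / sqrt \<epsilon>) + l + 2) * C) < \<beta>"
      using elim(10) by (simp only: mult.assoc)
    ultimately show ?case
      unfolding small_step_def
      using elim(1,7) less_imp_le[OF elim(2)] less_imp_le[OF elim(3)] less_imp_le[OF elim(4)]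
        elim(5,6,8)[unfolded diff_ge_0_iff_ge] by blast
  qed
  then obtain e where e: "0 < e" "\<And>\<epsilon>. 0 < \<epsilon> \<Longrightarrow> \<epsilon> < e \<Longrightarrow> small_step \<beta> \<zeta> \<gamma> c A C R l \<epsilon>"
    unfolding eventually_at_right_field by blast
  show ?thesis
    by (rule exI[of _ "e / 2"]) (use e in auto)
qed

theorem lemma4p4:
  fixes k \<zeta> \<gamma> :: real
    and u0 u1 :: "real \<Rightarrow> point \<Rightarrow> real"
  assumes "1 / 3 < k" and "k < 1"
    and "0 < \<zeta>"
    and "2 < \<gamma>"
    and "\<And>\<epsilon>. 0 < \<epsilon> \<Longrightarrow> u0 \<epsilon> \<in> admissible \<epsilon>"
    and "assumption_H (\<lambda>\<epsilon>. ones \<epsilon> (u0 \<epsilon>))"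
    and "\<And>\<epsilon>. 0 < \<epsilon> \<Longrightarrow> minimizer k (\<zeta> * \<epsilon>) \<gamma> \<epsilon> (u0 \<epsilon>) (u1 \<epsilon>)"
    and "\<And>\<epsilon>. 0 < \<epsilon> \<Longrightarrow> discrete_octagon \<epsilon> (ones \<epsilon> (u0 \<epsilon>))"
  shows "\<exists>\<epsilon>b>0. \<forall>\<epsilon>. 0 < \<epsilon> \<and> \<epsilon> \<le> \<epsilon>b \<longrightarrow>
    discrete_octagon \<epsilon> (ones \<epsilon> (u1 \<epsilon>)) \<and>
    ones \<epsilon> (u1 \<epsilon>) \<subseteq> ones \<epsilon> (u0 \<epsilon>) \<and>
    outer_bdry \<epsilon> (ones \<epsilon> (u1 \<epsilon>)) = zeros \<epsilon> (u1 \<epsilon>)"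
proof -
  define \<beta> where "\<beta> = 1 - k"
  have \<beta>: "0 < \<beta>" "3 * \<beta> < 2" using assms(1,2) by (auto simp: \<beta>_def)
  obtain c where c: "0 < c" "\<And>\<epsilon>. 0 < \<epsilon> \<Longrightarrow> \<forall>P\<in>set (external_slices (ones \<epsilon> (u0 \<epsilon>))). c / \<epsilon> \<le> real (card P)"
    using assms(6) unfolding assumption_H_def by blast
  \<comment> \<open>\<open>\<eta> * m0\<close> tends to \<open>c / (8 * \<zeta>)\<close>; half of
    this limit is a lower bound independent of \<open>\<epsilon>\<close>.\<close>
  define \<kappa> where "\<kappa> = c / (16 * \<zeta>)"
  have \<kappa>: "0 < \<kappa>" using c assms(3) by (simp add: \<kappa>_def)
  obtain \<Lambda> :: nat where \<Lambda>: "\<beta> < real \<Lambda> * ((2 - 3 * \<beta>) / 2)"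
    using ex_less_of_nat_mult[of "(2 - 3 * \<beta>) / 2" \<beta>] \<beta> by auto
  \<comment> \<open>So long that the \<open>q + 1 - \<Lambda>\<close> missing cells of a layer at
    depth \<open>m0\<close> pay \<open>3 * \<beta>\<close>; then \<open>kk\<close> is the number of
    blocks per edge that the pigeonhole argument needs.\<close>
  obtain q :: nat where q: "3 * \<beta> + \<kappa> * real \<Lambda> < real q * \<kappa>"
    using ex_less_of_nat_mult[OF \<kappa>] by blast
  obtain kk :: nat where kk: "20 * \<beta> * real (4 * q + 15) < real kk * \<kappa>"
    using ex_less_of_nat_mult[OF \<kappa>] by blast
  have kk0: "0 < kk" using kk \<beta> by (intro gr0I) (auto simp: mult_less_0_iff)
  \<comment> \<open>For small \<open>\<epsilon>\<close> the factor
    \<open>\<eta> * (L - 8 * K - 1 - \<Lambda>)\<close>, with limit \<open>c / \<zeta>\<close>,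
    exceeds \<open>c / (2 * \<zeta>)\<close>.\<close>
  obtain C :: nat where C: "3 * \<beta> < real C * (c / (2 * \<zeta>))"
    using ex_less_of_nat_mult[of "c / (2 * \<zeta>)" "3 * \<beta>"] c assms(3) by auto
  \<comment> \<open>\<open>K\<close> below is about \<open>A / sqrt \<epsilon>\<close>: a layer at depth \<open>K\<close> of length at least \<open>K\<close> gains more
    dissipation, about \<open>\<epsilon> / \<zeta> * K\<^sup>2\<close>, than the energy \<open>3 * \<beta>\<close> it can cost.\<close>
  define A where "A = sqrt (3 * \<beta> * \<zeta>) + 1"
  have A: "0 < A" "3 * \<beta> * \<zeta> < A\<^sup>2"
  proof -
    have s: "0 \<le> 3 * \<beta> * \<zeta>" using \<beta> assms(3) by simp
    then show "0 < A" by (simp add: A_def add_nonneg_pos)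
    have "(sqrt (3 * \<beta> * \<zeta>))\<^sup>2 < A\<^sup>2" unfolding A_def using s by (intro power_strict_mono) auto
    then show "3 * \<beta> * \<zeta> < A\<^sup>2" using s by simp
  qed
  \<comment> \<open>Three of the four units are added in \<open>K\<close> below; the fourth covers
    the ceiling.\<close>
  define l where "l = real \<Lambda> + 4"
  define R where "R = 2 * real (kk * (4 * q + 15)) + 3 * (real q + 3) + 2"
  have C': "3 * \<beta> < c / (2 * \<zeta>) * (real C + 1)"
  proof -
    have "0 \<le> c / (2 * \<zeta>)" using c assms(3) by simp
    moreover have "c / (2 * \<zeta>) * (real C + 1) = real C * (c / (2 * \<zeta>)) + c / (2 * \<zeta>)" by (simp only: ring_distribs mult.commute mult_1)
    ultimately show ?thesis using C by linarith
  qed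
  obtain e where e: "0 < e" "\<forall>\<epsilon>. 0 < \<epsilon> \<and> \<epsilon> \<le> e \<longrightarrow> small_step \<beta> \<zeta> \<gamma> c A (real C) R l \<epsilon>"
    using eventually_small_step[OF \<beta> assms(3,4) c(1) A(1) C', of R l] by auto
  have "discrete_octagon \<epsilon> (ones \<epsilon> (u1 \<epsilon>)) \<and> ones \<epsilon> (u1 \<epsilon>) \<subseteq> ones \<epsilon> (u0 \<epsilon>) \<and> outer_bdry \<epsilon> (ones \<epsilon> (u1 \<epsilon>)) = zeros \<epsilon> (u1 \<epsilon>)"
    if \<epsilon>: "0 < \<epsilon>" "\<epsilon> \<le> e" for \<epsilon>
  proof -
    define \<eta> where "\<eta> = \<epsilon> / \<zeta>"
    have \<eta>: "0 < \<eta>" using \<epsilon> assms(3) by (simp add: \<eta>_def)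
    define K where "K = \<lceil>A / sqrt \<epsilon>\<rceil> + int \<Lambda> + 3"
    \<comment> \<open>A slice of \<open>c / \<epsilon>\<close> cells spans
      \<open>c / \<epsilon> - 1\<close> steps; \<open>L\<close> is this number rounded down.\<close>
    define L where "L = \<lfloor>c / \<epsilon>\<rfloor> - 1"
    define m0 where "m0 = L div 8"
    note E = e(2)[rule_format, OF conjI[OF \<epsilon>], unfolded small_step_def, folded \<eta>_def \<kappa>_def]
    have L: "real_of_int L \<le> c / \<epsilon> - 1" "c / \<epsilon> - 2 \<le> real_of_int L" unfolding L_def by linarith+
    have Kb: "A / sqrt \<epsilon> + real \<Lambda> + 3 \<le> real_of_int K" "real_of_int K \<le> l + A / sqrt \<epsilon>"
      unfolding K_def l_def by linarith+
    have m0: "8 * m0 \<le> L" "L \<le> 8 * m0 + 7" unfolding m0_def by presburger+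
    then have "real_of_int L \<le> real_of_int (8 * m0 + 7)" by (simp only: of_int_le_iff)
    then have m0r': "real_of_int L \<le> 8 * real_of_int m0 + 7" by simp
    have "(x - 2) / 8 - 1 \<le> m" if "x - 2 \<le> y" "y \<le> 8 * m + 7" for x y m :: real using that by (simp add: field_simps)
    from this[OF L(2) m0r'] have m0r: "(c / \<epsilon> - 2) / 8 - 1 \<le> real_of_int m0" .
    have Apos: "0 \<le> A / sqrt \<epsilon>" using A \<epsilon> by simp
    have \<kappa>m: "\<kappa> \<le> \<eta> * real_of_int m0"
    proof -
      have "\<eta> * ((c / \<epsilon> - 2) / 8 - 1) \<le> \<eta> * real_of_int m0" using m0r \<eta> by (intro mult_left_mono) auto
      then show ?thesis using E by linarith
    qed
    show ?thesis
    proof (rule minimizer_is_octagon[OF assms(2,3) \<epsilon>(1) assms(5,7,8)[OF \<epsilon>(1)] c(2)[OF \<epsilon>(1)] _ \<beta>_def \<eta>_def _ _ \<Lambda> L(1) m0(1)])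
      show "2 \<le> c / \<epsilon>" "\<epsilon> powr (\<gamma> - 2) / \<zeta> \<le> \<beta> / 2" "\<epsilon> powr (\<gamma> - 2) / \<zeta> \<le> (2 - 3 * \<beta>) / 2"
        using E by blast+
      show "3 * \<beta> < \<eta> * real_of_int (m0 * (int q + 1 - int \<Lambda>))"
      proof -
        have "0 < (real q - real \<Lambda>) * \<kappa>" using q \<beta> by (simp add: algebra_simps)
        then have ql: "real \<Lambda> < real q" using \<kappa> by (simp add: zero_less_mult_iff)
        have "3 * \<beta> < \<kappa> * (real q + 1 - real \<Lambda>)" using q \<kappa> by (simp add: algebra_simps)
        also have "\<dots> \<le> \<eta> * real_of_int m0 * (real q + 1 - real \<Lambda>)"
          using \<kappa>m ql by (intro mult_right_mono) auto
        finally show ?thesis by (simp add: mult.assoc)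
      qed
      show "20 * \<beta> * real (4 * q + 15) < \<eta> * real_of_int m0 * real kk"
      proof -
        have "real kk * \<kappa> \<le> real kk * (\<eta> * real_of_int m0)" using \<kappa>m by (intro mult_left_mono) auto
        then show ?thesis using kk by (simp add: mult.commute)
      qed
      show "0 < kk" by (rule kk0)
      show "2 * int (kk * (4 * q + 15)) + 3 * (int q + 3) + 2 \<le> m0"
      proof -
        have "R \<le> real_of_int m0" using E m0r by linarith
        moreover have "R = real_of_int (2 * int (kk * (4 * q + 15)) + 3 * (int q + 3) + 2)" by (simp add: R_def)
        ultimately show ?thesis by (simp only: of_int_le_iff)
      qed
      show "int \<Lambda> + 2 \<le> K" using Kb(1) Apos by linarith
      show "K \<le> m0"
      proof -
        have "real_of_int K \<le> real_of_int m0" using Kb(2) E m0r by linarith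
        then show ?thesis by (simp only: of_int_le_iff)
      qed
      show "3 * \<beta> < \<eta> * real_of_int (K * (K - 2 - int \<Lambda>))"
      proof -
        have "(A / sqrt \<epsilon>) * (A / sqrt \<epsilon>) \<le> real_of_int K * (real_of_int K - 2 - real \<Lambda>)"
          using Kb(1) Apos by (intro mult_mono) auto
        moreover have "(A / sqrt \<epsilon>) * (A / sqrt \<epsilon>) = A\<^sup>2 / \<epsilon>"
          using \<epsilon> by (simp add: power2_eq_square)
        ultimately have "\<eta> * (A\<^sup>2 / \<epsilon>) \<le> \<eta> * (real_of_int K * (real_of_int K - 2 - real \<Lambda>))"
          using \<eta> by (intro mult_left_mono) auto
        moreover have "\<eta> * (A\<^sup>2 / \<epsilon>) = A\<^sup>2 / \<zeta>" using \<epsilon> by (simp add: \<eta>_def)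
        moreover have "3 * \<beta> < A\<^sup>2 / \<zeta>" using A(2) assms(3) by (simp add: field_simps)
        ultimately show ?thesis by simp
      qed
      show "\<eta> * real_of_int (K + 1) < \<beta>"
      proof -
        have "\<eta> * real_of_int (K + 1) \<le> \<eta> * (l + A / sqrt \<epsilon> + 1)" using Kb(2) \<eta> by (intro mult_left_mono) auto
        then show ?thesis using E by linarith
      qed
      show "12 * K + 2 \<le> L"
      proof -
        have "real_of_int (12 * K + 2) \<le> real_of_int L" using Kb(2) E L(2) by simp
        then show ?thesis by (simp only: of_int_le_iff)
      qed
      show "0 \<le> int C" by simp
      show "3 * \<beta> < \<eta> * real_of_int ((L - 8 * K - 1 - int \<Lambda>) * (int C + 1))"
      proof -
        have "(c / \<epsilon> - 2) - 8 * (l + A / sqrt \<epsilon>) - 1 - l \<le> real_of_int (L - 8 * K - 1 - int \<Lambda>)"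
          using Kb(2) L(2) by (simp add: l_def)
        then have "\<eta> * ((c / \<epsilon> - 2) - 8 * (l + A / sqrt \<epsilon>) - 1 - l) * (real C + 1) \<le> \<eta> * real_of_int (L - 8 * K - 1 - int \<Lambda>) * (real C + 1)"
          using \<eta> by (intro mult_right_mono mult_left_mono) auto
        moreover have "\<eta> * real_of_int (L - 8 * K - 1 - int \<Lambda>) * (real C + 1) = \<eta> * real_of_int ((L - 8 * K - 1 - int \<Lambda>) * (int C + 1))"
          by simp
        ultimately show ?thesis using E by linarith
      qed
      show "\<eta> * real_of_int ((6 * K + int \<Lambda> + 2) * int C) < \<beta>"
      proof -
        have "\<eta> * ((6 * real_of_int K + real \<Lambda> + 2) * real C) \<le> \<eta> * ((6 * (l + A / sqrt \<epsilon>) + l + 2) * real C)"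
          using \<eta> Kb(2) by (intro mult_right_mono mult_left_mono) (auto simp: l_def)
        then show ?thesis using E by simp
      qed
      show "(6 * K + 1) * int C + (1 + int \<Lambda> + 2 * int C) * int C < L - 6 * K"
      proof -
        have "(6 * real_of_int K + 1) * real C \<le> (6 * (l + A / sqrt \<epsilon>) + 1) * real C"
          "(1 + real \<Lambda> + 2 * real C) * real C \<le> (1 + l + 2 * real C) * real C"
          using Kb(2) by (intro mult_right_mono; simp add: l_def)+
        then have "(6 * real_of_int K + 1) * real C + (1 + real \<Lambda> + 2 * real C) * real C
            \<le> (6 * (l + A / sqrt \<epsilon>) + 1) * real C + (1 + l + 2 * real C) * real C"
          by (rule add_mono)
        also have "\<dots> < c / \<epsilon> - 2 - 6 * (l + A / sqrt \<epsilon>)" using E by blast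
        also have "\<dots> \<le> real_of_int L - 6 * real_of_int K" using Kb(2) L(2) by (intro diff_mono mult_left_mono) simp_all
        finally have "(6 * real_of_int K + 1) * real C + (1 + real \<Lambda> + 2 * real C) * real C < real_of_int L - 6 * real_of_int K" .
        then have "real_of_int ((6 * K + 1) * int C + (1 + int \<Lambda> + 2 * int C) * int C) < real_of_int (L - 6 * K)"
          by simp
        then show ?thesis by (simp only: of_int_less_iff)
      qed
    qed
  qed
  then show ?thesis using e(1) by blast
qed

end
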